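(* There are universal constants $\eta_0,c_0>0$ with the following property. For every $\alpha\in(0,1]$ there is $C_\alpha<\infty$ such that if $w\in C^2(\mathbb{T}^2)$ has zero mean and solves $$\det(I+D^2w)=1+f,\qquad \int_{\mathbb{T}^2}f\,dx=0,$$ with $\|D^2w\|_{L^\infty}\le\eta_0$, $\|f\|_{L^\infty}\le c_0$ and $f\in C^\alpha(\mathbb{T}^2)$, then $$\|D^2w\|_{L^\infty}\le C_\alpha\|f\|_{L^\infty}\left(1+\log^+\frac{[f]_{C^\alpha}}{\|f\|_{L^\infty}}\right),$$ with the convention that the right-hand side is zero when $\|f\|_{L^\infty}=0$. Consequently, if $\varepsilon>0$, $\psi\in C^2(\mathbb{T}^2)$ has zero mean, $\rho\in C^\alpha(\mathbb{T}^2)$ satisfies $\int_{\mathbb{T}^2}\rho\,dx=0$, and $$\det(I+\varepsilon D^2\psi)=1+\varepsilon\rho,\qquad \varepsilon\|D^2\psi\|_{L^\infty}\le\eta_0,\qquad \varepsilon\|\rho\|_{L^\infty}\le c_0$$ (that is, $w=\varepsilon\psi$ and $f=\varepsilon\rho$ satisfy the hypotheses just stated for $w$ and $f$), then, with $M=\|\rho\|_{L^\infty}$, $$\|D^2\psi\|_{L^\infty}\le C_\alpha M\left(1+\log^+\frac{[\rho]_{C^\alpha}}{M}\right),$$ with the convention that the right-hand side is zero when $M=0$.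
   Context: $\mathbb{T}^2=\mathbb{R}^2/\mathbb{Z}^2$ is the flat torus with unit volume. $[f]_{C^\alpha}$ is the Hölder seminorm of exponent $\alpha$ (Lipschitz seminorm if $\alpha=1$), and $\log^+s=\max\{\log s,0\}$ (with $\log^+0=0$). *)

theory Defs
  imports "HOL-Analysis.Analysis" "HOL-Probability.Essential_Supremum"
begin

text \<open>Functions on the flat torus R^2/Z^2 are represented by their Z^2-periodic lifts to R^2.\<close>

definition int_lattice :: "(real^2) set" where
  "int_lattice = {k. \<forall>i. k $ i \<in> \<int>}"

definition torus_fun :: "(real^2 \<Rightarrow> 'b) \<Rightarrow> bool" where
  "torus_fun g \<longleftrightarrow> (\<forall>x. \<forall>k\<in>int_lattice. g (x + k) = g x)"

text \<open>The quotient distance, evaluated on representatives.\<close>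

definition torus_dist :: "real^2 \<Rightarrow> real^2 \<Rightarrow> real" where
  "torus_dist x y = infdist x {y + k |k. k \<in> int_lattice}"

text \<open>Normalised Haar measure on the torus, carried by the fundamental domain [0,1)^2.\<close>

definition torus_measure :: "(real^2) measure" where
  "torus_measure = restrict_space lborel {x. \<forall>i. 0 \<le> x $ i \<and> x $ i < 1}"

text \<open>Only meaningful for essentially bounded measurable functions (the essential supremum
  is infinite otherwise, and is then sent to 0). On matrices, \<^const>\<open>norm\<close> is the Frobenius norm.\<close>

definition Linf_norm :: "(real^2 \<Rightarrow> 'b::real_normed_vector) \<Rightarrow> real" where
  "Linf_norm g = real_of_ereal (esssup torus_measure (\<lambda>x. ereal (norm (g x))))"

definition gradient :: "(real^2 \<Rightarrow> real) \<Rightarrow> real^2 \<Rightarrow> real^2" where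
  "gradient u x = (\<chi> i. frechet_derivative u (at x) (axis i 1))"

definition hessian :: "(real^2 \<Rightarrow> real) \<Rightarrow> real^2 \<Rightarrow> real^2^2" where
  "hessian u x = jacobian (gradient u) (at x)"

definition torus_C2 :: "(real^2 \<Rightarrow> real) \<Rightarrow> bool" where
  "torus_C2 u \<longleftrightarrow> torus_fun u \<and> u differentiable_on UNIV \<and>
     gradient u differentiable_on UNIV \<and> continuous_on UNIV (hessian u)"

definition torus_holder :: "real \<Rightarrow> (real^2 \<Rightarrow> real) \<Rightarrow> bool" where
  "torus_holder \<alpha> g \<longleftrightarrow> torus_fun g \<and>
     (\<exists>K. \<forall>x y. \<bar>g x - g y\<bar> \<le> K * torus_dist x y powr \<alpha>)"

definition holder_seminorm :: "real \<Rightarrow> (real^2 \<Rightarrow> real) \<Rightarrow> real" where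
  "holder_seminorm \<alpha> g =
     Sup {\<bar>g x - g y\<bar> / torus_dist x y powr \<alpha> |x y. torus_dist x y > 0}"

definition log_plus :: "real \<Rightarrow> real" where
  "log_plus s = (if s = 0 then 0 else max (ln s) 0)"

definition log_bound :: "real \<Rightarrow> real \<Rightarrow> real" where
  "log_bound M H = (if M = 0 then 0 else M * (1 + log_plus (H / M)))"

end

theory Submission
  imports Defs "HOL-Probability.Probability" "HOL-Real_Asymp.Real_Asymp"
begin

text \<open>
  Write \<open>S\<^sub>t\<close> for averaging against a Gaussian of width \<open>t\<close>, and let \<open>g\<close> be the Laplacian of \<open>w\<close>, so that
  \<open>g = f - det D\<^sup>2w\<close> and \<open>\<partial>\<^sub>t S\<^sub>t w = t S\<^sub>t g\<close>. Integrating over \<open>t\<close>, the Hessian of \<open>w\<close> is controlled by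
  its average at one large universal scale plus the integral of \<open>\<bar>E (H(Z) g(x + tZ))\<bar> / t\<close>, where \<open>H\<close> is a
  quadratic Hermite polynomial in the standard Gaussian vector \<open>Z\<close>.
  To bound the integrand at scale \<open>t\<close>, subtract from \<open>w\<close> the quadratic polynomial with Hessian
  \<open>A = D\<^sup>2S\<^sub>t w(x)\<close>. The linear part of \<open>det (A + B)\<close> in \<open>B = D\<^sup>2w - A\<close> is integrated by parts once, and
  so is the quadratic part, because \<open>det B\<close> is a null Lagrangian; both are then at most the sup norm of \<open>D\<^sup>2w\<close>
  times the deviation of the gradient from its affine approximation at scale \<open>t\<close>. That deviation is a
  geometrically weighted sum of the same Hermite averages over smaller and larger scales. For a small
  Hessian these terms can therefore be absorbed, uniformly in the exponent, and the integrand is at most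
  a constant times the modulus of continuity of \<open>f\<close> at scale \<open>t\<close>. Its Dini integral is the logarithmic bound.
\<close>

section \<open>Gaussian averages\<close>

text \<open>The sup norm of \<open>D^2 w\<close> is not controlled by that of its Laplacian:
  second-order singular integrals are unbounded on L^infinity. So the products in the determinant
  cannot be absorbed directly in \<open>Linf_norm\<close>. What is absorbed instead is the family of
  Hermite averages of \<open>g\<close> of orders 1 to 3, measured against one majorant
  \<open>envelope\<close>. Order 1 is integrated over scales below \<open>t\<close>, order 3 over
  scales above \<open>t\<close>, and order 2 gives the Hessian.

  The loop closes because the majorant grows at most like the square root of the scale, so that
  \<open>sqrt r / r^2\<close> is integrable at infinity. To have this for every \<alpha> in (0, 1],
  the modulus of \<open>f\<close> is replaced by a multiple of \<open>u / (1 + u)\<close> with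
  \<open>u = h * t powr (\<alpha> / 2)\<close>. Its saturation matters too: a pure power would
  integrate to a power of \<open>h\<close>, not to a logarithm. All thresholds are then built from
  Gaussian moments alone, and \<alpha> enters only through the factor \<open>1 / \<alpha>\<close> of
  that integral. The average at the outer scale is a small multiple of the Hessian norm and returns
  to the left-hand side.\<close>

definition gauss :: "real measure" where
  "gauss = density lborel (\<lambda>x. ennreal (std_normal_density x))"

definition gauss2 :: "(real \<times> real) measure" where
  "gauss2 = gauss \<Otimes>\<^sub>M gauss"

definition growth :: "real \<times> real \<Rightarrow> real" where
  "growth z = 1 + \<bar>fst z\<bar> + \<bar>snd z\<bar>"

text \<open>The class is closed under sums, products and affine substitution, and its members are
  Gaussian integrable. Hermite weights and the functions they are paired with thus need no separate
  integrability arguments.\<close>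

definition tempered :: "(real \<times> real \<Rightarrow> real) \<Rightarrow> bool" where
  "tempered F \<longleftrightarrow> continuous_on UNIV F \<and> (\<exists>C k. \<forall>z. \<bar>F z\<bar> \<le> C * growth z ^ k)"

abbreviation EE :: "(real \<times> real \<Rightarrow> real) \<Rightarrow> real" where
  "EE F \<equiv> integral\<^sup>L gauss2 F"

lemma sets_gauss [measurable_cong, simp]: "sets gauss = sets borel"
  by (simp add: gauss_def)

lemma space_gauss [simp]: "space gauss = UNIV"
  by (simp add: gauss_def)

lemma sets_gauss2 [measurable_cong, simp]: "sets gauss2 = sets borel"
  unfolding gauss2_def using sets_pair_measure_cong[OF sets_gauss sets_gauss] by (simp only: borel_prod)

lemma space_gauss2 [simp]: "space gauss2 = UNIV"
  by (simp add: gauss2_def space_pair_measure)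

lemma prob_space_gauss: "prob_space gauss"
  unfolding gauss_def by (rule prob_space_normal_density) simp

interpretation gauss: prob_space gauss
  by (rule prob_space_gauss)

interpretation gauss_pair: pair_prob_space gauss gauss ..

interpretation gauss2: prob_space gauss2
  unfolding gauss2_def by (rule gauss_pair.prob_space_axioms)

lemma growth_ge_1: "1 \<le> growth z"
  by (simp add: growth_def)

lemma growth_power_mono: "m \<le> n \<Longrightarrow> growth z ^ m \<le> growth z ^ n"
  by (simp add: growth_ge_1 power_increasing)

lemma integrable_gauss_power: "integrable gauss (\<lambda>x. (1 + \<bar>x\<bar>) ^ k)"
proof -
  have "integrable lborel (\<lambda>x. \<Sum>i\<le>k. real (k choose i) * (std_normal_density x * \<bar>x\<bar> ^ i))"
    by (intro Bochner_Integration.integrable_sum integrable_mult_right integrable_std_normal_moment_abs)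
  also have "(\<lambda>x. \<Sum>i\<le>k. real (k choose i) * (std_normal_density x * \<bar>x\<bar> ^ i))
      = (\<lambda>x. std_normal_density x * (\<bar>x\<bar> + 1) ^ k)"
    by (simp add: binomial_ring sum_distrib_left mult_ac)
  finally have "integrable lborel (\<lambda>x. std_normal_density x * (1 + \<bar>x\<bar>) ^ k)"
    by (simp add: add.commute)
  then show ?thesis
    unfolding gauss_def by (subst integrable_density) (auto simp: normal_density_nonneg)
qed

text \<open>\<open>growth\<close> is at most \<open>(1 + |x|) * (1 + |y|)\<close>, which factorises,
  so Fubini leaves one-dimensional moments.\<close>

lemma integrable_growth_power: "integrable gauss2 (\<lambda>z. growth z ^ k)"
proof -
  have "integrable gauss2 (\<lambda>z. (1 + \<bar>fst z\<bar>) ^ k * (1 + \<bar>snd z\<bar>) ^ k)"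
    unfolding gauss2_def
  proof (rule gauss_pair.Fubini_integrable)
    show "integrable gauss (\<lambda>x. LINT y|gauss. norm ((1 + \<bar>fst (x, y)\<bar>) ^ k * (1 + \<bar>snd (x, y)\<bar>) ^ k))"
      using integrable_mult_left[OF integrable_gauss_power[of k]] by (simp add: abs_mult)
    show "AE x in gauss. integrable gauss (\<lambda>y. (1 + \<bar>fst (x, y)\<bar>) ^ k * (1 + \<bar>snd (x, y)\<bar>) ^ k)"
      using integrable_gauss_power[of k] by simp
  qed (measurable)
  then show ?thesis
  proof (rule Bochner_Integration.integrable_bound)
    show "(\<lambda>z. growth z ^ k) \<in> borel_measurable gauss2"
      unfolding growth_def measurable_cong_sets[OF sets_gauss2 refl]
      by (intro borel_measurable_continuous_onI continuous_intros)
    have "growth z ^ k \<le> ((1 + \<bar>fst z\<bar>) * (1 + \<bar>snd z\<bar>)) ^ k" for z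
      by (rule power_mono) (auto simp: growth_def algebra_simps)
    then show "AE z in gauss2. norm (growth z ^ k) \<le> norm ((1 + \<bar>fst z\<bar>) ^ k * (1 + \<bar>snd z\<bar>) ^ k)"
      by (auto simp: power_mult_distrib abs_mult growth_def)
  qed
qed

lemma tempered_measurable: "tempered F \<Longrightarrow> F \<in> borel_measurable gauss2"
  by (auto simp: tempered_def borel_measurable_continuous_onI cong: measurable_cong_sets)

lemma tempered_nonneg_bound:
  assumes "tempered F" obtains C k where "C \<ge> 0" "\<And>z. \<bar>F z\<bar> \<le> C * growth z ^ k"
proof -
  from assms obtain C k where *: "\<And>z. \<bar>F z\<bar> \<le> C * growth z ^ k" unfolding tempered_def by blast
  have "0 \<le> C * growth (0,0) ^ k" using *[of "(0,0)"] by linarith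
  then have "C \<ge> 0" by (simp add: growth_def)
  with * show thesis using that by blast
qed

lemma tempered_integrable:
  assumes "tempered F" shows "integrable gauss2 F"
proof -
  obtain C k where *: "\<And>z. \<bar>F z\<bar> \<le> C * growth z ^ k" "C \<ge> 0"
    using tempered_nonneg_bound[OF assms] by blast
  have "integrable gauss2 (\<lambda>z. C * growth z ^ k)"
    by (intro integrable_mult_right integrable_growth_power)
  then show ?thesis
  proof (rule Bochner_Integration.integrable_bound)
    show "AE z in gauss2. norm (F z) \<le> norm (C * growth z ^ k)"
      using * by (intro AE_I2) (simp add: order.trans[OF _ abs_ge_self])
  qed (rule tempered_measurable[OF assms])
qed

lemma temperedI: "continuous_on UNIV F \<Longrightarrow> (\<And>z. \<bar>F z\<bar> \<le> C * growth z ^ k) \<Longrightarrow> tempered F"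
  unfolding tempered_def by blast

lemma tempered_const [simp]: "tempered (\<lambda>z. c)"
  by (rule temperedI[of _ "\<bar>c\<bar>" 0]) auto

lemma tempered_fst [simp]: "tempered fst"
  by (rule temperedI[of _ 1 1]) (auto simp: growth_def intro: continuous_intros)

lemma tempered_snd [simp]: "tempered snd"
  by (rule temperedI[of _ 1 1]) (auto simp: growth_def intro: continuous_intros)

lemma tempered_growth [simp]: "tempered growth"
  by (rule temperedI[of _ 1 1]) (auto simp: growth_def[abs_def] intro!: continuous_intros)

lemma tempered_add [intro]:
  assumes "tempered F" "tempered G" shows "tempered (\<lambda>z. F z + G z)"
proof -
  obtain C k where *: "\<And>z. \<bar>F z\<bar> \<le> C * growth z ^ k" "C \<ge> 0"
    using tempered_nonneg_bound[OF assms(1)] by blast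
  obtain D l where **: "\<And>z. \<bar>G z\<bar> \<le> D * growth z ^ l" "D \<ge> 0"
    using tempered_nonneg_bound[OF assms(2)] by blast
  show ?thesis
  proof (rule temperedI[of _ "C + D" "max k l"])
    show "continuous_on UNIV (\<lambda>z. F z + G z)"
      using assms by (auto simp: tempered_def intro!: continuous_intros)
    fix z
    have "C * growth z ^ k \<le> C * growth z ^ max k l" "D * growth z ^ l \<le> D * growth z ^ max k l"
      using *(2) **(2) by (auto intro!: mult_left_mono growth_power_mono)
    then show "\<bar>F z + G z\<bar> \<le> (C + D) * growth z ^ max k l"
      using *(1)[of z] **(1)[of z] by (simp add: algebra_simps)
  qed
qed

lemma tempered_mult [intro]:
  assumes "tempered F" "tempered G" shows "tempered (\<lambda>z. F z * G z)"
proof -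
  obtain C k where *: "\<And>z. \<bar>F z\<bar> \<le> C * growth z ^ k" "C \<ge> 0"
    using tempered_nonneg_bound[OF assms(1)] by blast
  obtain D l where **: "\<And>z. \<bar>G z\<bar> \<le> D * growth z ^ l" "D \<ge> 0"
    using tempered_nonneg_bound[OF assms(2)] by blast
  show ?thesis
  proof (rule temperedI[of _ "C * D" "k + l"])
    show "continuous_on UNIV (\<lambda>z. F z * G z)"
      using assms by (auto simp: tempered_def intro!: continuous_intros)
    fix z
    have "\<bar>F z\<bar> * \<bar>G z\<bar> \<le> (C * growth z ^ k) * (D * growth z ^ l)"
      by (rule mult_mono[OF *(1) **(1)]) (use *(2) growth_ge_1[of z] in auto)
    then show "\<bar>F z * G z\<bar> \<le> (C * D) * growth z ^ (k + l)"
      by (simp add: abs_mult power_add mult_ac)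
  qed
qed

lemma tempered_uminus [intro]: "tempered F \<Longrightarrow> tempered (\<lambda>z. - F z)"
  using tempered_mult[of "\<lambda>z. -1" F] by simp

lemma tempered_diff [intro]: "tempered F \<Longrightarrow> tempered G \<Longrightarrow> tempered (\<lambda>z. F z - G z)"
  using tempered_add[OF _ tempered_uminus, of F G] by simp

lemma tempered_power [intro]: "tempered F \<Longrightarrow> tempered (\<lambda>z. F z ^ n)"
  by (induction n) auto

lemma tempered_abs [intro]: "tempered F \<Longrightarrow> tempered (\<lambda>z. \<bar>F z\<bar>)"
  unfolding tempered_def by (auto intro!: continuous_intros)

text \<open>Submultiplicativity keeps the dependence on \<open>x\<close> and \<open>t\<close> in a
  separate factor. Polynomial bounds then survive the substitution locally uniformly, which supplies
  the dominating functions below.\<close>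

lemma growth_affine: "growth (x + t *\<^sub>R z) \<le> growth x * (1 + \<bar>t\<bar>) * growth z"
proof -
  have "\<bar>fst x + t * fst z\<bar> \<le> \<bar>fst x\<bar> + \<bar>t\<bar> * \<bar>fst z\<bar>" "\<bar>snd x + t * snd z\<bar> \<le> \<bar>snd x\<bar> + \<bar>t\<bar> * \<bar>snd z\<bar>"
    by (metis abs_mult abs_triangle_ineq)+
  then have "growth (x + t *\<^sub>R z) \<le> growth x + \<bar>t\<bar> * (growth z - 1)"
    by (simp add: growth_def algebra_simps)
  also have "\<dots> \<le> growth x * growth z + \<bar>t\<bar> * (growth x * growth z)"
  proof (rule add_mono)
    show "growth x \<le> growth x * growth z"
      using mult_left_mono[OF growth_ge_1[of z], of "growth x"] growth_ge_1[of x] by simp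
    have "growth z \<le> growth x * growth z"
      using mult_right_mono[OF growth_ge_1[of x], of "growth z"] growth_ge_1[of z] by simp
    then show "\<bar>t\<bar> * (growth z - 1) \<le> \<bar>t\<bar> * (growth x * growth z)"
      by (intro mult_left_mono) auto
  qed
  finally show ?thesis by (simp add: algebra_simps)
qed

lemma tempered_affine:
  assumes "tempered h" shows "tempered (\<lambda>z. h (x + t *\<^sub>R z))"
proof -
  obtain C k where *: "\<And>z. \<bar>h z\<bar> \<le> C * growth z ^ k" "C \<ge> 0"
    using tempered_nonneg_bound[OF assms(1)] by blast
  show ?thesis
  proof (rule temperedI[of _ "C * (growth x * (1 + \<bar>t\<bar>)) ^ k" k])
    have "continuous_on UNIV h" using assms by (simp add: tempered_def)
    then show "continuous_on UNIV (\<lambda>z. h (x + t *\<^sub>R z))"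
      by (rule continuous_on_compose2) (auto intro!: continuous_intros)
    fix z
    have "growth (x + t *\<^sub>R z) ^ k \<le> (growth x * (1 + \<bar>t\<bar>) * growth z) ^ k"
      by (intro power_mono growth_affine) (use growth_ge_1[of "x + t *\<^sub>R z"] in simp)
    then show "\<bar>h (x + t *\<^sub>R z)\<bar> \<le> C * (growth x * (1 + \<bar>t\<bar>)) ^ k * growth z ^ k"
      using *(1)[of "x + t *\<^sub>R z"] mult_left_mono[OF _ *(2)]
      by (fastforce simp: power_mult_distrib mult_ac intro: order.trans)
  qed
qed

lemma EE_mono: "tempered F \<Longrightarrow> tempered G \<Longrightarrow> (\<And>z. F z \<le> G z) \<Longrightarrow> EE F \<le> EE G"
  by (intro integral_mono tempered_integrable)

lemma EE_abs_le: "tempered F \<Longrightarrow> tempered G \<Longrightarrow> (\<And>z. \<bar>F z\<bar> \<le> G z) \<Longrightarrow> \<bar>EE F\<bar> \<le> EE G"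
  by (rule order.trans[OF integral_abs_bound EE_mono]) auto

lemma EE_dominated:
  assumes "\<And>n. tempered (F n)" "tempered G" "tempered D" "\<And>n z. \<bar>F n z\<bar> \<le> D z"
    and "\<And>z. (\<lambda>n. F n z) \<longlonglongrightarrow> G z"
  shows "(\<lambda>n. EE (F n)) \<longlonglongrightarrow> EE G"
  by (rule integral_dominated_convergence[where w=D])
     (use assms in \<open>auto intro: tempered_measurable tempered_integrable\<close>)

section \<open>Gaussian integration by parts\<close>

lemma std_normal_density_DERIV:
  "(std_normal_density has_real_derivative - x * std_normal_density x) (at x)"
  unfolding std_normal_density_def[abs_def]
  by (rule derivative_eq_intros refl | simp)+

lemma std_normal_density_decay:
  "((\<lambda>x. (1 + \<bar>x\<bar>) ^ k * std_normal_density x) \<longlongrightarrow> 0) at_top"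
  "((\<lambda>x. (1 + \<bar>x\<bar>) ^ k * std_normal_density x) \<longlongrightarrow> 0) at_bot"
proof -
  show 1: "((\<lambda>x. (1 + \<bar>x\<bar>) ^ k * std_normal_density x) \<longlongrightarrow> 0) at_top"
    unfolding std_normal_density_def by real_asymp
  then show "((\<lambda>x. (1 + \<bar>x\<bar>) ^ k * std_normal_density x) \<longlongrightarrow> 0) at_bot"
    unfolding filterlim_at_bot_mirror by (simp add: std_normal_density_def)
qed

lemma gauss_integral: "f \<in> borel_measurable borel \<Longrightarrow> (LINT x|gauss. f x) = (LINT x|lborel. std_normal_density x * f x)"
  unfolding gauss_def by (subst integral_density) (auto simp: normal_density_nonneg)

lemma gauss_integrable: "f \<in> borel_measurable borel \<Longrightarrow> integrable gauss f \<longleftrightarrow> integrable lborel (\<lambda>x. std_normal_density x * f x)"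
  unfolding gauss_def by (subst integrable_density) (auto simp: normal_density_nonneg)

lemma gauss_growth_integrable:
  assumes "continuous_on UNIV f" "\<And>x. \<bar>f x\<bar> \<le> C * (1 + \<bar>x\<bar>) ^ k"
  shows "integrable gauss f"
proof (rule Bochner_Integration.integrable_bound)
  show "integrable gauss (\<lambda>x. C * (1 + \<bar>x\<bar>) ^ k)"
    by (intro integrable_mult_right integrable_gauss_power)
  show "f \<in> borel_measurable gauss"
    using assms(1) by (simp add: borel_measurable_continuous_onI cong: measurable_cong_sets)
  show "AE x in gauss. norm (f x) \<le> norm (C * (1 + \<bar>x\<bar>) ^ k)"
    using assms(2) by (intro AE_I2) (simp add: order.trans[OF _ abs_ge_self])
qed

text \<open>Stein's identity: the density p satisfies p' = -x p, so p h has derivative p h' - x p h,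
  and polynomial growth of \<open>h\<close> makes p h vanish at both ends.\<close>

lemma stein_1d:
  assumes der: "\<And>x. (h has_real_derivative h' x) (at x)"
    and cont: "continuous_on UNIV h'"
    and bound: "\<And>x. \<bar>h x\<bar> \<le> C * (1 + \<bar>x\<bar>) ^ k" "\<And>x. \<bar>h' x\<bar> \<le> D * (1 + \<bar>x\<bar>) ^ l"
  shows "(LINT x|gauss. x * h x) = (LINT x|gauss. h' x)"
proof -
  have cont_h: "continuous_on UNIV h"
    using der DERIV_isCont by (auto simp: continuous_on_eq_continuous_at)
  have C: "C \<ge> 0" using bound(1)[of 0] by simp
  have meas: "h \<in> borel_measurable borel" "h' \<in> borel_measurable borel"
    using cont cont_h by (auto intro: borel_measurable_continuous_onI)
  have int1: "integrable gauss (\<lambda>x. x * h x)"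
  proof (rule gauss_growth_integrable)
    show "continuous_on UNIV (\<lambda>x. x * h x)" using cont_h by (intro continuous_intros)
    fix x :: real
    have "\<bar>x\<bar> * \<bar>h x\<bar> \<le> (1 + \<bar>x\<bar>) * (C * (1 + \<bar>x\<bar>) ^ k)"
      by (rule mult_mono) (use bound(1) in auto)
    then show "\<bar>x * h x\<bar> \<le> C * (1 + \<bar>x\<bar>) ^ Suc k" by (simp add: abs_mult mult_ac)
  qed
  have int2: "integrable gauss h'"
    by (rule gauss_growth_integrable[OF cont bound(2)])
  let ?F = "\<lambda>x. std_normal_density x * h x"
  let ?f = "\<lambda>x. std_normal_density x * h' x - std_normal_density x * (x * h x)"
  have int: "integrable lborel ?f"
    using int1 int2 meas by (subst (asm) (1 2) gauss_integrable) auto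
  have lim: "(?F \<longlongrightarrow> 0) at_top" "(?F \<longlongrightarrow> 0) at_bot"
  proof -
    have *: "norm (?F x) \<le> C * ((1 + \<bar>x\<bar>) ^ k * std_normal_density x)" for x
      using mult_left_mono[OF bound(1)[of x], of "std_normal_density x"]
      by (simp add: abs_mult normal_density_nonneg mult_ac)
    show "(?F \<longlongrightarrow> 0) at_top" "(?F \<longlongrightarrow> 0) at_bot"
      by (rule Lim_null_comparison[OF always_eventually[OF allI[OF *]]],
          rule tendsto_mult_right_zero, rule std_normal_density_decay)+
  qed
  have "(LBINT x=-\<infinity>..\<infinity>. ?f x) = 0 - 0"
  proof (rule interval_integral_FTC_integrable)
    fix x :: real
    show "(?F has_vector_derivative ?f x) (at x)"
      unfolding has_real_derivative_iff_has_vector_derivative[symmetric]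
      by (auto intro!: derivative_eq_intros std_normal_density_DERIV der simp: algebra_simps)
    have "continuous_on UNIV ?f"
      unfolding std_normal_density_def using cont cont_h by (intro continuous_intros) auto
    then show "isCont ?f x" by (simp add: continuous_on_eq_continuous_at)
  next
    show "set_integrable lborel (einterval (- \<infinity>) \<infinity>) ?f"
      using int by (simp add: set_integrable_def)
    show "((?F \<circ> real_of_ereal) \<longlongrightarrow> 0) (at_right (- \<infinity>))"
      using lim by (simp add: ereal_tendsto_simps)
    show "((?F \<circ> real_of_ereal) \<longlongrightarrow> 0) (at_left \<infinity>)"
      using lim by (simp add: ereal_tendsto_simps)
  qed auto
  then have "integral\<^sup>L lborel ?f = 0"
    by (simp add: interval_lebesgue_integral_def set_lebesgue_integral_def)
  also have "integral\<^sup>L lborel ?f = (LINT x|gauss. h' x) - (LINT x|gauss. x * h x)"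
    using int1 int2 meas by (subst (asm) (1 2) gauss_integrable) (auto simp: gauss_integral)
  finally show ?thesis by simp
qed

lemma EE_fst:
  assumes "tempered F" shows "EE F = (LINT y|gauss. LINT x|gauss. F (x, y))"
  using gauss_pair.integral_snd[of "\<lambda>x y. F (x, y)"] tempered_integrable[OF assms] by (simp add: gauss2_def)

lemma EE_snd:
  assumes "tempered F" shows "EE F = (LINT x|gauss. LINT y|gauss. F (x, y))"
  using gauss_pair.integral_fst[of "\<lambda>x y. F (x, y)"] tempered_integrable[OF assms] by (simp add: gauss2_def)

lemma growth_le_fst: "growth (x, y) \<le> (1 + \<bar>y\<bar>) * (1 + \<bar>x\<bar>)"
  and growth_le_snd: "growth (x, y) \<le> (1 + \<bar>x\<bar>) * (1 + \<bar>y\<bar>)"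
  by (auto simp: growth_def algebra_simps)

lemma stein_fst:
  assumes "tempered F" "tempered F'" and der: "\<And>x y. ((\<lambda>x. F (x, y)) has_real_derivative F' (x, y)) (at x)"
  shows "EE (\<lambda>z. fst z * F z) = EE F'"
proof -
  have "(LINT x|gauss. x * F (x, y)) = (LINT x|gauss. F' (x, y))" for y
  proof -
    obtain C k where C: "C \<ge> 0" "\<And>z. \<bar>F z\<bar> \<le> C * growth z ^ k"
      using tempered_nonneg_bound[OF assms(1)] by blast
    obtain D l where D: "D \<ge> 0" "\<And>z. \<bar>F' z\<bar> \<le> D * growth z ^ l"
      using tempered_nonneg_bound[OF assms(2)] by blast
    have pow: "growth (x, y) ^ k \<le> (1 + \<bar>y\<bar>) ^ k * (1 + \<bar>x\<bar>) ^ k" for x k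
      using power_mono[OF growth_le_fst[of x y], of k] growth_ge_1[of "(x, y)"] by (simp add: power_mult_distrib)
    show ?thesis
    proof (rule stein_1d[OF der])
      have "continuous_on UNIV F'" using assms by (simp add: tempered_def)
      then show "continuous_on UNIV (\<lambda>x. F' (x, y))"
        by (rule continuous_on_compose2) (auto intro!: continuous_intros)
      show "\<bar>F (x, y)\<bar> \<le> (C * (1 + \<bar>y\<bar>) ^ k) * (1 + \<bar>x\<bar>) ^ k" for x
        using order.trans[OF C(2) mult_left_mono[OF pow C(1)]] by (simp add: mult_ac)
      show "\<bar>F' (x, y)\<bar> \<le> (D * (1 + \<bar>y\<bar>) ^ l) * (1 + \<bar>x\<bar>) ^ l" for x
        using order.trans[OF D(2) mult_left_mono[OF pow D(1)]] by (simp add: mult_ac)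
    qed
  qed
  then show ?thesis
    using assms by (subst (1 2) EE_fst) (auto intro: tempered_fst)
qed

lemma stein_snd:
  assumes "tempered F" "tempered F'" and der: "\<And>x y. ((\<lambda>y. F (x, y)) has_real_derivative F' (x, y)) (at y)"
  shows "EE (\<lambda>z. snd z * F z) = EE F'"
proof -
  have "(LINT y|gauss. y * F (x, y)) = (LINT y|gauss. F' (x, y))" for x
  proof -
    obtain C k where C: "C \<ge> 0" "\<And>z. \<bar>F z\<bar> \<le> C * growth z ^ k"
      using tempered_nonneg_bound[OF assms(1)] by blast
    obtain D l where D: "D \<ge> 0" "\<And>z. \<bar>F' z\<bar> \<le> D * growth z ^ l"
      using tempered_nonneg_bound[OF assms(2)] by blast
    have pow: "growth (x, y) ^ k \<le> (1 + \<bar>x\<bar>) ^ k * (1 + \<bar>y\<bar>) ^ k" for y k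
      using power_mono[OF growth_le_snd[of x y], of k] growth_ge_1[of "(x, y)"] by (simp add: power_mult_distrib)
    show ?thesis
    proof (rule stein_1d[OF der])
      have "continuous_on UNIV F'" using assms by (simp add: tempered_def)
      then show "continuous_on UNIV (\<lambda>y. F' (x, y))"
        by (rule continuous_on_compose2) (auto intro!: continuous_intros)
      show "\<bar>F (x, y)\<bar> \<le> (C * (1 + \<bar>x\<bar>) ^ k) * (1 + \<bar>y\<bar>) ^ k" for y
        using order.trans[OF C(2) mult_left_mono[OF pow[of y k] C(1)]] by (simp only: mult.assoc)
      show "\<bar>F' (x, y)\<bar> \<le> (D * (1 + \<bar>x\<bar>) ^ l) * (1 + \<bar>y\<bar>) ^ l" for y
        using order.trans[OF D(2) mult_left_mono[OF pow[of y l] D(1)]] by (simp only: mult.assoc)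
    qed
  qed
  then show ?thesis
    using assms by (subst (1 2) EE_snd) (auto intro: tempered_snd)
qed

section \<open>Hermite kernels\<close>

text \<open>The probabilists' Hermite polynomials, orthogonal for the standard Gaussian.\<close>

fun hermite :: "nat \<Rightarrow> real \<Rightarrow> real" where
  "hermite 0 x = 1"
| "hermite (Suc 0) x = x"
| "hermite (Suc (Suc n)) x = x * hermite (Suc n) x - real (Suc n) * hermite n x"

text \<open>At \<open>n = 0\<close> the truncated index \<open>n - 1\<close> is harmless, because
  its coefficient vanishes. The same convention is used in all derivative rules below.\<close>

lemma hermite_rec: "x * hermite n x = hermite (Suc n) x + real n * hermite (n - 1) x"
  by (cases n) auto

lemma hermite_DERIV: "(hermite n has_real_derivative real n * hermite (n - 1) x) (at x)"
proof (induction n rule: less_induct)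
  case (less n)
  consider "n = 0" | "n = 1" | m where "n = Suc (Suc m)"
    by (metis One_nat_def not0_implies_Suc)
  then show ?case
  proof cases
    case n: 3
    have "((\<lambda>x. x * hermite (Suc m) x - real (Suc m) * hermite m x) has_real_derivative
        (x * (real (Suc m) * hermite m x) + hermite (Suc m) x) - real (Suc m) * (real m * hermite (m - 1) x)) (at x)"
      by (rule derivative_eq_intros less.IH refl | use n in simp)+
    also have "(x * (real (Suc m) * hermite m x) + hermite (Suc m) x) - real (Suc m) * (real m * hermite (m - 1) x)
        = real (Suc m) * (x * hermite m x - real m * hermite (m - 1) x) + hermite (Suc m) x"
      by (simp only: algebra_simps)
    also have "\<dots> = real n * hermite (n - 1) x"
      using hermite_rec[of x m] n by (simp add: algebra_simps)
    finally show ?thesis using n by (simp only: hermite.simps(3)[abs_def])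
  qed (simp_all add: hermite.simps(1,2)[abs_def])
qed

lemma hermite_bound: "\<bar>hermite n x\<bar> \<le> fact n * (1 + \<bar>x\<bar>) ^ n"
proof (induction n rule: less_induct)
  case (less n)
  consider "n = 0" | "n = 1" | m where "n = Suc (Suc m)"
    by (metis One_nat_def not0_implies_Suc)
  then show ?case
  proof cases
    case 3
    let ?l = "1 + \<bar>x\<bar>"
    have *: "\<bar>hermite (Suc m) x\<bar> \<le> fact (Suc m) * ?l ^ Suc m" "\<bar>hermite m x\<bar> \<le> fact m * ?l ^ m"
      using less[of "Suc m"] less[of m] 3 by auto
    define q :: real where "q = fact (Suc m) * ?l ^ Suc (Suc m)"
    have "\<bar>hermite n x\<bar> \<le> \<bar>x\<bar> * \<bar>hermite (Suc m) x\<bar> + real (Suc m) * \<bar>hermite m x\<bar>"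
      using abs_triangle_ineq4[of "x * hermite (Suc m) x" "real (Suc m) * hermite m x"] 3 by (simp add: abs_mult)
    also have "\<dots> \<le> ?l * (fact (Suc m) * ?l ^ Suc m) + real (Suc m) * (fact m * ?l ^ m)"
      using * by (intro add_mono mult_mono) auto
    also have "?l * (fact (Suc m) * ?l ^ Suc m) = q"
      by (simp add: q_def)
    also have "real (Suc m) * (fact m * ?l ^ m) \<le> real (Suc m) * q"
    proof (rule mult_left_mono)
      show "fact m * ?l ^ m \<le> q"
        unfolding q_def by (intro mult_mono fact_mono power_increasing) auto
    qed simp
    also have "q + real (Suc m) * q = (1 + real (Suc m)) * q"
      by (simp only: distrib_right mult_1_left)
    also have "\<dots> = fact n * ?l ^ n"
      using 3 by (simp add: q_def)
    finally show ?thesis by simp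
  qed auto
qed

definition hermite2 :: "nat \<Rightarrow> nat \<Rightarrow> real \<times> real \<Rightarrow> real" where
  "hermite2 a b z = hermite a (fst z) * hermite b (snd z)"

lemma hermite2_0_0 [simp]: "hermite2 0 0 z = 1"
  by (simp add: hermite2_def)

lemma hermite2_fst: "fst z * hermite2 a b z = hermite2 (Suc a) b z + real a * hermite2 (a - 1) b z"
  using hermite_rec[of "fst z" a] by (simp add: hermite2_def mult.assoc[symmetric] distrib_right)

lemma hermite2_snd: "snd z * hermite2 a b z = hermite2 a (Suc b) z + real b * hermite2 a (b - 1) z"
  using hermite_rec[of "snd z" b] by (simp add: hermite2_def mult.left_commute[of "snd z"] distrib_left mult.left_commute[of "real b"])

lemma hermite2_bound: "\<bar>hermite2 a b z\<bar> \<le> fact a * fact b * growth z ^ (a + b)"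
proof -
  have *: "(1 + \<bar>fst z\<bar>) ^ a \<le> growth z ^ a" "(1 + \<bar>snd z\<bar>) ^ b \<le> growth z ^ b"
    by (auto intro!: power_mono simp: growth_def)
  have "\<bar>hermite2 a b z\<bar> \<le> (fact a * (1 + \<bar>fst z\<bar>) ^ a) * (fact b * (1 + \<bar>snd z\<bar>) ^ b)"
    unfolding hermite2_def abs_mult by (intro mult_mono hermite_bound) auto
  also have "\<dots> \<le> (fact a * growth z ^ a) * (fact b * growth z ^ b)"
    using * growth_ge_1[of z] by (intro mult_mono mult_left_mono) auto
  finally show ?thesis by (simp add: power_add mult_ac)
qed

lemma continuous_on_hermite: "continuous_on UNIV (hermite n)"
  using DERIV_isCont[OF hermite_DERIV] by (simp add: continuous_on_eq_continuous_at)

lemma tempered_hermite2 [simp, intro]: "tempered (hermite2 a b)"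
proof (rule temperedI[OF _ hermite2_bound])
  show "continuous_on UNIV (hermite2 a b)"
    unfolding hermite2_def[abs_def]
    by (intro continuous_intros continuous_on_compose2[OF continuous_on_hermite]) auto
qed

text \<open>The partial derivatives are arguments, not choices made by
  \<open>frechet_derivative\<close>, so that the integration by parts rules can name them.\<close>

definition C1 :: "(real \<times> real \<Rightarrow> real) \<Rightarrow> (real \<times> real \<Rightarrow> real) \<Rightarrow> (real \<times> real \<Rightarrow> real) \<Rightarrow> bool" where
  "C1 h h1 h2 \<longleftrightarrow> tempered h \<and> tempered h1 \<and> tempered h2 \<and>
     (\<forall>z. (h has_derivative (\<lambda>v. fst v * h1 z + snd v * h2 z)) (at z))"

lemma C1_tempered: "C1 h h1 h2 \<Longrightarrow> tempered h" "C1 h h1 h2 \<Longrightarrow> tempered h1" "C1 h h1 h2 \<Longrightarrow> tempered h2"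
  by (auto simp: C1_def)

lemma C1_line:
  assumes "C1 h h1 h2"
  shows "((\<lambda>s. h (p + s *\<^sub>R q)) has_real_derivative
     fst q * h1 (p + s *\<^sub>R q) + snd q * h2 (p + s *\<^sub>R q)) (at s)"
proof -
  have "((\<lambda>s. p + s *\<^sub>R q) has_derivative (\<lambda>d. d *\<^sub>R q)) (at s)"
    by (auto intro!: derivative_eq_intros)
  moreover have "(h has_derivative (\<lambda>v. fst v * h1 (p + s *\<^sub>R q) + snd v * h2 (p + s *\<^sub>R q))) (at (p + s *\<^sub>R q))"
    using assms unfolding C1_def by blast
  ultimately have "((\<lambda>s. h (p + s *\<^sub>R q)) has_derivative
      (\<lambda>d. fst (d *\<^sub>R q) * h1 (p + s *\<^sub>R q) + snd (d *\<^sub>R q) * h2 (p + s *\<^sub>R q))) (at s)"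
    by (rule has_derivative_compose)
  then show ?thesis
    by (rule has_derivative_imp_has_field_derivative) (simp add: algebra_simps)
qed

lemma C1_partial:
  assumes "C1 h h1 h2"
  shows "((\<lambda>r. h (x + t *\<^sub>R (r, y))) has_real_derivative t * h1 (x + t *\<^sub>R (r, y))) (at r)"
    and "((\<lambda>r. h (x + t *\<^sub>R (y, r))) has_real_derivative t * h2 (x + t *\<^sub>R (y, r))) (at r)"
  using C1_line[OF assms, of "x + t *\<^sub>R (0, y)" "(t, 0)" r] C1_line[OF assms, of "x + t *\<^sub>R (y, 0)" "(0, t)" r]
  by (cases x; simp add: mult.commute add.assoc)+

definition gauss_avg :: "(real \<times> real \<Rightarrow> real) \<Rightarrow> (real \<times> real \<Rightarrow> real) \<Rightarrow> real \<Rightarrow> real \<times> real \<Rightarrow> real" where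
  "gauss_avg P h t x = EE (\<lambda>z. P z * h (x + t *\<^sub>R z))"

lemma tempered_prod_affine: "tempered P \<Longrightarrow> tempered h \<Longrightarrow> tempered (\<lambda>z. P z * h (x + t *\<^sub>R z))"
  by (rule tempered_mult[OF _ tempered_affine])

text \<open>Along convergent sequences \<open>growth_affine\<close> gives a uniform bound, so
  dominated convergence applies. The limit \<open>t = 0\<close> is included: this is how values of
  \<open>h\<close> itself are recovered from its averages.\<close>

lemma gauss_avg_tendsto:
  assumes "tempered P" "tempered h" "X \<longlonglongrightarrow> x" "T \<longlonglongrightarrow> t"
  shows "(\<lambda>n. gauss_avg P h (T n) (X n)) \<longlonglongrightarrow> gauss_avg P h t x"
proof -
  obtain C k where C: "C \<ge> 0" "\<And>z. \<bar>h z\<bar> \<le> C * growth z ^ k"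
    using tempered_nonneg_bound[OF assms(2)] by blast
  have "(\<lambda>n. growth (X n) * (1 + \<bar>T n\<bar>)) \<longlonglongrightarrow> growth x * (1 + \<bar>t\<bar>)"
    unfolding growth_def by (intro tendsto_intros assms)
  from convergentI[OF this, THEN convergent_imp_Bseq]
  obtain B where B: "\<And>n. norm (growth (X n) * (1 + \<bar>T n\<bar>)) \<le> B"
    unfolding Bseq_def by blast
  have B': "growth (X n + T n *\<^sub>R z) ^ k \<le> (B * growth z) ^ k" for n z
  proof (rule power_mono)
    have "growth (X n + T n *\<^sub>R z) \<le> growth (X n) * (1 + \<bar>T n\<bar>) * growth z" by (rule growth_affine)
    also have "\<dots> \<le> B * growth z"
      using B[of n] growth_ge_1[of z] by (intro mult_right_mono) auto
    finally show "growth (X n + T n *\<^sub>R z) \<le> B * growth z" .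
  qed (use growth_ge_1[of "X n + T n *\<^sub>R z"] in simp)
  show ?thesis
    unfolding gauss_avg_def
  proof (rule EE_dominated[where D = "\<lambda>z. \<bar>P z\<bar> * (C * (B * growth z) ^ k)"])
    show "tempered (\<lambda>z. \<bar>P z\<bar> * (C * (B * growth z) ^ k))"
      by (intro tempered_mult tempered_power tempered_abs tempered_const tempered_growth assms)
    fix n z
    show "\<bar>P z * h (X n + T n *\<^sub>R z)\<bar> \<le> \<bar>P z\<bar> * (C * (B * growth z) ^ k)"
      unfolding abs_mult
      by (intro mult_left_mono order.trans[OF C(2)] B' C) auto
  next
    fix z
    have "isCont h (x + t *\<^sub>R z)"
      using assms(2) by (metis tempered_def continuous_on_eq_continuous_at open_UNIV UNIV_I)
    from isCont_tendsto_compose[OF this tendsto_add[OF assms(3) tendsto_scaleR[OF assms(4) tendsto_const]]]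
    show "(\<lambda>n. P z * h (X n + T n *\<^sub>R z)) \<longlonglongrightarrow> P z * h (x + t *\<^sub>R z)"
      by (rule tendsto_mult_left)
  qed (rule tempered_prod_affine[OF assms(1,2)])+
qed

lemma gauss_avg_continuous:
  assumes "tempered P" "tempered h" shows "continuous_on UNIV (\<lambda>x. gauss_avg P h t x)"
  unfolding continuous_on_sequentially comp_def
  by (auto intro!: gauss_avg_tendsto assms)

lemma gauss_avg_continuous_t:
  assumes "tempered P" "tempered h" shows "continuous_on S (\<lambda>t. gauss_avg P h t x)"
  unfolding continuous_on_sequentially comp_def
  by (auto intro!: gauss_avg_tendsto assms)

lemma tempered_gauss_avg [intro]:
  assumes "tempered P" "tempered h" shows "tempered (gauss_avg P h t)"
proof -
  obtain C k where C: "C \<ge> 0" "\<And>z. \<bar>h z\<bar> \<le> C * growth z ^ k"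
    using tempered_nonneg_bound[OF assms(2)] by blast
  show ?thesis
  proof (rule temperedI)
    show "continuous_on UNIV (gauss_avg P h t)" using gauss_avg_continuous[OF assms] by simp
    fix x
    have "\<bar>gauss_avg P h t x\<bar> \<le> EE (\<lambda>z. (C * growth x ^ k) * (\<bar>P z\<bar> * ((1 + \<bar>t\<bar>) * growth z) ^ k))"
      unfolding gauss_avg_def
    proof (rule EE_abs_le)
      show "tempered (\<lambda>z. (C * growth x ^ k) * (\<bar>P z\<bar> * ((1 + \<bar>t\<bar>) * growth z) ^ k))"
        by (intro tempered_mult tempered_power tempered_abs tempered_const tempered_growth assms)
      fix z
      have "growth (x + t *\<^sub>R z) ^ k \<le> (growth x * (1 + \<bar>t\<bar>) * growth z) ^ k"
        by (intro power_mono growth_affine) (use growth_ge_1[of "x + t *\<^sub>R z"] in simp)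
      then have "\<bar>h (x + t *\<^sub>R z)\<bar> \<le> C * (growth x * (1 + \<bar>t\<bar>) * growth z) ^ k"
        using order.trans[OF C(2) mult_left_mono[OF _ C(1)]] by blast
      then have "\<bar>P z\<bar> * \<bar>h (x + t *\<^sub>R z)\<bar> \<le> \<bar>P z\<bar> * (C * (growth x * (1 + \<bar>t\<bar>) * growth z) ^ k)"
        by (rule mult_left_mono) simp
      then show "\<bar>P z * h (x + t *\<^sub>R z)\<bar> \<le> (C * growth x ^ k) * (\<bar>P z\<bar> * ((1 + \<bar>t\<bar>) * growth z) ^ k)"
        by (simp add: abs_mult power_mult_distrib mult_ac)
    qed (rule tempered_prod_affine[OF assms])
    then show "\<bar>gauss_avg P h t x\<bar> \<le> (C * EE (\<lambda>z. \<bar>P z\<bar> * ((1 + \<bar>t\<bar>) * growth z) ^ k)) * growth x ^ k"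
      unfolding integral_mult_right_zero by (simp only: mult_ac)
  qed
qed

text \<open>Scale and point move together, so one computation serves twice:
  \<open>\<tau> = 0\<close> gives the space derivatives, \<open>u = 0\<close> and
  \<open>\<tau> = 1\<close> the derivative in the scale. The factors
  \<open>fst u + \<tau> * fst z\<close> and \<open>snd u + \<tau> * snd z\<close> are the velocity
  of the sampling point.\<close>

lemma gauss_avg_derivative:
  assumes P: "tempered P" and h: "C1 h h1 h2"
  shows "((\<lambda>s. gauss_avg P h (t + s * \<tau>) (x + s *\<^sub>R u)) has_real_derivative
     gauss_avg (\<lambda>z. P z * (fst u + \<tau> * fst z)) h1 (t + s * \<tau>) (x + s *\<^sub>R u)
     + gauss_avg (\<lambda>z. P z * (snd u + \<tau> * snd z)) h2 (t + s * \<tau>) (x + s *\<^sub>R u)) (at s)"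
proof -
  let ?p = "\<lambda>s z. (x + s *\<^sub>R u) + (t + s * \<tau>) *\<^sub>R z"
  let ?d = "\<lambda>s z. (fst u + \<tau> * fst z) * h1 (?p s z) + (snd u + \<tau> * snd z) * h2 (?p s z)"
  note tempered = C1_tempered[OF h]
  obtain C1 k1 where C1: "C1 \<ge> 0" "\<And>z. \<bar>h1 z\<bar> \<le> C1 * growth z ^ k1"
    using tempered_nonneg_bound[OF tempered(2)] by blast
  obtain C2 k2 where C2: "C2 \<ge> 0" "\<And>z. \<bar>h2 z\<bar> \<le> C2 * growth z ^ k2"
    using tempered_nonneg_bound[OF tempered(3)] by blast
  have line: "((\<lambda>s. h (?p s z)) has_real_derivative ?d s z) (at s)" for s z
    using C1_line[OF h, of "x + t *\<^sub>R z" "u + \<tau> *\<^sub>R z" s] by (simp add: algebra_simps)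
  have tempered_fst': "tempered (\<lambda>z. P z * (fst u + \<tau> * fst z))" and tempered_snd': "tempered (\<lambda>z. P z * (snd u + \<tau> * snd z))"
    by (rule tempered_mult[OF P]; rule tempered_add[OF tempered_const]; rule tempered_mult[OF tempered_const]; rule tempered_fst tempered_snd)+
  have "((\<lambda>r. (gauss_avg P h (t + r * \<tau>) (x + r *\<^sub>R u) - gauss_avg P h (t + s * \<tau>) (x + s *\<^sub>R u)) / (r - s))
     \<longlongrightarrow> EE (\<lambda>z. P z * ?d s z)) (at s)"
    unfolding tendsto_at_iff_sequentially
  proof (intro allI impI)
    fix R :: "nat \<Rightarrow> real" assume R: "\<forall>i. R i \<in> UNIV - {s}" "R \<longlonglongrightarrow> s"
    from convergentI[OF R(2), THEN convergent_imp_Bseq]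
    obtain B where B: "\<And>n. \<bar>R n\<bar> \<le> B"
      unfolding Bseq_def real_norm_def by blast
    have B0: "B \<ge> 0" using B[of 0] by linarith
    have Bs: "\<bar>s\<bar> \<le> B"
      using tendsto_upperbound[OF tendsto_rabs[OF R(2)] always_eventually] B by auto
    \<comment> \<open>Valid for all parameters up to \<open>B\<close> at once, because the
      intermediate points of the mean value theorem vary with \<open>n\<close> and
      \<open>z\<close>.\<close>
    define L where "L = (growth x * (1 + B) * growth u) * (1 + (\<bar>t\<bar> + B * \<bar>\<tau>\<bar>))"
    have L: "growth (?p r z) \<le> L * growth z" if r: "\<bar>r\<bar> \<le> B" for r z
    proof -
      have "\<bar>t + r * \<tau>\<bar> \<le> \<bar>t\<bar> + \<bar>r\<bar> * \<bar>\<tau>\<bar>" by (metis abs_mult abs_triangle_ineq)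
      also have "\<dots> \<le> \<bar>t\<bar> + B * \<bar>\<tau>\<bar>" using r by (intro add_mono mult_right_mono) auto
      finally have t': "\<bar>t + r * \<tau>\<bar> \<le> \<bar>t\<bar> + B * \<bar>\<tau>\<bar>" .
      have "growth (x + r *\<^sub>R u) \<le> growth x * (1 + \<bar>r\<bar>) * growth u" by (rule growth_affine)
      also have "\<dots> \<le> growth x * (1 + B) * growth u"
        using r growth_ge_1[of x] growth_ge_1[of u] by (intro mult_right_mono mult_left_mono) auto
      finally have x': "growth (x + r *\<^sub>R u) \<le> growth x * (1 + B) * growth u" .
      have "growth (?p r z) \<le> growth (x + r *\<^sub>R u) * (1 + \<bar>t + r * \<tau>\<bar>) * growth z" by (rule growth_affine)
      also have "\<dots> \<le> L * growth z"
        unfolding L_def using x' t' growth_ge_1[of z] growth_ge_1[of "x + r *\<^sub>R u"]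
        by (intro mult_right_mono mult_mono add_mono) auto
      finally show ?thesis .
    qed
    define D where "D z = \<bar>P z\<bar> * ((\<bar>fst u + \<tau> * fst z\<bar>) * (C1 * (L * growth z) ^ k1)
        + \<bar>snd u + \<tau> * snd z\<bar> * (C2 * (L * growth z) ^ k2))" for z
    have tempered_D: "tempered D"
      unfolding D_def[abs_def] using P by (intro tempered_mult tempered_add tempered_power tempered_abs tempered_const tempered_fst tempered_snd tempered_growth)
    have dD: "\<bar>P z * ?d r z\<bar> \<le> D z" if "\<bar>r\<bar> \<le> B" for r z
    proof -
      have pw: "growth (?p r z) ^ k \<le> (L * growth z) ^ k" for k
        by (rule power_mono[OF L[OF that]]) (use growth_ge_1[of "?p r z"] in simp)
      have "\<bar>?d r z\<bar> \<le> \<bar>fst u + \<tau> * fst z\<bar> * \<bar>h1 (?p r z)\<bar> + \<bar>snd u + \<tau> * snd z\<bar> * \<bar>h2 (?p r z)\<bar>"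
        using abs_triangle_ineq by (simp add: abs_mult[symmetric])
      also have "\<dots> \<le> (\<bar>fst u + \<tau> * fst z\<bar>) * (C1 * (L * growth z) ^ k1)
        + \<bar>snd u + \<tau> * snd z\<bar> * (C2 * (L * growth z) ^ k2)"
        by (intro add_mono mult_left_mono order.trans[OF C1(2)] order.trans[OF C2(2)] pw C1 C2) auto
      finally show ?thesis unfolding D_def abs_mult by (intro mult_left_mono) auto
    qed
    have "(\<lambda>n. EE (\<lambda>z. P z * ((h (?p (R n) z) - h (?p s z)) / (R n - s)))) \<longlonglongrightarrow> EE (\<lambda>z. P z * ?d s z)"
    proof (rule EE_dominated[where D = D])
      fix n
      have "tempered (\<lambda>z. (1 / (R n - s)) * (P z * h (?p (R n) z) - P z * h (?p s z)))"
        by (rule tempered_mult[OF tempered_const tempered_diff[OF tempered_prod_affine[OF P tempered(1)] tempered_prod_affine[OF P tempered(1)]]])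
      then show "tempered (\<lambda>z. P z * ((h (?p (R n) z) - h (?p s z)) / (R n - s)))"
        by (simp add: algebra_simps diff_divide_distrib)
    next
      have "tempered (\<lambda>z. P z * (fst u + \<tau> * fst z) * h1 (?p s z) + P z * (snd u + \<tau> * snd z) * h2 (?p s z))"
        by (rule tempered_add[OF tempered_prod_affine[OF tempered_fst' tempered(2)] tempered_prod_affine[OF tempered_snd' tempered(3)]])
      also have "(\<lambda>z. P z * (fst u + \<tau> * fst z) * h1 (?p s z) + P z * (snd u + \<tau> * snd z) * h2 (?p s z))
          = (\<lambda>z. P z * ?d s z)"
        by (rule ext) (simp only: algebra_simps)
      finally show "tempered (\<lambda>z. P z * ?d s z)" .
    next
      fix n z
      \<comment> \<open>The mean value theorem turns a difference quotient into a derivative at an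
        intermediate parameter, where \<open>dD\<close> applies.\<close>
      have "\<exists>r. \<bar>r\<bar> \<le> B \<and> (h (?p (R n) z) - h (?p s z)) / (R n - s) = ?d r z"
      proof (cases "R n < s")
        case True
        have "\<exists>r>R n. r < s \<and> h (?p s z) - h (?p (R n) z) = (s - R n) * ?d r z"
          by (rule MVT2[OF True]) (rule line)
        then obtain r where r: "R n < r" "r < s" "h (?p s z) - h (?p (R n) z) = (s - R n) * ?d r z"
          by blast
        then have eq: "h (?p (R n) z) - h (?p s z) = ?d r z * (R n - s)"
          by (simp only: left_diff_distrib right_diff_distrib mult.commute)
        have "\<bar>r\<bar> \<le> B" using r(1,2) B[of n] Bs by linarith
        then show ?thesis
          unfolding eq using True by (intro exI[of _ r]) simp
      next
        case False
        then have gt: "s < R n" using R(1)[rule_format, of n] by simp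
        have "\<exists>r>s. r < R n \<and> h (?p (R n) z) - h (?p s z) = (R n - s) * ?d r z"
          by (rule MVT2[OF gt]) (rule line)
        then obtain r where r: "s < r" "r < R n" "h (?p (R n) z) - h (?p s z) = (R n - s) * ?d r z"
          by blast
        have "\<bar>r\<bar> \<le> B" using r(1,2) B[of n] Bs by linarith
        then show ?thesis
          unfolding r(3) using gt by (intro exI[of _ r]) simp
      qed
      then show "\<bar>P z * ((h (?p (R n) z) - h (?p s z)) / (R n - s))\<bar> \<le> D z"
        using dD by (elim exE conjE) (simp only:)
    next
      fix z
      have "((\<lambda>r. (h (?p r z) - h (?p s z)) / (r - s)) \<longlongrightarrow> ?d s z) (at s)"
        using line[of z s] unfolding has_field_derivative_iff .
      then have "(\<lambda>n. (h (?p (R n) z) - h (?p s z)) / (R n - s)) \<longlonglongrightarrow> ?d s z"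
        using R unfolding tendsto_at_iff_sequentially comp_def by blast
      then show "(\<lambda>n. P z * ((h (?p (R n) z) - h (?p s z)) / (R n - s))) \<longlonglongrightarrow> P z * ?d s z"
        by (rule tendsto_mult_left)
    qed (rule tempered_D)
    moreover have "EE (\<lambda>z. P z * ((h (?p (R n) z) - h (?p s z)) / (R n - s)))
      = (gauss_avg P h (t + R n * \<tau>) (x + R n *\<^sub>R u) - gauss_avg P h (t + s * \<tau>) (x + s *\<^sub>R u)) / (R n - s)" for n
    proof -
      have "(\<lambda>z. P z * ((h (?p (R n) z) - h (?p s z)) / (R n - s)))
        = (\<lambda>z. (P z * h (?p (R n) z) - P z * h (?p s z)) / (R n - s))"
        by (rule ext) (simp only: right_diff_distrib times_divide_eq_right)
      moreover have "EE (\<lambda>z. P z * h (?p (R n) z) - P z * h (?p s z))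
          = EE (\<lambda>z. P z * h (?p (R n) z)) - EE (\<lambda>z. P z * h (?p s z))"
        by (rule Bochner_Integration.integral_diff[OF tempered_integrable[OF tempered_prod_affine[OF P tempered(1)]] tempered_integrable[OF tempered_prod_affine[OF P tempered(1)]]])
      ultimately show ?thesis by (simp only: gauss_avg_def integral_divide_zero)
    qed
    ultimately show "((\<lambda>r. (gauss_avg P h (t + r * \<tau>) (x + r *\<^sub>R u) - gauss_avg P h (t + s * \<tau>) (x + s *\<^sub>R u)) / (r - s)) \<circ> R)
      \<longlonglongrightarrow> EE (\<lambda>z. P z * ?d s z)"
      by (simp only: comp_def)
  qed
  moreover have "EE (\<lambda>z. P z * ?d s z) =
     gauss_avg (\<lambda>z. P z * (fst u + \<tau> * fst z)) h1 (t + s * \<tau>) (x + s *\<^sub>R u)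
     + gauss_avg (\<lambda>z. P z * (snd u + \<tau> * snd z)) h2 (t + s * \<tau>) (x + s *\<^sub>R u)"
  proof -
    have "(\<lambda>z. P z * ?d s z) = (\<lambda>z. P z * (fst u + \<tau> * fst z) * h1 (?p s z)
        + P z * (snd u + \<tau> * snd z) * h2 (?p s z))"
      by (rule ext) (simp only: algebra_simps)
    then have "EE (\<lambda>z. P z * ?d s z) = EE (\<lambda>z. P z * (fst u + \<tau> * fst z) * h1 (?p s z)
        + P z * (snd u + \<tau> * snd z) * h2 (?p s z))"
      by (simp only:)
    also have "\<dots> = EE (\<lambda>z. P z * (fst u + \<tau> * fst z) * h1 (?p s z))
        + EE (\<lambda>z. P z * (snd u + \<tau> * snd z) * h2 (?p s z))"
      by (rule Bochner_Integration.integral_add[OF tempered_integrable[OF tempered_prod_affine[OF tempered_fst' tempered(2)]] tempered_integrable[OF tempered_prod_affine[OF tempered_snd' tempered(3)]]])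
    finally show ?thesis unfolding gauss_avg_def .
  qed
  ultimately show ?thesis
    unfolding has_field_derivative_iff by (simp only:)
qed

section \<open>Heat smoothing\<close>

lemma tempered_hermite2_h: "tempered h \<Longrightarrow> tempered (\<lambda>z. hermite2 a b z * h (x + t *\<^sub>R z))"
  by (rule tempered_prod_affine[OF tempered_hermite2])

lemma hermite_DERIV_chain: "((\<lambda>r. hermite2 a b (r, y)) has_real_derivative real a * hermite2 (a - 1) b (r, y)) (at r)"
  "((\<lambda>r. hermite2 a b (y, r)) has_real_derivative real b * hermite2 a (b - 1) (y, r)) (at r)"
  using DERIV_cmult_right[OF hermite_DERIV[of a r], of "hermite b y"] DERIV_cmult[OF hermite_DERIV[of b r], of "hermite a y"]
  by (simp_all add: hermite2_def mult.assoc mult.left_commute)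

text \<open>Stein's identity for \<open>hermite2 a b z * F z\<close> produces a term with the
  lowered index \<open>a - 1\<close>; it is exactly the term separating
  \<open>fst z * hermite2 a b z\<close> from \<open>hermite2 (Suc a) b z\<close>, so it
  cancels.\<close>

lemma stein_hermite2_fst:
  assumes F: "tempered F" "tempered F'" and der: "\<And>x y. ((\<lambda>x. F (x, y)) has_real_derivative F' (x, y)) (at x)"
  shows "EE (\<lambda>z. hermite2 (Suc a) b z * F z) = EE (\<lambda>z. hermite2 a b z * F' z)"
proof -
  have tempered: "tempered (\<lambda>z. hermite2 a b z * F z)" "tempered (\<lambda>z. real a * (hermite2 (a - 1) b z * F z))" "tempered (\<lambda>z. hermite2 a b z * F' z)"
    "tempered (\<lambda>z. hermite2 (Suc a) b z * F z)"
    by (intro tempered_mult tempered_hermite2 tempered_const F)+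
  have "EE (\<lambda>z. fst z * (hermite2 a b z * F z)) = EE (\<lambda>z. real a * (hermite2 (a - 1) b z * F z) + hermite2 a b z * F' z)"
  proof (rule stein_fst[OF tempered(1) tempered_add[OF tempered(2,3)]])
    fix x y
    have "((\<lambda>x. F (x, y)) has_real_derivative F' (x, y)) (at x)" by (rule der)
    from DERIV_mult[OF hermite_DERIV_chain(1)[of a b y x] this]
    show "((\<lambda>x. hermite2 a b (x, y) * F (x, y)) has_real_derivative
        real a * (hermite2 (a - 1) b (x, y) * F (x, y)) + hermite2 a b (x, y) * F' (x, y)) (at x)"
      by (simp add: mult_ac)
  qed
  moreover have "(\<lambda>z. fst z * (hermite2 a b z * F z)) = (\<lambda>z. hermite2 (Suc a) b z * F z + real a * (hermite2 (a - 1) b z * F z))"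
    by (simp add: mult.assoc[symmetric] hermite2_fst distrib_right)
  ultimately have "EE (\<lambda>z. hermite2 (Suc a) b z * F z + real a * (hermite2 (a - 1) b z * F z))
      = EE (\<lambda>z. real a * (hermite2 (a - 1) b z * F z) + hermite2 a b z * F' z)"
    by (simp only:)
  then show ?thesis
    unfolding Bochner_Integration.integral_add[OF tempered_integrable[OF tempered(4)] tempered_integrable[OF tempered(2)]]
      Bochner_Integration.integral_add[OF tempered_integrable[OF tempered(2)] tempered_integrable[OF tempered(3)]]
    by simp
qed

lemma stein_hermite2_snd:
  assumes F: "tempered F" "tempered F'" and der: "\<And>x y. ((\<lambda>y. F (x, y)) has_real_derivative F' (x, y)) (at y)"
  shows "EE (\<lambda>z. hermite2 a (Suc b) z * F z) = EE (\<lambda>z. hermite2 a b z * F' z)"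
proof -
  have tempered: "tempered (\<lambda>z. hermite2 a b z * F z)" "tempered (\<lambda>z. real b * (hermite2 a (b - 1) z * F z))" "tempered (\<lambda>z. hermite2 a b z * F' z)"
    "tempered (\<lambda>z. hermite2 a (Suc b) z * F z)"
    by (intro tempered_mult tempered_hermite2 tempered_const F)+
  have "EE (\<lambda>z. snd z * (hermite2 a b z * F z)) = EE (\<lambda>z. real b * (hermite2 a (b - 1) z * F z) + hermite2 a b z * F' z)"
  proof (rule stein_snd[OF tempered(1) tempered_add[OF tempered(2,3)]])
    fix x y
    have "((\<lambda>y. F (x, y)) has_real_derivative F' (x, y)) (at y)" by (rule der)
    from DERIV_mult[OF hermite_DERIV_chain(2)[of a b x y] this]
    show "((\<lambda>y. hermite2 a b (x, y) * F (x, y)) has_real_derivative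
        real b * (hermite2 a (b - 1) (x, y) * F (x, y)) + hermite2 a b (x, y) * F' (x, y)) (at y)"
      using DERIV_mult[OF hermite_DERIV_chain(2) der, of a b x y x] by (simp add: mult_ac)
  qed
  moreover have "(\<lambda>z. snd z * (hermite2 a b z * F z)) = (\<lambda>z. hermite2 a (Suc b) z * F z + real b * (hermite2 a (b - 1) z * F z))"
    by (simp add: mult.assoc[symmetric] hermite2_snd distrib_right)
  ultimately have "EE (\<lambda>z. hermite2 a (Suc b) z * F z + real b * (hermite2 a (b - 1) z * F z))
      = EE (\<lambda>z. real b * (hermite2 a (b - 1) z * F z) + hermite2 a b z * F' z)"
    by (simp only:)
  then show ?thesis
    unfolding Bochner_Integration.integral_add[OF tempered_integrable[OF tempered(4)] tempered_integrable[OF tempered(2)]]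
      Bochner_Integration.integral_add[OF tempered_integrable[OF tempered(2)] tempered_integrable[OF tempered(3)]]
    by simp
qed

text \<open>A Hermite index is worth one derivative and a factor \<open>t\<close>. Read from right
  to left, this is the integration by parts that takes a derivative off \<open>h1\<close> or
  \<open>h2\<close>.\<close>

lemma gauss_avg_hermite2_shift:
  assumes "C1 h h1 h2"
  shows "gauss_avg (hermite2 (Suc a) b) h t x = t * gauss_avg (hermite2 a b) h1 t x"
    and "gauss_avg (hermite2 a (Suc b)) h t x = t * gauss_avg (hermite2 a b) h2 t x"
proof -
  note tempered = C1_tempered[OF assms]
  have *: "tempered (\<lambda>z. t * g (x + t *\<^sub>R z))" if "tempered g" for g
    by (rule tempered_mult[OF tempered_const tempered_affine[OF that]])
  have "gauss_avg (hermite2 (Suc a) b) h t x = EE (\<lambda>z. hermite2 a b z * (t * h1 (x + t *\<^sub>R z)))"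
    unfolding gauss_avg_def by (rule stein_hermite2_fst[OF tempered_affine[OF tempered(1)] *[OF tempered(2)] C1_partial(1)[OF assms]])
  then show "gauss_avg (hermite2 (Suc a) b) h t x = t * gauss_avg (hermite2 a b) h1 t x"
    by (simp add: gauss_avg_def mult.left_commute)
  have "gauss_avg (hermite2 a (Suc b)) h t x = EE (\<lambda>z. hermite2 a b z * (t * h2 (x + t *\<^sub>R z)))"
    unfolding gauss_avg_def by (rule stein_hermite2_snd[OF tempered_affine[OF tempered(1)] *[OF tempered(3)] C1_partial(2)[OF assms]])
  then show "gauss_avg (hermite2 a (Suc b)) h t x = t * gauss_avg (hermite2 a b) h2 t x"
    by (simp add: gauss_avg_def mult.left_commute)
qed

text \<open>By Gaussian integration by parts this is the derivative of order \<open>(a, b)\<close> of the smoothing of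
  \<open>h\<close> at scale \<open>t\<close>, i.e. of the heat flow at time \<open>t\<^sup>2 / 2\<close>. At \<open>t = 0\<close> the value is junk.\<close>

definition heat_deriv :: "nat \<Rightarrow> nat \<Rightarrow> (real \<times> real \<Rightarrow> real) \<Rightarrow> real \<Rightarrow> real \<times> real \<Rightarrow> real" where
  "heat_deriv a b h t x = gauss_avg (hermite2 a b) h t x / t ^ (a + b)"

lemma heat_deriv_shift:
  assumes "C1 h h1 h2" "t \<noteq> 0"
  shows "heat_deriv (Suc a) b h t x = heat_deriv a b h1 t x" "heat_deriv a (Suc b) h t x = heat_deriv a b h2 t x"
  using assms(2) by (simp_all add: heat_deriv_def gauss_avg_hermite2_shift[OF assms(1)])

lemma tempered_heat_deriv: "tempered h \<Longrightarrow> tempered (heat_deriv a b h t)"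
  using tempered_mult[OF tempered_gauss_avg[OF tempered_hermite2] tempered_const, of h a b t "1 / t ^ (a + b)"]
  by (simp add: heat_deriv_def[abs_def])

lemma heat_deriv_dx:
  assumes "C1 h h1 h2"
  shows "((\<lambda>s. heat_deriv a b h t (x + s *\<^sub>R u)) has_real_derivative
     fst u * heat_deriv a b h1 t (x + s *\<^sub>R u) + snd u * heat_deriv a b h2 t (x + s *\<^sub>R u)) (at s)"
proof -
  have *: "gauss_avg (\<lambda>z. hermite2 a b z * c) g t y = c * gauss_avg (hermite2 a b) g t y" for c g y
    by (simp add: gauss_avg_def mult.left_commute mult.assoc)
  show ?thesis
    using DERIV_cdivide[OF gauss_avg_derivative[OF tempered_hermite2 assms, of a b t 0 x u s], of "t ^ (a + b)"]
    by (simp add: heat_deriv_def * add_divide_distrib)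
qed

lemma gauss_avg_add:
  assumes "tempered P" "tempered Q" "tempered h"
  shows "gauss_avg (\<lambda>z. P z + Q z) h t x = gauss_avg P h t x + gauss_avg Q h t x"
  using assms by (simp add: gauss_avg_def distrib_right Bochner_Integration.integral_add tempered_integrable tempered_prod_affine)

lemma gauss_avg_cmult: "gauss_avg (\<lambda>z. c * P z) h t x = c * gauss_avg P h t x"
  by (simp add: gauss_avg_def mult.assoc)

text \<open>Moving the scale multiplies the kernel by a coordinate of \<open>z\<close>, which raises
  or lowers a Hermite index. The raised terms form the Laplacian; the lowered ones add up to
  \<open>(a + b) / t\<close> times the average and cancel the derivative of the normalisation
  \<open>t ^ (a + b)\<close>.\<close>

lemma heat_deriv_dt:
  assumes h: "C1 h h1 h2" and t: "t > 0"
  shows "((\<lambda>t. heat_deriv a b h t x) has_real_derivative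
     t * (heat_deriv (Suc (Suc a)) b h t x + heat_deriv a (Suc (Suc b)) h t x)) (at t)"
proof -
  note tempered = C1_tempered[OF h]
  have 1: "gauss_avg (\<lambda>z. hermite2 a b z * fst z) h1 t x = (gauss_avg (hermite2 (Suc (Suc a)) b) h t x + real a * gauss_avg (hermite2 a b) h t x) / t"
  proof -
    have "(\<lambda>z. hermite2 a b z * fst z) = (\<lambda>z. hermite2 (Suc a) b z + real a * hermite2 (a - 1) b z)"
      by (subst mult.commute) (simp only: hermite2_fst)
    then have "gauss_avg (\<lambda>z. hermite2 a b z * fst z) h1 t x = gauss_avg (hermite2 (Suc a) b) h1 t x + real a * gauss_avg (hermite2 (a - 1) b) h1 t x"
      by (simp add: gauss_avg_add[OF tempered_hermite2 tempered_mult[OF tempered_const tempered_hermite2] tempered(2)] gauss_avg_cmult)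
    then show ?thesis
      using t gauss_avg_hermite2_shift(1)[OF h, of "Suc a" b t x] gauss_avg_hermite2_shift(1)[OF h, of "a - 1" b t x]
      by (cases a) (simp_all add: field_simps)
  qed
  have 2: "gauss_avg (\<lambda>z. hermite2 a b z * snd z) h2 t x = (gauss_avg (hermite2 a (Suc (Suc b))) h t x + real b * gauss_avg (hermite2 a b) h t x) / t"
  proof -
    have "(\<lambda>z. hermite2 a b z * snd z) = (\<lambda>z. hermite2 a (Suc b) z + real b * hermite2 a (b - 1) z)"
      by (subst mult.commute) (simp only: hermite2_snd)
    then have "gauss_avg (\<lambda>z. hermite2 a b z * snd z) h2 t x = gauss_avg (hermite2 a (Suc b)) h2 t x + real b * gauss_avg (hermite2 a (b - 1)) h2 t x"
      by (simp add: gauss_avg_add[OF tempered_hermite2 tempered_mult[OF tempered_const tempered_hermite2] tempered(3)] gauss_avg_cmult)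
    then show ?thesis
      using t gauss_avg_hermite2_shift(2)[OF h, of a "Suc b" t x] gauss_avg_hermite2_shift(2)[OF h, of a "b - 1" t x]
      by (cases b) (simp_all add: field_simps)
  qed
  have "((\<lambda>s. gauss_avg (hermite2 a b) h s x) has_real_derivative
      gauss_avg (\<lambda>z. hermite2 a b z * fst z) h1 t x + gauss_avg (\<lambda>z. hermite2 a b z * snd z) h2 t x) (at t)"
    using gauss_avg_derivative[OF tempered_hermite2 h, of a b 0 1 x 0 t] by simp
  from DERIV_divide[OF this DERIV_pow[of "a + b" t]]
  have "((\<lambda>t. heat_deriv a b h t x) has_real_derivative
     ((gauss_avg (\<lambda>z. hermite2 a b z * fst z) h1 t x + gauss_avg (\<lambda>z. hermite2 a b z * snd z) h2 t x) * t ^ (a + b)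
       - gauss_avg (hermite2 a b) h t x * (real (a + b) * t ^ (a + b - Suc 0))) / (t ^ (a + b) * t ^ (a + b))) (at t)"
    using t by (simp add: heat_deriv_def)
  moreover have "((gauss_avg (\<lambda>z. hermite2 a b z * fst z) h1 t x + gauss_avg (\<lambda>z. hermite2 a b z * snd z) h2 t x) * t ^ (a + b)
       - gauss_avg (hermite2 a b) h t x * (real (a + b) * t ^ (a + b - Suc 0))) / (t ^ (a + b) * t ^ (a + b))
     = t * (heat_deriv (Suc (Suc a)) b h t x + heat_deriv a (Suc (Suc b)) h t x)"
  proof -
    \<comment> \<open>At \<open>a + b = 0\<close> the exponent on the left is truncated, but the
      coefficient vanishes on both sides.\<close>
    have p: "real (a + b) * t ^ (a + b - Suc 0) = real (a + b) * t ^ (a + b) / t"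
      using t by (cases "a + b") auto
    show ?thesis
      unfolding 1 2 p using t by (simp add: heat_deriv_def field_simps)
  qed
  ultimately show ?thesis by simp
qed

section \<open>The Monge-Ampere equation at a fixed scale\<close>

text \<open>\<open>576 = 4! * 4!\<close> bounds the factorials in \<open>hermite2_bound\<close> up
  to total order 4, which is order 3 after one integration by parts. The exponent 6 is 4 for the
  kernel plus 2 for functions of quadratic growth.\<close>

definition moment_const :: real where "moment_const = 576 * EE (\<lambda>z. growth z ^ 6)"

lemma prob_gauss2_UNIV [simp]: "gauss2.prob UNIV = 1"
  using gauss2.prob_space by simp

lemma moment_const_ge_1: "1 \<le> moment_const"
proof -
  have "EE (\<lambda>z. 1) \<le> EE (\<lambda>z. growth z ^ 6)"
    by (rule EE_mono) (auto simp: growth_ge_1 intro: tempered_power)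
  then show ?thesis by (simp add: moment_const_def)
qed

lemma hermite2_EE_bound:
  assumes ab: "a + b \<le> 4" and F: "tempered F" "\<And>z. \<bar>F z\<bar> \<le> c * growth z ^ 2" and c: "c \<ge> 0"
  shows "\<bar>EE (\<lambda>z. hermite2 a b z * F z)\<bar> \<le> c * moment_const"
proof -
  have "\<bar>EE (\<lambda>z. hermite2 a b z * F z)\<bar> \<le> EE (\<lambda>z. (c * 576) * growth z ^ 6)"
  proof (rule EE_abs_le)
    fix z
    have f: "fact a \<le> (24::real)" "fact b \<le> (24::real)"
      using ab fact_mono[of a 4, where 'a = real] fact_mono[of b 4, where 'a = real]
      by (simp_all add: fact_numeral)
    have "fact a * fact b * growth z ^ (a + b) \<le> (24 * 24) * growth z ^ 4"
      by (intro mult_mono f growth_power_mono ab) (use growth_ge_1[of z] in auto)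
    then have "\<bar>hermite2 a b z\<bar> \<le> 576 * growth z ^ 4" using hermite2_bound[of a b z] by simp
    then have "\<bar>hermite2 a b z\<bar> * \<bar>F z\<bar> \<le> (576 * growth z ^ 4) * (c * growth z ^ 2)"
      by (intro mult_mono F) (use growth_ge_1[of z] in auto)
    also have "\<dots> = (c * 576) * growth z ^ 6" by (simp flip: power_add)
    finally show "\<bar>hermite2 a b z * F z\<bar> \<le> (c * 576) * growth z ^ 6" by (simp only: abs_mult)
  qed (use F in \<open>auto intro!: tempered_mult tempered_power\<close>)
  then show ?thesis by (simp add: moment_const_def mult.assoc)
qed

lemma gauss_avg_hermite2_bound:
  assumes "a + b \<le> 4" "tempered h" "\<And>z. \<bar>h (x + t *\<^sub>R z)\<bar> \<le> c * growth z ^ 2" "c \<ge> 0"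
  shows "\<bar>gauss_avg (hermite2 a b) h t x\<bar> \<le> c * moment_const"
  unfolding gauss_avg_def by (rule hermite2_EE_bound[OF assms(1) tempered_affine[OF assms(2)] assms(3,4)])

lemma gauss_avg_hermite2_bounded:
  assumes "a + b \<le> 4" "tempered h" "\<And>y. \<bar>h y\<bar> \<le> c"
  shows "\<bar>gauss_avg (hermite2 a b) h t x\<bar> \<le> c * moment_const"
proof (rule gauss_avg_hermite2_bound[OF assms(1,2)])
  show c: "c \<ge> 0" using assms(3)[of x] by linarith
  fix z show "\<bar>h (x + t *\<^sub>R z)\<bar> \<le> c * growth z ^ 2"
    using mult_left_mono[OF one_le_power[OF growth_ge_1[of z], of 2] c] assms(3)[of "x + t *\<^sub>R z"] by simp
qed

lemma gauss_avg_0_0_bounded: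
  assumes "tempered h" "\<And>y. \<bar>h y\<bar> \<le> c"
  shows "\<bar>gauss_avg (hermite2 0 0) h t x\<bar> \<le> c"
  using EE_abs_le[OF tempered_affine[OF assms(1)] tempered_const assms(2), of x t] by (simp add: gauss_avg_def)

lemma gauss_avg_at_0: "gauss_avg (hermite2 0 0) h 0 x = h x"
  by (simp add: gauss_avg_def)

lemma gauss_avg_0_0_tendsto:
  assumes "tempered h" "s \<longlonglongrightarrow> 0" shows "(\<lambda>n. gauss_avg (hermite2 0 0) h (s n) x) \<longlonglongrightarrow> h x"
  using gauss_avg_tendsto[OF tempered_hermite2 assms(1) tendsto_const assms(2), of 0 0 x] by (simp only: gauss_avg_at_0)

lemma gauss_avg_add_right:
  assumes "tempered P" "tempered h" "tempered k"
  shows "gauss_avg P (\<lambda>y. h y + k y) t x = gauss_avg P h t x + gauss_avg P k t x"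
  unfolding gauss_avg_def distrib_left
  by (rule Bochner_Integration.integral_add[OF tempered_integrable[OF tempered_prod_affine[OF assms(1,2)]]
        tempered_integrable[OF tempered_prod_affine[OF assms(1,3)]]])

lemma gauss_avg_cmult_right: "gauss_avg P (\<lambda>y. c * h y) t x = c * gauss_avg P h t x"
  by (simp add: gauss_avg_def mult.left_commute)

lemma gauss_avg_diff_right:
  assumes "tempered P" "tempered h" "tempered k"
  shows "gauss_avg P (\<lambda>y. h y - k y) t x = gauss_avg P h t x - gauss_avg P k t x"
  using gauss_avg_add_right[OF assms(1,2) tempered_uminus[OF assms(3)], of t x] gauss_avg_cmult_right[of P "-1" k t x] by simp

lemma C1_const: "C1 (\<lambda>z. c) (\<lambda>z. 0) (\<lambda>z. 0)"
  by (simp add: C1_def)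

lemma gauss_avg_hermite2_const:
  assumes "1 \<le> a + b" shows "gauss_avg (hermite2 a b) (\<lambda>y. c) t x = 0"
proof (cases a)
  case (Suc a')
  then show ?thesis using gauss_avg_hermite2_shift(1)[OF C1_const, of a' b c t x] by (simp add: gauss_avg_def)
next
  case 0
  then obtain b' where "b = Suc b'" using assms by (cases b) auto
  then show ?thesis using gauss_avg_hermite2_shift(2)[OF C1_const, of a b' c t x] by (simp add: gauss_avg_def)
qed

text \<open>Applied to both gradient components, this subtracts a quadratic polynomial from
  \<open>w\<close>.\<close>

lemma C1_minus_affine:
  assumes "C1 h h1 h2"
  shows "C1 (\<lambda>y. h y - c - (fst y - fst x) * p - (snd y - snd x) * q) (\<lambda>y. h1 y - p) (\<lambda>y. h2 y - q)"
  unfolding C1_def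
proof (intro conjI allI)
  note tempered = C1_tempered[OF assms]
  show "tempered (\<lambda>y. h y - c - (fst y - fst x) * p - (snd y - snd x) * q)" "tempered (\<lambda>y. h1 y - p)" "tempered (\<lambda>y. h2 y - q)"
    by (intro tempered_diff tempered_mult tempered_const tempered_fst tempered_snd tempered)+
  fix z
  have "(h has_derivative (\<lambda>v. fst v * h1 z + snd v * h2 z)) (at z)"
    using assms unfolding C1_def by blast
  then show "((\<lambda>y. h y - c - (fst y - fst x) * p - (snd y - snd x) * q) has_derivative
      (\<lambda>v. fst v * (h1 z - p) + snd v * (h2 z - q))) (at z)"
    by (rule has_derivative_eq_rhs[OF has_derivative_diff[OF has_derivative_diff[OF has_derivative_diff]]])
       (rule derivative_intros | simp add: algebra_simps fun_eq_iff)+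
qed

text \<open>The rate \<open>r^(-3/2)\<close> is what square-root growth leaves of
  \<open>1 / r^2\<close> in \<open>third_order\<close>.\<close>

lemma DERIV_inverse_sqrt:
  assumes "r > 0" shows "((\<lambda>r. - 2 * c / sqrt r) has_real_derivative c / (r * sqrt r)) (at r)"
proof -
  have "((\<lambda>r. (- 2 * c) / sqrt r) has_real_derivative
      (0 * sqrt r - (- 2 * c) * (inverse (sqrt r) / 2)) / (sqrt r * sqrt r)) (at r)"
    using assms by (intro DERIV_divide DERIV_const DERIV_real_sqrt) auto
  then show ?thesis using assms by (simp add: field_simps)
qed

lemma sqrt_quotient:
  fixes B q r t :: real
  assumes "r > 0" "t > 0"
  shows "q * (sqrt (r / t) * B) / r\<^sup>2 = q * B / sqrt t / (r * sqrt r)"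
proof -
  define s u where "s = sqrt r" and "u = sqrt t"
  have *: "r = s * s" "s > 0" "u > 0" using assms by (simp_all add: s_def u_def)
  have "q * (s / u * B) / (s * s)\<^sup>2 = q * B / u / (s * s * s)"
    using *(2,3) by (simp add: divide_simps power2_eq_square)
  then show ?thesis
    unfolding real_sqrt_divide s_def[symmetric] u_def[symmetric] using *(1) by simp
qed

text \<open>Of the torus only uniform bounds remain, with one \<open>N\<close> for gradient and
  Hessian. \<open>R\<close> is the outer scale and \<open>om\<close> an abstract modulus for
  \<open>f\<close> in the l1 distance; \<open>om_scale\<close> expresses its square-root growth.
  \<open>eqn\<close> is the determinant equation with the \<open>1\<close> cancelled, and
  \<open>small\<close> is the absorption threshold.\<close>

locale monge_ampere =
  fixes w w1 w2 w11 w12 w22 f :: "real \<times> real \<Rightarrow> real" and N R \<delta> :: real and om :: "real \<Rightarrow> real"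
  assumes C1_w: "C1 w w1 w2" and C1_w1: "C1 w1 w11 w12" and C1_w2: "C1 w2 w12 w22"
    and tempered_f: "tempered f"
    and N_pos: "N > 0" and R_pos: "R > 0" and \<delta>_pos: "\<delta> > 0"
    and bnd1: "\<And>y. \<bar>w1 y\<bar> \<le> N" "\<And>y. \<bar>w2 y\<bar> \<le> N"
    and bnd2: "\<And>y. \<bar>w11 y\<bar> \<le> N" "\<And>y. \<bar>w12 y\<bar> \<le> N" "\<And>y. \<bar>w22 y\<bar> \<le> N"
    and eqn: "\<And>y. w11 y + w22 y + w11 y * w22 y - w12 y * w12 y = f y"
    and om_nonneg: "\<And>t. t \<ge> 0 \<Longrightarrow> om t \<ge> 0"
    and om_mono: "\<And>s t. 0 \<le> s \<Longrightarrow> s \<le> t \<Longrightarrow> om s \<le> om t"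
    and om_scale: "\<And>c t. c \<ge> 1 \<Longrightarrow> t > 0 \<Longrightarrow> om (c * t) \<le> sqrt c * om t"
    and osc: "\<And>x y. \<bar>f (x + y) - f x\<bar> \<le> om (\<bar>fst y\<bar> + \<bar>snd y\<bar>)"
    and small: "48 * N * moment_const \<le> 1"
begin

definition g :: "real \<times> real \<Rightarrow> real" where "g y = w11 y + w22 y"

text \<open>The term \<open>N * \<delta>\<close> only serves to
  make the supremum of the quotient finite a priori; \<open>\<delta>\<close> is sent to \<open>0\<close> in the end. The square root
  growth makes the contributions of larger scales summable.\<close>

definition envelope :: "real \<Rightarrow> real" where "envelope t = om t + N\<^sup>2 * sqrt (t / R) + N * \<delta>"

lemmas tempered_w = C1_tempered[OF C1_w] C1_tempered(2,3)[OF C1_w1] C1_tempered(3)[OF C1_w2]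

lemma tempered_g: "tempered g"
  unfolding g_def[abs_def] by (intro tempered_add tempered_w)

lemma heat_deriv_shifts:
  assumes "t \<noteq> 0"
  shows "heat_deriv (Suc a) b w t x = heat_deriv a b w1 t x" "heat_deriv a (Suc b) w t x = heat_deriv a b w2 t x"
    "heat_deriv (Suc a) b w1 t x = heat_deriv a b w11 t x" "heat_deriv a (Suc b) w1 t x = heat_deriv a b w12 t x"
    "heat_deriv (Suc a) b w2 t x = heat_deriv a b w12 t x" "heat_deriv a (Suc b) w2 t x = heat_deriv a b w22 t x"
  using heat_deriv_shift[OF C1_w assms] heat_deriv_shift[OF C1_w1 assms] heat_deriv_shift[OF C1_w2 assms] by auto

text \<open>The Laplacian produced by \<open>heat_deriv_dt\<close> is moved onto \<open>w\<close> by
  the shift rules and becomes \<open>g\<close>.\<close>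

lemma heat:
  assumes "t > 0"
  shows "((\<lambda>t. heat_deriv a b w t x) has_real_derivative t * heat_deriv a b g t x) (at t)"
proof -
  have "heat_deriv a b g t x = heat_deriv a b w11 t x + heat_deriv a b w22 t x"
    unfolding heat_deriv_def g_def[abs_def] by (simp add: gauss_avg_add_right tempered_w add_divide_distrib)
  then show ?thesis
    using heat_deriv_dt[OF C1_w assms, of a b x] assms by (simp add: heat_deriv_shifts)
qed

lemma heat_deriv_w_dx:
  assumes "t \<noteq> 0"
  shows "((\<lambda>s. heat_deriv a b w t (x + s *\<^sub>R u)) has_real_derivative
     fst u * heat_deriv (Suc a) b w t (x + s *\<^sub>R u) + snd u * heat_deriv a (Suc b) w t (x + s *\<^sub>R u)) (at s)"
  using heat_deriv_dx[OF C1_w, of a b t x u s] heat_deriv_shift[OF C1_w assms] by simp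

lemma heat_deriv2_bound:
  assumes "t \<noteq> 0"
  shows "\<bar>heat_deriv (Suc (Suc 0)) 0 w t x\<bar> \<le> N" "\<bar>heat_deriv (Suc 0) (Suc 0) w t x\<bar> \<le> N" "\<bar>heat_deriv 0 (Suc (Suc 0)) w t x\<bar> \<le> N"
  unfolding heat_deriv_shifts[OF assms] by (auto simp: heat_deriv_def intro!: gauss_avg_0_0_bounded tempered_w bnd2)

lemma envelope_pos: "t \<ge> 0 \<Longrightarrow> envelope t > 0"
  unfolding envelope_def using om_nonneg[of t] N_pos \<delta>_pos R_pos
  by (intro add_nonneg_pos add_nonneg_nonneg) auto

lemma envelope_mono: "0 \<le> s \<Longrightarrow> s \<le> t \<Longrightarrow> envelope s \<le> envelope t"
  unfolding envelope_def using om_mono[of s t] R_pos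
  by (intro add_mono mult_left_mono) (auto simp: divide_right_mono less_imp_le[OF N_pos])

lemma envelope_scale:
  assumes "0 < t" "t \<le> r" shows "envelope r \<le> sqrt (r / t) * envelope t"
proof -
  have 1: "1 \<le> sqrt (r / t)" using assms by simp
  have "om r \<le> sqrt (r / t) * om t" using om_scale[of "r / t" t] assms by simp
  moreover have "N\<^sup>2 * sqrt (r / R) = sqrt (r / t) * (N\<^sup>2 * sqrt (t / R))"
  proof -
    have "sqrt (r / R) = sqrt (r / t * (t / R))" using assms by simp
    then show ?thesis by (simp only: real_sqrt_mult mult.left_commute)
  qed
  moreover have "N * \<delta> \<le> sqrt (r / t) * (N * \<delta>)"
    using mult_right_mono[OF 1, of "N * \<delta>"] N_pos \<delta>_pos by simp
  ultimately show ?thesis unfolding envelope_def distrib_left by linarith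
qed

text \<open>As \<open>s \<le> sqrt s\<close> on [0, 1], the middle term of \<open>envelope\<close>
  covers the error inherited from the outer scale, which is quadratic in \<open>N\<close> and linear
  in \<open>t / R\<close>.\<close>

lemma N2_le_envelope: "0 < t \<Longrightarrow> t \<le> R \<Longrightarrow> N * (N * (t / R)) \<le> envelope t"
proof -
  assume t: "0 < t" "t \<le> R"
  have "t / R * (t / R) \<le> t / R"
    by (rule mult_left_le) (use t R_pos in auto)
  then have "t / R \<le> sqrt (t / R)"
    by (intro real_le_rsqrt) (simp only: power2_eq_square)
  then have "N\<^sup>2 * (t / R) \<le> N\<^sup>2 * sqrt (t / R)" by (intro mult_left_mono) auto
  then show ?thesis
    unfolding envelope_def using om_nonneg[of t] t N_pos \<delta>_pos by (simp add: power2_eq_square mult.assoc add_nonneg_nonneg add_increasing add_increasing2)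
qed

section \<open>Consequences of a hypothetical bound \<open>Q\<close> for the Hermite averages of the
  Laplacian\<close>

context
  fixes Q :: real
  assumes Q_nonneg: "Q \<ge> 0"
    and Q: "\<And>r x a b. 0 < r \<Longrightarrow> r \<le> R \<Longrightarrow> 1 \<le> a + b \<Longrightarrow> a + b \<le> 3 \<Longrightarrow> \<bar>gauss_avg (hermite2 a b) g r x\<bar> \<le> Q * envelope r"
begin

text \<open>At order 1 the factor in \<open>heat\<close> cancels the normalisation of
  \<open>heat_deriv\<close>: the scale derivative is a bare Hermite average, at most
  \<open>Q * envelope t\<close>, and it is integrated over an interval of length \<open>t\<close>
  down to scale 0. These are the smaller scales.\<close>

lemma first_order:
  assumes t: "0 < t" "t \<le> R"
  shows "\<bar>w1 y - heat_deriv (Suc 0) 0 w t y\<bar> \<le> t * (Q * envelope t)" "\<bar>w2 y - heat_deriv 0 (Suc 0) w t y\<bar> \<le> t * (Q * envelope t)"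
proof -
  have *: "\<bar>h y - heat_deriv a b w t y\<bar> \<le> t * (Q * envelope t)"
    if h: "tempered h" "\<And>r. r > 0 \<Longrightarrow> heat_deriv a b w r y = gauss_avg (hermite2 0 0) h r y" and ab: "a + b = 1" for h a b
  proof -
    have "norm (gauss_avg (hermite2 0 0) h t y - gauss_avg (hermite2 0 0) h 0 y) \<le> (Q * envelope t) * t - (Q * envelope t) * 0"
    proof (rule differentiable_bound_general)
      show "continuous_on {0..t} (\<lambda>t. gauss_avg (hermite2 0 0) h t y)"
        by (rule gauss_avg_continuous_t[OF tempered_hermite2 h(1)])
      fix r assume r: "0 < r" "r < t"
      have "((\<lambda>t. gauss_avg (hermite2 0 0) h t y) has_real_derivative r * heat_deriv a b g r y) (at r)"
        by (rule has_field_derivative_transform_within_open[OF heat, where S = "{0<..}"])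
          (use r h(2) in auto)
      then show "((\<lambda>t. gauss_avg (hermite2 0 0) h t y) has_vector_derivative r * heat_deriv a b g r y) (at r)"
        by (simp add: has_real_derivative_iff_has_vector_derivative)
      show "((\<lambda>r. Q * envelope t * r) has_vector_derivative Q * envelope t) (at r)"
        unfolding has_real_derivative_iff_has_vector_derivative[symmetric]
        by (auto intro!: derivative_eq_intros)
      have "r * heat_deriv a b g r y = gauss_avg (hermite2 a b) g r y"
        using r ab by (simp add: heat_deriv_def)
      also have "\<bar>\<dots>\<bar> \<le> Q * envelope r" using Q[of r a b y] r t ab by simp
      also have "\<dots> \<le> Q * envelope t" using envelope_mono[of r t] r Q_nonneg by (intro mult_left_mono) auto
      finally show "norm (r * heat_deriv a b g r y) \<le> Q * envelope t" by simp
    qed (use t in \<open>auto intro!: continuous_intros\<close>)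
    then show ?thesis
      using h(2)[OF t(1)] by (simp add: gauss_avg_at_0 abs_minus_commute mult.commute)
  qed
  have "heat_deriv (Suc 0) 0 w r y = gauss_avg (hermite2 0 0) w1 r y" "heat_deriv 0 (Suc 0) w r y = gauss_avg (hermite2 0 0) w2 r y" if "r > 0" for r
    unfolding heat_deriv_shifts(1,2)[OF less_imp_neq[OF that, symmetric]] by (simp_all add: heat_deriv_def)
  then show "\<bar>w1 y - heat_deriv (Suc 0) 0 w t y\<bar> \<le> t * (Q * envelope t)" "\<bar>w2 y - heat_deriv 0 (Suc 0) w t y\<bar> \<le> t * (Q * envelope t)"
    by (auto intro!: * tempered_w)
qed

text \<open>At the outer scale two derivatives fall on \<open>w\<close> and the third costs
  \<open>1 / R\<close>. From there down to \<open>t\<close> the scale derivative is at most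
  \<open>Q * envelope r / r^2\<close>; by \<open>envelope_scale\<close> its integral is governed by
  the lower end \<open>t\<close>. These are the larger scales.\<close>

lemma third_order:
  assumes t: "0 < t" "t \<le> R" and ab: "a + b = 3"
  shows "\<bar>heat_deriv a b w t x\<bar> \<le> moment_const * N / R + 2 * (Q * envelope t) / t"
proof -
  have R: "\<bar>heat_deriv a b w R x\<bar> \<le> moment_const * N / R"
  proof -
    have *: "\<bar>heat_deriv c d h R x\<bar> \<le> moment_const * N / R" if "c + d = 1" "tempered h" "\<And>y. \<bar>h y\<bar> \<le> N" for c d h
      using gauss_avg_hermite2_bounded[of c d h N R x] that R_pos by (simp add: heat_deriv_def divide_right_mono mult.commute)
    have "(a = Suc (Suc (Suc 0)) \<and> b = 0) \<or> (a = Suc (Suc 0) \<and> b = Suc 0) \<or>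
        (a = Suc 0 \<and> b = Suc (Suc 0)) \<or> (a = 0 \<and> b = Suc (Suc (Suc 0)))"
      using ab by presburger
    moreover have R0: "R \<noteq> 0" using R_pos by simp
    moreover have "\<bar>heat_deriv (Suc (Suc (Suc 0))) 0 w R x\<bar> \<le> moment_const * N / R" "\<bar>heat_deriv (Suc (Suc 0)) (Suc 0) w R x\<bar> \<le> moment_const * N / R"
      "\<bar>heat_deriv (Suc 0) (Suc (Suc 0)) w R x\<bar> \<le> moment_const * N / R" "\<bar>heat_deriv 0 (Suc (Suc (Suc 0))) w R x\<bar> \<le> moment_const * N / R"
      unfolding heat_deriv_shifts[OF R0] by (rule *; simp add: tempered_w bnd2)+
    ultimately show ?thesis by auto
  qed
  have "\<bar>heat_deriv a b w R x - heat_deriv a b w t x\<bar> \<le> 2 * (Q * envelope t) / t"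
  proof (cases "t = R")
    case True
    then show ?thesis using envelope_pos[of t] t Q_nonneg by simp
  next
    case False
    then have tR: "t < R" using t by simp
    define c where "c = Q * envelope t / sqrt t"
    have c: "c \<ge> 0" using Q_nonneg envelope_pos[of t] t by (simp add: c_def)
    have "norm (heat_deriv a b w R x - heat_deriv a b w t x) \<le> - 2 * c / sqrt R - (- 2 * c / sqrt t)"
    proof (rule differentiable_bound_general[OF tR])
      show "continuous_on {t..R} (\<lambda>t. heat_deriv a b w t x)"
        by (rule continuous_at_imp_continuous_on, rule ballI, rule DERIV_isCont, rule heat) (use t in auto)
      show "continuous_on {t..R} (\<lambda>r. - 2 * c / sqrt r)"
        using t by (intro continuous_intros) auto
      fix r assume r: "t < r" "r < R"
      then have r0: "r > 0" using t by simp
      show "((\<lambda>t. heat_deriv a b w t x) has_vector_derivative r * heat_deriv a b g r x) (at r)"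
        using heat[OF r0] by (simp add: has_real_derivative_iff_has_vector_derivative)
      show "((\<lambda>r. - 2 * c / sqrt r) has_vector_derivative c / (r * sqrt r)) (at r)"
        unfolding has_real_derivative_iff_has_vector_derivative[symmetric]
        by (rule DERIV_inverse_sqrt[OF r0])
      have "\<bar>r * heat_deriv a b g r x\<bar> = \<bar>gauss_avg (hermite2 a b) g r x\<bar> / r\<^sup>2"
      proof -
        have "r * (gauss_avg (hermite2 a b) g r x / r ^ 3) = gauss_avg (hermite2 a b) g r x / r\<^sup>2"
          using r0 by (simp add: power2_eq_square power3_eq_cube)
        then show ?thesis unfolding heat_deriv_def ab by simp
      qed
      also have "\<dots> \<le> (Q * envelope r) / r\<^sup>2"
        using Q[of r a b x] r r0 ab by (intro divide_right_mono) auto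
      also have "\<dots> \<le> (Q * (sqrt (r / t) * envelope t)) / r\<^sup>2"
        using envelope_scale[of t r] t r Q_nonneg by (intro divide_right_mono mult_left_mono) auto
      also have "\<dots> = c / (r * sqrt r)"
        unfolding c_def by (rule sqrt_quotient) (use r0 t in auto)
      finally show "norm (r * heat_deriv a b g r x) \<le> c / (r * sqrt r)" by simp
    qed
    also have "\<dots> \<le> 2 * c / sqrt t" using c R_pos by simp
    also have "\<dots> = 2 * (Q * envelope t) / t" using t by (simp add: c_def)
    finally show ?thesis by simp
  qed
  with R show ?thesis by linarith
qed

end

lemma heat_deriv_w_partial:
  assumes "s \<noteq> 0"
  shows "((\<lambda>r. heat_deriv a b w s (x + t *\<^sub>R (r, y))) has_real_derivative t * heat_deriv (Suc a) b w s (x + t *\<^sub>R (r, y))) (at r)"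
    and "((\<lambda>r. heat_deriv a b w s (x + t *\<^sub>R (y, r))) has_real_derivative t * heat_deriv a (Suc b) w s (x + t *\<^sub>R (y, r))) (at r)"
  using heat_deriv_w_dx[OF assms, of a b "x + t *\<^sub>R (0, y)" "(t, 0)" r] heat_deriv_w_dx[OF assms, of a b "x + t *\<^sub>R (y, 0)" "(0, t)" r]
  by (cases x; simp add: mult.commute add.assoc)+

text \<open>The mean value theorem is used twice along the segment, and the factor
  \<open>z < 1\<close> is simply dropped, which costs the usual 1/2 of Taylor's formula.\<close>

lemma heat_deriv_taylor:
  assumes t: "t > 0" and ab: "a + b = 1" and G: "\<And>c d y. c + d = 3 \<Longrightarrow> \<bar>heat_deriv c d w t y\<bar> \<le> G"
  shows "\<bar>heat_deriv a b w t (x + q) - heat_deriv a b w t x - fst q * heat_deriv (Suc a) b w t x - snd q * heat_deriv a (Suc b) w t x\<bar>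
    \<le> G * (\<bar>fst q\<bar> + \<bar>snd q\<bar>)\<^sup>2"
proof -
  have t0: "t \<noteq> 0" using t by simp
  define p where "p s = fst q * heat_deriv (Suc a) b w t (x + s *\<^sub>R q) + snd q * heat_deriv a (Suc b) w t (x + s *\<^sub>R q)" for s
  define p' where "p' s = fst q * (fst q * heat_deriv (Suc (Suc a)) b w t (x + s *\<^sub>R q) + snd q * heat_deriv (Suc a) (Suc b) w t (x + s *\<^sub>R q))
    + snd q * (fst q * heat_deriv (Suc a) (Suc b) w t (x + s *\<^sub>R q) + snd q * heat_deriv a (Suc (Suc b)) w t (x + s *\<^sub>R q))" for s
  have d1: "((\<lambda>s. heat_deriv a b w t (x + s *\<^sub>R q)) has_real_derivative p s) (at s)" for s
    unfolding p_def by (rule heat_deriv_w_dx[OF t0])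
  have d2: "(p has_real_derivative p' s) (at s)" for s
    unfolding p_def[abs_def] p'_def by (intro DERIV_add DERIV_cmult heat_deriv_w_dx[OF t0])
  have "\<exists>z>0. z < 1 \<and> heat_deriv a b w t (x + 1 *\<^sub>R q) - heat_deriv a b w t (x + 0 *\<^sub>R q) = (1 - 0) * p z"
    by (rule MVT2) (auto intro: d1)
  then obtain z where z: "0 < z" "z < 1" "heat_deriv a b w t (x + q) - heat_deriv a b w t x = p z" by auto
  have "\<exists>y>0. y < z \<and> p z - p 0 = (z - 0) * p' y"
    by (rule MVT2) (use z in \<open>auto intro: d2\<close>)
  then obtain y where y: "p z - p 0 = z * p' y" by auto
  have GG: "\<bar>heat_deriv (Suc (Suc a)) b w t u\<bar> \<le> G" "\<bar>heat_deriv (Suc a) (Suc b) w t u\<bar> \<le> G" "\<bar>heat_deriv a (Suc (Suc b)) w t u\<bar> \<le> G" for u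
    using ab by (intro G; simp)+
  have G0: "G \<ge> 0" using GG(1)[of x] by linarith
  have "\<bar>p' y\<bar> \<le> \<bar>fst q\<bar> * (\<bar>fst q\<bar> * G + \<bar>snd q\<bar> * G) + \<bar>snd q\<bar> * (\<bar>fst q\<bar> * G + \<bar>snd q\<bar> * G)"
    unfolding p'_def
    by (intro order.trans[OF abs_triangle_ineq] add_mono)
       (simp only: abs_mult, intro mult_left_mono order.trans[OF abs_triangle_ineq] add_mono; simp add: abs_mult mult_left_mono GG)+
  also have "\<dots> = G * (\<bar>fst q\<bar> + \<bar>snd q\<bar>)\<^sup>2" by (simp add: power2_eq_square algebra_simps)
  finally have "\<bar>p' y\<bar> \<le> G * (\<bar>fst q\<bar> + \<bar>snd q\<bar>)\<^sup>2" .
  then have "z * \<bar>p' y\<bar> \<le> 1 * (G * (\<bar>fst q\<bar> + \<bar>snd q\<bar>)\<^sup>2)"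
    using z by (intro mult_mono) auto
  moreover have "heat_deriv a b w t (x + q) - heat_deriv a b w t x - fst q * heat_deriv (Suc a) b w t x - snd q * heat_deriv a (Suc b) w t x = z * p' y"
    using y z(3) by (simp add: p_def)
  ultimately show ?thesis using z by (simp add: abs_mult)
qed

text \<open>The integration by parts would need third derivatives of \<open>w\<close>, so \<open>w\<close> is replaced by its smoothing at
  scale \<open>s\<close> in one of the two factors before letting \<open>s\<close> tend to \<open>0\<close>.\<close>

lemma null_lagrangian:
  assumes t: "t > 0" and ab: "a + b \<le> 3" and v: "C1 v b11 b12"
    and vb: "\<And>z. \<bar>v (x + t *\<^sub>R z)\<bar> \<le> c * growth z ^ 2" and c: "c \<ge> 0"
    and A: "\<bar>A12\<bar> \<le> N" "\<bar>A22\<bar> \<le> N"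
  shows "\<bar>gauss_avg (hermite2 a b) (\<lambda>y. b11 y * (w22 y - A22) - b12 y * (w12 y - A12)) t x\<bar> \<le> 4 * N * c * moment_const / t"
proof -
  note tempered_v = C1_tempered[OF v]
  define p where "p s y = heat_deriv 0 (Suc (Suc 0)) w s y - A22" for s y
  define q where "q s y = heat_deriv (Suc 0) (Suc 0) w s y - A12" for s y
  \<comment> \<open>The common derivative of \<open>p s\<close> in the first direction and of
    \<open>q s\<close> in the second: the smoothed second row of the Hessian is curl-free.\<close>
  define r where "r s y = heat_deriv (Suc 0) (Suc (Suc 0)) w s y" for s y
  have tempered_p: "tempered (p s)" and tempered_q: "tempered (q s)" and tempered_r: "tempered (r s)" for s
    unfolding p_def[abs_def] q_def[abs_def] r_def[abs_def] by (intro tempered_diff tempered_const tempered_heat_deriv tempered_w)+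
  have pq: "\<bar>p s y\<bar> \<le> 2 * N" "\<bar>q s y\<bar> \<le> 2 * N" if "s > 0" for s y
    using heat_deriv2_bound(2,3)[of s y] A that by (auto simp: p_def q_def)
  have bound: "\<bar>gauss_avg (hermite2 a b) (\<lambda>y. b11 y * p s y - b12 y * q s y) t x\<bar> \<le> 4 * N * c * moment_const / t" if s: "s > 0" for s
  proof -
    have s0: "s \<noteq> 0" using s by simp
    have adms: "tempered (\<lambda>y. v y * p s y)" "tempered (\<lambda>y. v y * q s y)" "tempered (\<lambda>y. b11 y * p s y + v y * r s y)"
      "tempered (\<lambda>y. b12 y * q s y + v y * r s y)" "tempered (\<lambda>y. b11 y * p s y - b12 y * q s y)"
      by (intro tempered_mult tempered_add tempered_diff tempered_v tempered_p tempered_q tempered_r)+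
    note ct = tempered_mult[OF tempered_const tempered_affine]
    have "gauss_avg (hermite2 (Suc a) b) (\<lambda>y. v y * p s y) t x = EE (\<lambda>z. hermite2 a b z * (t * (b11 (x + t *\<^sub>R z) * p s (x + t *\<^sub>R z) + v (x + t *\<^sub>R z) * r s (x + t *\<^sub>R z))))"
      unfolding gauss_avg_def
    proof (rule stein_hermite2_fst[OF tempered_affine[OF adms(1)] ct[OF adms(3)]])
      fix \<xi> y :: real
      have "((\<lambda>\<xi>. p s (x + t *\<^sub>R (\<xi>, y))) has_real_derivative t * r s (x + t *\<^sub>R (\<xi>, y))) (at \<xi>)"
        unfolding p_def r_def using DERIV_diff[OF heat_deriv_w_partial(1)[OF s0] DERIV_const] by simp
      from DERIV_mult[OF C1_partial(1)[OF v, where x = x and t = t and y = y] this]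
      show "((\<lambda>\<xi>. v (x + t *\<^sub>R (\<xi>, y)) * p s (x + t *\<^sub>R (\<xi>, y))) has_real_derivative
         t * (b11 (x + t *\<^sub>R (\<xi>, y)) * p s (x + t *\<^sub>R (\<xi>, y)) + v (x + t *\<^sub>R (\<xi>, y)) * r s (x + t *\<^sub>R (\<xi>, y)))) (at \<xi>)"
        by (simp add: algebra_simps)
    qed
    then have 1: "gauss_avg (hermite2 (Suc a) b) (\<lambda>y. v y * p s y) t x = t * gauss_avg (hermite2 a b) (\<lambda>y. b11 y * p s y + v y * r s y) t x"
      by (simp add: gauss_avg_def mult.left_commute)
    have "gauss_avg (hermite2 a (Suc b)) (\<lambda>y. v y * q s y) t x = EE (\<lambda>z. hermite2 a b z * (t * (b12 (x + t *\<^sub>R z) * q s (x + t *\<^sub>R z) + v (x + t *\<^sub>R z) * r s (x + t *\<^sub>R z))))"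
      unfolding gauss_avg_def
    proof (rule stein_hermite2_snd[OF tempered_affine[OF adms(2)] ct[OF adms(4)]])
      fix y \<xi> :: real
      have "((\<lambda>\<xi>. q s (x + t *\<^sub>R (y, \<xi>))) has_real_derivative t * r s (x + t *\<^sub>R (y, \<xi>))) (at \<xi>)"
        unfolding q_def r_def using DERIV_diff[OF heat_deriv_w_partial(2)[OF s0] DERIV_const] by simp
      from DERIV_mult[OF C1_partial(2)[OF v, where x = x and t = t and y = y] this]
      show "((\<lambda>\<xi>. v (x + t *\<^sub>R (y, \<xi>)) * q s (x + t *\<^sub>R (y, \<xi>))) has_real_derivative
         t * (b12 (x + t *\<^sub>R (y, \<xi>)) * q s (x + t *\<^sub>R (y, \<xi>)) + v (x + t *\<^sub>R (y, \<xi>)) * r s (x + t *\<^sub>R (y, \<xi>)))) (at \<xi>)"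
        by (simp add: algebra_simps)
    qed
    then have 2: "gauss_avg (hermite2 a (Suc b)) (\<lambda>y. v y * q s y) t x = t * gauss_avg (hermite2 a b) (\<lambda>y. b12 y * q s y + v y * r s y) t x"
      by (simp add: gauss_avg_def mult.left_commute)
    \<comment> \<open>The third derivatives cancel here, so the resulting bound does not depend on
      \<open>s\<close>.\<close>
    have "(\<lambda>y. b11 y * p s y - b12 y * q s y) = (\<lambda>y. (b11 y * p s y + v y * r s y) - (b12 y * q s y + v y * r s y))"
      by simp
    then have "gauss_avg (hermite2 a b) (\<lambda>y. b11 y * p s y - b12 y * q s y) t x =
        (gauss_avg (hermite2 (Suc a) b) (\<lambda>y. v y * p s y) t x - gauss_avg (hermite2 a (Suc b)) (\<lambda>y. v y * q s y) t x) / t"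
      using t by (simp only: 1 2 gauss_avg_diff_right[OF tempered_hermite2 adms(3,4)]) (simp add: field_simps)
    moreover have "\<bar>gauss_avg (hermite2 (Suc a) b) (\<lambda>y. v y * p s y) t x\<bar> \<le> (c * (2 * N)) * moment_const"
    proof (rule gauss_avg_hermite2_bound[OF _ adms(1)])
      fix z
      have "\<bar>v (x + t *\<^sub>R z)\<bar> * \<bar>p s (x + t *\<^sub>R z)\<bar> \<le> (c * growth z ^ 2) * (2 * N)"
        by (intro mult_mono vb pq s) (use c in auto)
      then show "\<bar>v (x + t *\<^sub>R z) * p s (x + t *\<^sub>R z)\<bar> \<le> (c * (2 * N)) * growth z ^ 2"
        by (simp add: abs_mult mult_ac)
    qed (use ab c N_pos in auto)
    moreover have "\<bar>gauss_avg (hermite2 a (Suc b)) (\<lambda>y. v y * q s y) t x\<bar> \<le> (c * (2 * N)) * moment_const"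
    proof (rule gauss_avg_hermite2_bound[OF _ adms(2)])
      fix z
      have "\<bar>v (x + t *\<^sub>R z)\<bar> * \<bar>q s (x + t *\<^sub>R z)\<bar> \<le> (c * growth z ^ 2) * (2 * N)"
        by (intro mult_mono vb pq s) (use c in auto)
      then show "\<bar>v (x + t *\<^sub>R z) * q s (x + t *\<^sub>R z)\<bar> \<le> (c * (2 * N)) * growth z ^ 2"
        by (simp add: abs_mult mult_ac)
    qed (use ab c N_pos in auto)
    ultimately have "\<bar>gauss_avg (hermite2 a b) (\<lambda>y. b11 y * p s y - b12 y * q s y) t x\<bar> \<le> ((c * (2 * N)) * moment_const + (c * (2 * N)) * moment_const) / t"
      using t by (auto simp only: abs_divide abs_of_pos intro!: divide_right_mono order.trans[OF abs_triangle_ineq4] add_mono)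
    also have "\<dots> = 4 * N * c * moment_const / t" by (simp add: algebra_simps)
    finally show ?thesis .
  qed
  define S where "S n = 1 / real (Suc n)" for n
  have S: "S n > 0" "S \<longlonglongrightarrow> 0" for n
    unfolding S_def[abs_def] by (simp, rule LIMSEQ_Suc[OF lim_const_over_n])
  have "(\<lambda>n. gauss_avg (hermite2 a b) (\<lambda>y. b11 y * p (S n) y - b12 y * q (S n) y) t x) \<longlonglongrightarrow>
     gauss_avg (hermite2 a b) (\<lambda>y. b11 y * (w22 y - A22) - b12 y * (w12 y - A12)) t x"
    unfolding gauss_avg_def
  proof (rule EE_dominated[where D = "\<lambda>z. \<bar>hermite2 a b z\<bar> * (\<bar>b11 (x + t *\<^sub>R z)\<bar> * (2 * N) + \<bar>b12 (x + t *\<^sub>R z)\<bar> * (2 * N))"])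
    fix n
    have "tempered (\<lambda>y. b11 y * p (S n) y - b12 y * q (S n) y)"
      by (intro tempered_mult tempered_diff tempered_v tempered_p tempered_q)
    from tempered_hermite2_h[OF this, of a b x t]
    show "tempered (\<lambda>z. hermite2 a b z * (b11 (x + t *\<^sub>R z) * p (S n) (x + t *\<^sub>R z) - b12 (x + t *\<^sub>R z) * q (S n) (x + t *\<^sub>R z)))" .
  next
    have "tempered (\<lambda>y. b11 y * (w22 y - A22) - b12 y * (w12 y - A12))"
      by (intro tempered_mult tempered_diff tempered_v tempered_w tempered_const)
    from tempered_hermite2_h[OF this, of a b x t]
    show "tempered (\<lambda>z. hermite2 a b z * (b11 (x + t *\<^sub>R z) * (w22 (x + t *\<^sub>R z) - A22) - b12 (x + t *\<^sub>R z) * (w12 (x + t *\<^sub>R z) - A12)))" .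
  next
    show "tempered (\<lambda>z. \<bar>hermite2 a b z\<bar> * (\<bar>b11 (x + t *\<^sub>R z)\<bar> * (2 * N) + \<bar>b12 (x + t *\<^sub>R z)\<bar> * (2 * N)))"
      by (rule tempered_mult[OF tempered_abs[OF tempered_hermite2] tempered_add[OF tempered_mult[OF tempered_abs[OF tempered_affine[OF tempered_v(2)]] tempered_const]
          tempered_mult[OF tempered_abs[OF tempered_affine[OF tempered_v(3)]] tempered_const]]])
  next
    fix n z
    let ?y = "x + t *\<^sub>R z"
    show "\<bar>hermite2 a b z * (b11 ?y * p (S n) ?y - b12 ?y * q (S n) ?y)\<bar> \<le> \<bar>hermite2 a b z\<bar> * (\<bar>b11 ?y\<bar> * (2 * N) + \<bar>b12 ?y\<bar> * (2 * N))"
      unfolding abs_mult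
      by (intro mult_left_mono order.trans[OF abs_triangle_ineq4] add_mono; simp add: abs_mult mult_left_mono pq S)
  next
    fix z
    let ?y = "x + t *\<^sub>R z"
    have S0: "S n \<noteq> 0" for n using S(1)[of n] by simp
    have "(\<lambda>n. p (S n) ?y) \<longlonglongrightarrow> w22 ?y - A22"
      unfolding p_def heat_deriv_shifts(2,6)[OF S0]
      using tendsto_diff[OF gauss_avg_0_0_tendsto[OF tempered_w(6) S(2)] tendsto_const] by (simp add: heat_deriv_def)
    moreover have "(\<lambda>n. q (S n) ?y) \<longlonglongrightarrow> w12 ?y - A12"
      unfolding q_def heat_deriv_shifts(1,4)[OF S0]
      using tendsto_diff[OF gauss_avg_0_0_tendsto[OF tempered_w(5) S(2)] tendsto_const] by (simp add: heat_deriv_def)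
    ultimately show "(\<lambda>n. hermite2 a b z * (b11 ?y * p (S n) ?y - b12 ?y * q (S n) ?y)) \<longlonglongrightarrow>
        hermite2 a b z * (b11 ?y * (w22 ?y - A22) - b12 ?y * (w12 ?y - A12))"
      by (intro tendsto_mult tendsto_diff tendsto_const)
  qed
  then show ?thesis
    by (rule tendsto_upperbound[OF tendsto_rabs]) (use bound S in auto)
qed

text \<open>Since the order is at least 1, \<open>f x\<close> may be subtracted. The square-root
  growth of \<open>om\<close> then trades the distance \<open>t * growth z\<close> for
  \<open>om t\<close> times a weight that the Gaussian absorbs.\<close>

lemma gauss_avg_f_bound:
  assumes t: "t > 0" and ab: "1 \<le> a + b" "a + b \<le> 4"
  shows "\<bar>gauss_avg (hermite2 a b) f t x\<bar> \<le> moment_const * om t"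
proof -
  have "gauss_avg (hermite2 a b) f t x = gauss_avg (hermite2 a b) (\<lambda>y. f y - f x) t x"
    using gauss_avg_diff_right[OF tempered_hermite2 tempered_f tempered_const, of a b "f x" t x] gauss_avg_hermite2_const[OF ab(1)] by simp
  also have "\<bar>\<dots>\<bar> \<le> om t * moment_const"
  proof (rule gauss_avg_hermite2_bound[OF ab(2) tempered_diff[OF tempered_f tempered_const]])
    fix z
    have l: "1 \<le> growth z" by (rule growth_ge_1)
    have "\<bar>f (x + t *\<^sub>R z) - f x\<bar> \<le> om (\<bar>fst (t *\<^sub>R z)\<bar> + \<bar>snd (t *\<^sub>R z)\<bar>)" by (rule osc)
    also have "\<dots> \<le> om (growth z * t)"
      using t by (intro om_mono) (auto simp: abs_mult growth_def algebra_simps)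
    also have "\<dots> \<le> sqrt (growth z) * om t" by (rule om_scale[OF l t])
    also have "\<dots> \<le> growth z ^ 2 * om t"
    proof (intro mult_right_mono om_nonneg)
      have "growth z \<le> growth z ^ 2 * growth z ^ 2"
        using growth_power_mono[of 1 4 z] by (simp flip: power_add)
      then show "sqrt (growth z) \<le> growth z ^ 2"
        using l by (intro real_le_lsqrt) (auto simp: power2_eq_square)
    qed (use t in simp)
    finally show "\<bar>f (x + t *\<^sub>R z) - f x\<bar> \<le> om t * growth z ^ 2" by (simp add: mult.commute)
  qed (use om_nonneg t in simp)
  finally show ?thesis by (simp add: mult.commute)
qed

text \<open>Halves any admissible \<open>Q\<close> up to a universal constant. Every entry of
  \<open>D^2 w - A\<close> is a derivative of \<open>v1\<close> or \<open>v2\<close>, the deviation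
  of the gradient from its affine approximation. That deviation has size \<open>t * e\<close>, and
  integration by parts costs \<open>1 / t\<close>.\<close>

lemma bootstrap:
  assumes Q_nonneg: "Q \<ge> 0"
    and Q: "\<And>r x a b. 0 < r \<Longrightarrow> r \<le> R \<Longrightarrow> 1 \<le> a + b \<Longrightarrow> a + b \<le> 3 \<Longrightarrow> \<bar>gauss_avg (hermite2 a b) g r x\<bar> \<le> Q * envelope r"
    and t: "0 < t" "t \<le> R" and ab: "1 \<le> a + b" "a + b \<le> 3"
  shows "\<bar>gauss_avg (hermite2 a b) g t x\<bar> \<le> (moment_const + 8 * moment_const\<^sup>2 + Q / 2) * envelope t"
proof -
  have t0: "t \<noteq> 0" using t by simp
  define A11 A12 A22 where "A11 = heat_deriv (Suc (Suc 0)) 0 w t x" and "A12 = heat_deriv (Suc 0) (Suc 0) w t x"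
    and "A22 = heat_deriv 0 (Suc (Suc 0)) w t x"
  have A: "\<bar>A11\<bar> \<le> N" "\<bar>A12\<bar> \<le> N" "\<bar>A22\<bar> \<le> N"
    unfolding A11_def A12_def A22_def by (rule heat_deriv2_bound[OF t0])+
  define v1 where "v1 y = w1 y - heat_deriv (Suc 0) 0 w t x - (fst y - fst x) * A11 - (snd y - snd x) * A12" for y
  define v2 where "v2 y = w2 y - heat_deriv 0 (Suc 0) w t x - (fst y - fst x) * A12 - (snd y - snd x) * A22" for y
  have C1_v1: "C1 v1 (\<lambda>y. w11 y - A11) (\<lambda>y. w12 y - A12)" and C1_v2: "C1 v2 (\<lambda>y. w12 y - A12) (\<lambda>y. w22 y - A22)"
    unfolding v1_def[abs_def] v2_def[abs_def] by (rule C1_minus_affine C1_w1 C1_w2)+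
  define G where "G = moment_const * N / R + 2 * (Q * envelope t) / t"
  have G: "\<bar>heat_deriv c d w t y\<bar> \<le> G" if "c + d = 3" for c d y
    unfolding G_def by (rule third_order[OF Q_nonneg Q t that])
  \<comment> \<open>One \<open>Q * envelope t\<close> comes from \<open>first_order\<close>; two
    more and the outer-scale term come from the Taylor remainder with
    \<open>third_order\<close>.\<close>
  define e where "e = 3 * (Q * envelope t) + moment_const * N * (t / R)"
  have Qb: "Q * envelope t \<ge> 0" using Q_nonneg envelope_pos[of t] t by simp
  have KK0: "moment_const \<ge> 0" using moment_const_ge_1 by simp
  have e0: "e \<ge> 0" unfolding e_def using Qb KK0 N_pos R_pos t by simp
  have remainder: "t * (Q * envelope t) + G * (\<bar>fst (t *\<^sub>R z)\<bar> + \<bar>snd (t *\<^sub>R z)\<bar>)\<^sup>2 \<le> (t * e) * growth z ^ 2" for z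
  proof -
    have G0: "G \<ge> 0" using G[of 3 0 x] by linarith
    have "(\<bar>fst (t *\<^sub>R z)\<bar> + \<bar>snd (t *\<^sub>R z)\<bar>) \<le> t * growth z"
      using t by (simp add: growth_def abs_mult algebra_simps)
    then have "(\<bar>fst (t *\<^sub>R z)\<bar> + \<bar>snd (t *\<^sub>R z)\<bar>)\<^sup>2 \<le> (t * growth z)\<^sup>2" by (intro power_mono) auto
    then have "G * (\<bar>fst (t *\<^sub>R z)\<bar> + \<bar>snd (t *\<^sub>R z)\<bar>)\<^sup>2 \<le> G * (t * growth z)\<^sup>2" by (rule mult_left_mono[OF _ G0])
    also have "\<dots> = (t * (2 * (Q * envelope t) + moment_const * N * (t / R))) * growth z ^ 2"
      unfolding G_def using t R_pos by (simp add: power2_eq_square field_simps)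
    finally have 1: "G * (\<bar>fst (t *\<^sub>R z)\<bar> + \<bar>snd (t *\<^sub>R z)\<bar>)\<^sup>2 \<le> (t * (2 * (Q * envelope t) + moment_const * N * (t / R))) * growth z ^ 2" .
    have "(t * (Q * envelope t)) * 1 \<le> (t * (Q * envelope t)) * growth z ^ 2"
      using t Qb one_le_power[OF growth_ge_1[of z], of 2] by (intro mult_left_mono) auto
    with 1 show ?thesis by (simp add: e_def algebra_simps)
  qed
  have vb1: "\<bar>v1 (x + t *\<^sub>R z)\<bar> \<le> (t * e) * growth z ^ 2" for z
  proof -
    note first_order(1)[OF Q_nonneg Q t, of "x + t *\<^sub>R z"]
    moreover have "\<bar>heat_deriv (Suc 0) 0 w t (x + t *\<^sub>R z) - heat_deriv (Suc 0) 0 w t x - fst (t *\<^sub>R z) * heat_deriv (Suc (Suc 0)) 0 w t x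
        - snd (t *\<^sub>R z) * heat_deriv (Suc 0) (Suc 0) w t x\<bar> \<le> G * (\<bar>fst (t *\<^sub>R z)\<bar> + \<bar>snd (t *\<^sub>R z)\<bar>)\<^sup>2"
      by (rule heat_deriv_taylor[OF t(1) _ G]) auto
    moreover have "v1 (x + t *\<^sub>R z) = w1 (x + t *\<^sub>R z) - heat_deriv (Suc 0) 0 w t x - fst (t *\<^sub>R z) * heat_deriv (Suc (Suc 0)) 0 w t x
        - snd (t *\<^sub>R z) * heat_deriv (Suc 0) (Suc 0) w t x"
      by (simp add: v1_def A11_def A12_def)
    ultimately show ?thesis using remainder[of z] by linarith
  qed
  have vb2: "\<bar>v2 (x + t *\<^sub>R z)\<bar> \<le> (t * e) * growth z ^ 2" for z
  proof -
    note first_order(2)[OF Q_nonneg Q t, of "x + t *\<^sub>R z"]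
    moreover have "\<bar>heat_deriv 0 (Suc 0) w t (x + t *\<^sub>R z) - heat_deriv 0 (Suc 0) w t x - fst (t *\<^sub>R z) * heat_deriv (Suc 0) (Suc 0) w t x
        - snd (t *\<^sub>R z) * heat_deriv 0 (Suc (Suc 0)) w t x\<bar> \<le> G * (\<bar>fst (t *\<^sub>R z)\<bar> + \<bar>snd (t *\<^sub>R z)\<bar>)\<^sup>2"
      by (rule heat_deriv_taylor[OF t(1) _ G]) auto
    moreover have "v2 (x + t *\<^sub>R z) = w2 (x + t *\<^sub>R z) - heat_deriv 0 (Suc 0) w t x - fst (t *\<^sub>R z) * heat_deriv (Suc 0) (Suc 0) w t x
        - snd (t *\<^sub>R z) * heat_deriv 0 (Suc (Suc 0)) w t x"
      by (simp add: v2_def A12_def A22_def)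
    ultimately show ?thesis using remainder[of z] by linarith
  qed
  have te: "t * e \<ge> 0" using t e0 by simp
  have B: "\<bar>gauss_avg (hermite2 a b) h t x\<bar> \<le> e * moment_const"
    if v: "C1 v h h2" and vb: "\<And>z. \<bar>v (x + t *\<^sub>R z)\<bar> \<le> (t * e) * growth z ^ 2" for v h h2
  proof -
    have "t * \<bar>gauss_avg (hermite2 a b) h t x\<bar> \<le> t * (e * moment_const)"
      using gauss_avg_hermite2_bound[OF _ C1_tempered(1)[OF v] vb te, of "Suc a" b] ab t
      by (simp add: gauss_avg_hermite2_shift(1)[OF v] abs_mult mult.assoc)
    then show ?thesis using t by simp
  qed
  have B': "\<bar>gauss_avg (hermite2 a b) h t x\<bar> \<le> e * moment_const"
    if v: "C1 v h1 h" and vb: "\<And>z. \<bar>v (x + t *\<^sub>R z)\<bar> \<le> (t * e) * growth z ^ 2" for v h h1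
  proof -
    have "t * \<bar>gauss_avg (hermite2 a b) h t x\<bar> \<le> t * (e * moment_const)"
      using gauss_avg_hermite2_bound[OF _ C1_tempered(1)[OF v] vb te, of a "Suc b"] ab t
      by (simp add: gauss_avg_hermite2_shift(2)[OF v] abs_mult mult.assoc)
    then show ?thesis using t by simp
  qed
  let ?B11 = "\<lambda>y. w11 y - A11" and ?B12 = "\<lambda>y. w12 y - A12" and ?B22 = "\<lambda>y. w22 y - A22"
  let ?D = "\<lambda>y. ?B11 y * ?B22 y - ?B12 y * ?B12 y"
  have D: "\<bar>gauss_avg (hermite2 a b) ?D t x\<bar> \<le> 4 * N * (e * moment_const)"
    using null_lagrangian[OF t(1) ab(2) C1_v1 vb1 te A(2,3)] t by simp
  have adms: "tempered ?B11" "tempered ?B12" "tempered ?B22" "tempered ?D"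
    by (intro tempered_diff tempered_mult tempered_w tempered_const)+
  have cadms: "tempered (\<lambda>y. A11 * ?B22 y)" "tempered (\<lambda>y. A22 * ?B11 y)" "tempered (\<lambda>y. 2 * A12 * ?B12 y)"
    by (rule tempered_mult[OF tempered_const], rule adms)+
  define k where "k = A11 * A22 - A12 * A12"
  have "g = (\<lambda>y. f y - (((A11 * ?B22 y + A22 * ?B11 y) - 2 * A12 * ?B12 y) + (?D y + k)))"
    using eqn by (auto simp: fun_eq_iff g_def k_def algebra_simps)
  then have "gauss_avg (hermite2 a b) g t x = gauss_avg (hermite2 a b) f t x - (((A11 * gauss_avg (hermite2 a b) ?B22 t x + A22 * gauss_avg (hermite2 a b) ?B11 t x)
      - 2 * A12 * gauss_avg (hermite2 a b) ?B12 t x) + (gauss_avg (hermite2 a b) ?D t x + 0))"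
    by (simp only: gauss_avg_diff_right[OF tempered_hermite2 tempered_f tempered_add[OF tempered_diff[OF tempered_add[OF cadms(1,2)] cadms(3)] tempered_add[OF adms(4) tempered_const]]]
        gauss_avg_add_right[OF tempered_hermite2 tempered_diff[OF tempered_add[OF cadms(1,2)] cadms(3)] tempered_add[OF adms(4) tempered_const]]
        gauss_avg_diff_right[OF tempered_hermite2 tempered_add[OF cadms(1,2)] cadms(3)]
        gauss_avg_add_right[OF tempered_hermite2 cadms(1,2)] gauss_avg_add_right[OF tempered_hermite2 adms(4) tempered_const] gauss_avg_hermite2_const[OF ab(1)] gauss_avg_cmult_right)
  moreover have "\<bar>A11 * gauss_avg (hermite2 a b) ?B22 t x\<bar> \<le> N * (e * moment_const)" "\<bar>A22 * gauss_avg (hermite2 a b) ?B11 t x\<bar> \<le> N * (e * moment_const)"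
    "\<bar>A12 * gauss_avg (hermite2 a b) ?B12 t x\<bar> \<le> N * (e * moment_const)"
    unfolding abs_mult using A N_pos
    by (intro mult_mono B'[OF C1_v2 vb2] B[OF C1_v1 vb1] B[OF C1_v2 vb2]; simp)+
  moreover have "\<bar>gauss_avg (hermite2 a b) f t x\<bar> \<le> moment_const * om t" by (rule gauss_avg_f_bound[OF t(1) ab(1)]) (use ab in simp)
  ultimately have "\<bar>gauss_avg (hermite2 a b) g t x\<bar> \<le> moment_const * om t + 8 * (N * (e * moment_const))"
    using D by linarith
  \<comment> \<open>The 8 is 4 for the linear terms, the mixed one counted twice, plus 4 for the
    determinant of the deviation. With the 3 in \<open>e\<close> the gain on \<open>Q\<close> is
    \<open>24 * N * moment_const\<close>, at most 1/2: the origin of the 48 in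
    \<open>small\<close>.\<close>
  also have "8 * (N * (e * moment_const)) = (48 * N * moment_const) * (Q * envelope t / 2) + 8 * moment_const\<^sup>2 * (N * (N * (t / R)))"
    by (simp add: e_def power2_eq_square algebra_simps)
  also have "(48 * N * moment_const) * (Q * envelope t / 2) \<le> 1 * (Q * envelope t / 2)"
    using Qb by (intro mult_right_mono small) simp
  also have "8 * moment_const\<^sup>2 * (N * (N * (t / R))) \<le> 8 * moment_const\<^sup>2 * envelope t"
    by (intro mult_left_mono N2_le_envelope t) simp
  also have "moment_const * om t \<le> moment_const * envelope t"
    unfolding envelope_def using KK0 N_pos \<delta>_pos t R_pos by (intro mult_left_mono) auto
  finally show ?thesis by (simp add: algebra_simps)
qed

text \<open>For the finite supremum of all quotients, \<open>bootstrap\<close> reads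
  \<open>Sup S \<le> c + Sup S / 2\<close> with a universal \<open>c\<close>, which can be solved.
  The supremum runs over all points, scales and three orders at once, because
  \<open>bootstrap\<close> draws on all of them.\<close>

lemma absolute_bound:
  assumes t: "0 < t" "t \<le> R" and ab: "1 \<le> a + b" "a + b \<le> 3"
  shows "\<bar>gauss_avg (hermite2 a b) g t x\<bar> \<le> 2 * (moment_const + 8 * moment_const\<^sup>2) * envelope t"
proof -
  define S where "S = {\<bar>gauss_avg (hermite2 a b) g r x\<bar> / envelope r | a b r x. 0 < r \<and> r \<le> R \<and> 1 \<le> a + b \<and> a + b \<le> 3}"
  have gb: "\<bar>g y\<bar> \<le> 2 * N" for y
    using bnd2(1)[of y] bnd2(3)[of y] by (simp add: g_def)
  have bdd: "bdd_above S"
  proof (rule bdd_aboveI)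
    fix s assume "s \<in> S"
    then obtain a b r x where s: "s = \<bar>gauss_avg (hermite2 a b) g r x\<bar> / envelope r" "0 < r" "a + b \<le> 3" by (auto simp: S_def)
    have "N * \<delta> \<le> envelope r" unfolding envelope_def using om_nonneg[of r] s R_pos by simp
    then show "s \<le> (2 * N * moment_const) / (N * \<delta>)"
      unfolding s(1) using gauss_avg_hermite2_bounded[of a b g "2 * N" r x] s gb tempered_g N_pos \<delta>_pos moment_const_ge_1
      by (intro frac_le) auto
  qed
  have mem: "\<bar>gauss_avg (hermite2 a b) g r x\<bar> / envelope r \<in> S" if "0 < r" "r \<le> R" "1 \<le> a + b" "a + b \<le> 3" for r x a b
    unfolding S_def using that by blast
  have S_ne: "S \<noteq> {}" using mem[OF t ab] by auto
  have Sup0: "Sup S \<ge> 0"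
    using cSup_upper[OF mem[OF t ab] bdd] envelope_pos[of t] t by (meson abs_ge_zero divide_nonneg_pos less_imp_le order_trans)
  have Q: "\<bar>gauss_avg (hermite2 a b) g r x\<bar> \<le> Sup S * envelope r" if "0 < r" "r \<le> R" "1 \<le> a + b" "a + b \<le> 3" for r x a b
    using cSup_upper[OF mem[OF that] bdd] envelope_pos[of r] that by (simp add: pos_divide_le_eq)
  have "Sup S \<le> moment_const + 8 * moment_const\<^sup>2 + Sup S / 2"
  proof (rule cSup_least[OF S_ne])
    fix s assume "s \<in> S"
    then obtain a b r x where s: "s = \<bar>gauss_avg (hermite2 a b) g r x\<bar> / envelope r" "0 < r" "r \<le> R" "1 \<le> a + b" "a + b \<le> 3" by (auto simp: S_def)
    show "s \<le> moment_const + 8 * moment_const\<^sup>2 + Sup S / 2"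
      using bootstrap[OF Sup0 Q s(2,3,4,5), of x] envelope_pos[of r] s by (simp add: pos_divide_le_eq)
  qed
  then have "Sup S \<le> 2 * (moment_const + 8 * moment_const\<^sup>2)" by simp
  then have "Sup S * envelope t \<le> 2 * (moment_const + 8 * moment_const\<^sup>2) * envelope t"
    using envelope_pos[of t] t by (intro mult_right_mono) auto
  with Q[OF t ab, of x] show ?thesis by linarith
qed

text \<open>At order 2 the scale derivative is a Hermite average divided by \<open>r\<close>, so the
  change from \<open>t\<close> to \<open>R\<close> is a Dini integral of \<open>envelope\<close>;
  \<open>Om\<close> is the primitive for \<open>om\<close>. At scale \<open>R\<close> one index
  stays on the kernel and the other gives the bounded gradient, hence the factor
  \<open>1 / R\<close>.\<close>

lemma second_order:
  assumes t: "0 < t" "t < R" and ab: "a + b = 2"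
    and Om: "\<And>r. r > 0 \<Longrightarrow> (Om has_real_derivative om r / r) (at r)" "\<And>r. r > 0 \<Longrightarrow> Om r \<ge> 0"
  shows "\<bar>heat_deriv a b w t x\<bar> \<le> moment_const * N / R + 2 * (moment_const + 8 * moment_const\<^sup>2) * (Om R + 2 * N\<^sup>2 + N * \<delta> * (ln R - ln t))"
proof -
  have R0: "R \<noteq> 0" using R_pos by simp
  define bound_const where "bound_const = 2 * (moment_const + 8 * moment_const\<^sup>2)"
  have bound_const: "bound_const \<ge> 0" using moment_const_ge_1 by (simp add: bound_const_def)
  have "\<bar>heat_deriv a b w R x\<bar> \<le> moment_const * N / R"
  proof -
    have *: "\<bar>heat_deriv c d h R x\<bar> \<le> moment_const * N / R" if "c + d = 1" "tempered h" "\<And>y. \<bar>h y\<bar> \<le> N" for c d h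
      using gauss_avg_hermite2_bounded[of c d h N R x] that R_pos by (simp add: heat_deriv_def divide_right_mono mult.commute)
    have "(a = Suc (Suc 0) \<and> b = 0) \<or> (a = Suc 0 \<and> b = Suc 0) \<or> (a = 0 \<and> b = Suc (Suc 0))"
      using ab by presburger
    moreover have "\<bar>heat_deriv (Suc (Suc 0)) 0 w R x\<bar> \<le> moment_const * N / R" "\<bar>heat_deriv (Suc 0) (Suc 0) w R x\<bar> \<le> moment_const * N / R"
      "\<bar>heat_deriv 0 (Suc (Suc 0)) w R x\<bar> \<le> moment_const * N / R"
      unfolding heat_deriv_shifts(1,2)[OF R0] by (rule *; simp add: tempered_w bnd1)+
    ultimately show ?thesis by auto
  qed
  \<comment> \<open>The comparison function is a primitive of
    \<open>bound_const * envelope r / r\<close>: its square root and logarithm come from the two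
    auxiliary terms of \<open>envelope\<close>.\<close>
  moreover have "norm (heat_deriv a b w R x - heat_deriv a b w t x) \<le>
      bound_const * (Om R + 2 * N\<^sup>2 * sqrt (R / R) + N * \<delta> * ln R) - bound_const * (Om t + 2 * N\<^sup>2 * sqrt (t / R) + N * \<delta> * ln t)"
  proof (rule differentiable_bound_general[OF t(2)])
    show "continuous_on {t..R} (\<lambda>t. heat_deriv a b w t x)"
      by (rule continuous_at_imp_continuous_on, rule ballI, rule DERIV_isCont, rule heat) (use t in auto)
    have d: "((\<lambda>r. bound_const * (Om r + 2 * N\<^sup>2 * sqrt (r / R) + N * \<delta> * ln r)) has_real_derivative bound_const * envelope r / r) (at r)" if r: "r > 0" for r
    proof -
      have "((\<lambda>r. sqrt (r / R)) has_real_derivative inverse (sqrt (r / R)) / 2 * (1 / R)) (at r)"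
        using r R_pos by (intro DERIV_chain'[where f = "\<lambda>r. r / R" and g = sqrt] DERIV_real_sqrt) (auto intro!: derivative_eq_intros)
      moreover have "inverse (sqrt (r / R)) / 2 * (1 / R) = sqrt (r / R) / (2 * r)"
      proof -
        define s where "s = sqrt (r / R)"
        have "s > 0" "s * s = r / R" using r R_pos by (simp_all add: s_def)
        then have "r = R * (s * s)" using R_pos by simp
        then show ?thesis
          unfolding s_def[symmetric] using \<open>s > 0\<close> R_pos by (simp add: divide_simps)
      qed
      ultimately have s: "((\<lambda>r. sqrt (r / R)) has_real_derivative sqrt (r / R) / (2 * r)) (at r)" by simp
      have "((\<lambda>r. bound_const * (Om r + 2 * N\<^sup>2 * sqrt (r / R) + N * \<delta> * ln r)) has_real_derivative
          bound_const * (om r / r + 2 * N\<^sup>2 * (sqrt (r / R) / (2 * r)) + N * \<delta> * (inverse r))) (at r)"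
        by (intro DERIV_cmult DERIV_add Om s DERIV_ln r)
      moreover have "bound_const * (om r / r + 2 * N\<^sup>2 * (sqrt (r / R) / (2 * r)) + N * \<delta> * (inverse r)) = bound_const * envelope r / r"
        using r by (simp add: envelope_def field_simps)
      ultimately show ?thesis by (simp only:)
    qed
    show "continuous_on {t..R} (\<lambda>r. bound_const * (Om r + 2 * N\<^sup>2 * sqrt (r / R) + N * \<delta> * ln r))"
      by (rule continuous_at_imp_continuous_on, rule ballI, rule DERIV_isCont, rule d) (use t in auto)
    fix r assume r: "t < r" "r < R"
    then have r0: "r > 0" using t by simp
    show "((\<lambda>t. heat_deriv a b w t x) has_vector_derivative r * heat_deriv a b g r x) (at r)"
      using heat[OF r0] by (simp add: has_real_derivative_iff_has_vector_derivative)
    show "((\<lambda>r. bound_const * (Om r + 2 * N\<^sup>2 * sqrt (r / R) + N * \<delta> * ln r)) has_vector_derivative bound_const * envelope r / r) (at r)"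
      using d[OF r0] by (simp only: has_real_derivative_iff_has_vector_derivative)
    have "r * heat_deriv a b g r x = gauss_avg (hermite2 a b) g r x / r"
      unfolding heat_deriv_def ab using r0 by (simp add: power2_eq_square)
    then show "norm (r * heat_deriv a b g r x) \<le> bound_const * envelope r / r"
      using absolute_bound[of r a b x] r r0 ab by (simp add: bound_const_def divide_right_mono)
  qed
  moreover have "bound_const * (Om t + 2 * N\<^sup>2 * sqrt (t / R) + N * \<delta> * ln t) \<ge> bound_const * (N * \<delta> * ln t)"
    using Om(2)[OF t(1)] t R_pos bound_const by (intro mult_left_mono) auto
  ultimately have "\<bar>heat_deriv a b w t x\<bar> \<le> moment_const * N / R + (bound_const * (Om R + 2 * N\<^sup>2 + N * \<delta> * ln R) - bound_const * (N * \<delta> * ln t))"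
    using R0 by simp
  also have "\<dots> = moment_const * N / R + bound_const * (Om R + 2 * N\<^sup>2 + N * \<delta> * (ln R - ln t))" by (simp add: algebra_simps)
  finally show ?thesis by (simp add: bound_const_def)
qed

end

section \<open>The Hessian bound\<close>

text \<open>Chosen so that the average at the outer scale contributes \<open>N / 64\<close>, which
  can be returned to the left-hand side.\<close>

definition outer_scale :: real where "outer_scale = 64 * moment_const"
definition bound_const :: real where "bound_const = 2 * (moment_const + 8 * moment_const\<^sup>2)"

lemma moment_const_le_bound_const: "16 * moment_const \<le> bound_const"
proof -
  have "moment_const \<le> moment_const\<^sup>2"
    using moment_const_ge_1 by (rule self_le_power) simp
  then have "16 * moment_const \<le> 2 * (8 * moment_const\<^sup>2)" by linarith
  also have "\<dots> \<le> bound_const" using moment_const_ge_1 by (simp add: bound_const_def)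
  finally show ?thesis .
qed

lemma bound_const_pos: "bound_const > 0"
  using moment_const_le_bound_const moment_const_ge_1 by linarith

lemma outer_scale_ge_1: "outer_scale \<ge> 1"
  using moment_const_ge_1 unfolding outer_scale_def by linarith

text \<open>Schwarz's theorem: integrating by parts in either order leads to the same kernel against
  \<open>w\<close>, so both mixed derivatives have the same averages at every positive scale, and
  the scale tends to 0.\<close>

lemma mixed_partials_eq:
  assumes w: "C1 w w1 w2" and w1: "C1 w1 w11 w12" and w2: "C1 w2 w21 w22"
  shows "w12 x = w21 x"
proof -
  define S where "S n = 1 / real (Suc n)" for n
  have S0: "S n \<noteq> 0" for n by (simp add: S_def)
  have "S \<longlonglongrightarrow> 0"
    unfolding S_def[abs_def] by (rule LIMSEQ_Suc[OF lim_const_over_n])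
  note lim = gauss_avg_0_0_tendsto[OF C1_tempered(3)[OF w1] this, of x] gauss_avg_0_0_tendsto[OF C1_tempered(2)[OF w2] this, of x]
  have eq: "gauss_avg (hermite2 0 0) w12 (S n) x = gauss_avg (hermite2 0 0) w21 (S n) x" for n
  proof -
    have "heat_deriv 0 0 w12 (S n) x = heat_deriv (Suc 0) (Suc 0) w (S n) x"
      using heat_deriv_shift(1)[OF w S0, of 0 "Suc 0"] heat_deriv_shift(2)[OF w1 S0] by simp
    also have "\<dots> = heat_deriv 0 0 w21 (S n) x"
      using heat_deriv_shift(2)[OF w S0, of "Suc 0" 0] heat_deriv_shift(1)[OF w2 S0] by simp
    finally show ?thesis by (simp add: heat_deriv_def)
  qed
  show ?thesis by (rule LIMSEQ_unique[OF lim(1)[unfolded eq] lim(2)])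
qed

text \<open>The modulus in \<open>osc\<close> has an explicit primitive against dt / t, the
  logarithm in the conclusion, and \<open>\<beta> \<le> 1 / 2\<close> yields
  \<open>om_scale\<close>. Half of \<open>N / 32\<close> comes from the outer scale, half from
  \<open>2 * bound_const * N^2\<close> by the bound on \<open>N\<close>.\<close>

lemma hessian_log_bound:
  fixes w w1 w2 w11 w12 w22 f :: "real \<times> real \<Rightarrow> real"
  assumes C1: "C1 w w1 w2" "C1 w1 w11 w12" "C1 w2 w12 w22" and f: "tempered f"
    and N: "N > 0" "N \<le> 1 / (128 * bound_const)"
    and bnd1: "\<And>y. \<bar>w1 y\<bar> \<le> N" "\<And>y. \<bar>w2 y\<bar> \<le> N"
    and bnd2: "\<And>y. \<bar>w11 y\<bar> \<le> N" "\<And>y. \<bar>w12 y\<bar> \<le> N" "\<And>y. \<bar>w22 y\<bar> \<le> N"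
    and eqn: "\<And>y. w11 y + w22 y + w11 y * w22 y - w12 y * w12 y = f y"
    and M: "M \<ge> 0" and h: "h \<ge> 0" and \<beta>: "0 < \<beta>" "\<beta> \<le> 1 / 2"
    and osc: "\<And>x y. \<bar>f (x + y) - f x\<bar> \<le>
      M * (h * (\<bar>fst y\<bar> + \<bar>snd y\<bar>) powr \<beta> / (1 + h * (\<bar>fst y\<bar> + \<bar>snd y\<bar>) powr \<beta>))"
  shows "\<bar>w11 x\<bar> \<le> N / 32 + bound_const * (M / \<beta> * ln (1 + h * outer_scale powr \<beta>))"
    and "\<bar>w12 x\<bar> \<le> N / 32 + bound_const * (M / \<beta> * ln (1 + h * outer_scale powr \<beta>))"
    and "\<bar>w22 x\<bar> \<le> N / 32 + bound_const * (M / \<beta> * ln (1 + h * outer_scale powr \<beta>))"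
proof -
  define om where "om t = M * (h * t powr \<beta> / (1 + h * t powr \<beta>))" for t
  define Om where "Om t = M / \<beta> * ln (1 + h * t powr \<beta>)" for t
  have R: "outer_scale > 0" using outer_scale_ge_1 by simp
  have pos: "1 + h * t powr \<beta> > 0" for t
    using h by (simp add: add_pos_nonneg)
  have "N * (16 * moment_const) \<le> N * bound_const" using moment_const_le_bound_const N by (intro mult_left_mono) auto
  moreover have NK2: "N * bound_const \<le> 1 / 128" using N(2) bound_const_pos by (simp add: field_simps)
  ultimately have small: "48 * N * moment_const \<le> 1" by simp
  have loc: "monge_ampere w w1 w2 w11 w12 w22 f N outer_scale \<delta> om" if "\<delta> > 0" for \<delta>
  proof
    show "om t \<ge> 0" for t
      unfolding om_def using M h pos[of t] by (intro mult_nonneg_nonneg divide_nonneg_pos) auto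
    fix s t :: real assume st: "0 \<le> s" "s \<le> t"
    have "s powr \<beta> \<le> t powr \<beta>" using st \<beta> by (intro powr_mono2) auto
    then have "h * s powr \<beta> \<le> h * t powr \<beta>" using h by (rule mult_left_mono)
    moreover have "a / (1 + a) \<le> b / (1 + b)" if "0 \<le> a" "a \<le> b" for a b :: real
      using that by (simp add: divide_simps algebra_simps)
    ultimately show "om s \<le> om t"
      unfolding om_def using M h by (intro mult_left_mono) auto
  next
    fix c t :: real assume c: "c \<ge> 1" and t: "t > 0"
    have c1: "c powr \<beta> \<ge> 1" using c \<beta> by (simp add: ge_one_powr_ge_zero)
    have c2: "c powr \<beta> \<le> sqrt c"
      using c \<beta> powr_mono[of \<beta> "1 / 2" c] by (simp add: powr_half_sqrt)
    have le: "1 + h * t powr \<beta> \<le> 1 + h * (c powr \<beta> * t powr \<beta>)"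
      using mult_right_mono[OF c1, of "t powr \<beta>"] h by (simp add: mult_left_mono)
    have "om (c * t) = M * (c powr \<beta> * (h * t powr \<beta> / (1 + h * (c powr \<beta> * t powr \<beta>))))"
      using c t by (simp add: om_def powr_mult mult_ac)
    also have "\<dots> \<le> M * (sqrt c * (h * t powr \<beta> / (1 + h * t powr \<beta>)))"
      using M h c c2 pos[of t] le by (intro mult_left_mono mult_mono frac_le) auto
    finally show "om (c * t) \<le> sqrt c * om t" by (simp add: om_def mult_ac)
  qed (fact C1 f N R that bnd1 bnd2 eqn small osc[folded om_def])+
  have Om: "(Om has_real_derivative om r / r) (at r)" if r: "r > 0" for r
  proof -
    have "((\<lambda>t. 1 + h * t powr \<beta>) has_real_derivative 0 + h * (\<beta> * r powr (\<beta> - 1))) (at r)"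
      by (rule DERIV_add[OF DERIV_const DERIV_cmult[OF has_real_derivative_powr[OF r]]])
    from DERIV_cmult[OF DERIV_chain2[OF DERIV_ln[OF pos] this], of "M / \<beta>"]
    have "(Om has_real_derivative M / \<beta> * (inverse (1 + h * r powr \<beta>) * (0 + h * (\<beta> * r powr (\<beta> - 1))))) (at r)"
      unfolding Om_def[abs_def] .
    moreover have "M / \<beta> * (inverse (1 + h * r powr \<beta>) * (0 + h * (\<beta> * r powr (\<beta> - 1)))) = om r / r"
    proof -
      have "r powr (\<beta> - 1) = r powr \<beta> / r" using r by (simp add: powr_diff)
      then show ?thesis unfolding om_def using \<beta>(1) by (simp add: divide_inverse)
    qed
    ultimately show ?thesis by (simp only:)
  qed
  have Om0: "Om r \<ge> 0" for r
    unfolding Om_def using M \<beta> h by (intro mult_nonneg_nonneg ln_ge_zero) auto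
  have *: "\<bar>heat_deriv a b w t x\<bar> \<le> N / 32 + bound_const * Om outer_scale" if t: "0 < t" "t < outer_scale" and ab: "a + b = 2" for a b t
  proof -
    have L: "ln outer_scale - ln t > 0" using t by simp
    have "\<bar>heat_deriv a b w t x\<bar> \<le> moment_const * N / outer_scale + bound_const * (Om outer_scale + 2 * N\<^sup>2)"
    proof (rule field_le_epsilon)
      fix e :: real assume e: "e > 0"
      \<comment> \<open>With \<open>t\<close> still fixed, the regularising term contributes exactly
        \<open>e\<close>. Only after \<open>e\<close> is gone may \<open>t\<close> tend to 0, since
        the logarithm of \<open>t\<close> diverges.\<close>
      define \<delta> where "\<delta> = e / (bound_const * N * (ln outer_scale - ln t))"
      have den: "bound_const * N * (ln outer_scale - ln t) > 0" using bound_const_pos N L by (intro mult_pos_pos)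
      have \<delta>: "\<delta> > 0" unfolding \<delta>_def by (rule divide_pos_pos[OF e den])
      have "\<delta> * (bound_const * N * (ln outer_scale - ln t)) = e"
        unfolding \<delta>_def by (rule nonzero_eq_divide_eq[THEN iffD1, OF _ refl]) (use den in linarith)
      then have e': "bound_const * (N * \<delta> * (ln outer_scale - ln t)) = e" by (simp only: mult_ac)
      have "\<bar>heat_deriv a b w t x\<bar> \<le> moment_const * N / outer_scale + bound_const * (Om outer_scale + 2 * N\<^sup>2 + N * \<delta> * (ln outer_scale - ln t))"
        unfolding bound_const_def by (rule monge_ampere.second_order[OF loc[OF \<delta>] t ab Om Om0])
      also have "\<dots> = moment_const * N / outer_scale + bound_const * (Om outer_scale + 2 * N\<^sup>2) + e"
        unfolding distrib_left[of bound_const] e' by simp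
      finally show "\<bar>heat_deriv a b w t x\<bar> \<le> moment_const * N / outer_scale + bound_const * (Om outer_scale + 2 * N\<^sup>2) + e" .
    qed
    also have "moment_const * N / outer_scale = N / 64" using moment_const_ge_1 by (simp add: outer_scale_def)
    also have "bound_const * (Om outer_scale + 2 * N\<^sup>2) = bound_const * Om outer_scale + 2 * (N * (N * bound_const))"
      by (simp add: power2_eq_square algebra_simps)
    also have "N * (N * bound_const) \<le> N * (1 / 128)" using NK2 N by (intro mult_left_mono) auto
    finally show ?thesis by simp
  qed
  \<comment> \<open>The shift by two keeps \<open>S 0\<close> below 1, hence strictly below
    \<open>outer_scale\<close>.\<close>
  define S where "S n = 1 / real (Suc (Suc n))" for n
  have S: "S n > 0" "S n < outer_scale" for n
  proof -
    show "S n > 0" by (simp add: S_def)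
    have "S n < 1" by (simp add: S_def)
    then show "S n < outer_scale" using outer_scale_ge_1 by linarith
  qed
  have S0: "S n \<noteq> 0" for n using S(1)[of n] by simp
  have lim: "S \<longlonglongrightarrow> 0"
    unfolding S_def[abs_def] by (rule LIMSEQ_Suc[OF LIMSEQ_Suc[OF lim_const_over_n]])
  have **: "\<bar>k x\<bar> \<le> N / 32 + bound_const * Om outer_scale"
    if k: "tempered k" "\<And>n. heat_deriv a b w (S n) x = heat_deriv 0 0 k (S n) x" and ab: "a + b = 2" for a b k
  proof (rule tendsto_upperbound[OF tendsto_rabs[OF gauss_avg_0_0_tendsto[OF k(1) lim, of x]]])
    have "\<bar>gauss_avg (hermite2 0 0) k (S n) x\<bar> \<le> N / 32 + bound_const * Om outer_scale" for n
      using *[OF S ab, of n] unfolding k(2) by (simp add: heat_deriv_def)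
    then show "\<forall>\<^sub>F n in sequentially. \<bar>gauss_avg (hermite2 0 0) k (S n) x\<bar> \<le> N / 32 + bound_const * Om outer_scale"
      by (rule always_eventually[OF allI])
  qed (rule trivial_limit_sequentially)
  note shifts = heat_deriv_shift[OF C1(1) S0] heat_deriv_shift[OF C1(2) S0] heat_deriv_shift(2)[OF C1(3) S0]
  have "heat_deriv (Suc (Suc 0)) 0 w (S n) x = heat_deriv 0 0 w11 (S n) x" "heat_deriv (Suc 0) (Suc 0) w (S n) x = heat_deriv 0 0 w12 (S n) x"
    "heat_deriv 0 (Suc (Suc 0)) w (S n) x = heat_deriv 0 0 w22 (S n) x" for n
    using shifts(1)[of "Suc 0" 0 n] shifts(1)[of 0 "Suc 0" n] shifts(2)[of 0 "Suc 0" n] shifts(3)[of 0 0 n]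
      shifts(4)[of 0 0 n] shifts(5)[of 0 0 n] by simp_all
  then have "\<bar>w11 x\<bar> \<le> N / 32 + bound_const * Om outer_scale" "\<bar>w12 x\<bar> \<le> N / 32 + bound_const * Om outer_scale" "\<bar>w22 x\<bar> \<le> N / 32 + bound_const * Om outer_scale"
    using **[OF C1_tempered(2)[OF C1(2)], of "Suc (Suc 0)" 0] **[OF C1_tempered(3)[OF C1(2)], of "Suc 0" "Suc 0"]
      **[OF C1_tempered(3)[OF C1(3)], of 0 "Suc (Suc 0)"] by simp_all
  then show "\<bar>w11 x\<bar> \<le> N / 32 + bound_const * (M / \<beta> * ln (1 + h * outer_scale powr \<beta>))"
    "\<bar>w12 x\<bar> \<le> N / 32 + bound_const * (M / \<beta> * ln (1 + h * outer_scale powr \<beta>))"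
    "\<bar>w22 x\<bar> \<le> N / 32 + bound_const * (M / \<beta> * ln (1 + h * outer_scale powr \<beta>))"
    unfolding Om_def .
qed

section \<open>Functions on the torus\<close>

text \<open>The Gaussian calculus uses pairs because of the product measure and Fubini; the torus
  uses \<open>real^2\<close>.\<close>

definition emb :: "real \<times> real \<Rightarrow> real^2" where
  "emb p = fst p *\<^sub>R axis 1 1 + snd p *\<^sub>R axis 2 1"

lemma emb_nth [simp]: "emb p $ 1 = fst p" "emb p $ 2 = snd p"
  by (simp_all add: emb_def axis_def)

lemma emb_surj: "emb (x $ 1, x $ 2) = x"
  by (simp add: vec_eq_iff forall_2)

lemma emb_add: "emb (p + q) = emb p + emb q"
  by (simp add: vec_eq_iff forall_2)

lemma continuous_emb: "continuous_on S emb"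
  unfolding emb_def[abs_def] by (intro continuous_intros)

lemma norm_emb_le: "norm (emb p) \<le> \<bar>fst p\<bar> + \<bar>snd p\<bar>"
  using norm_le_l1_cart[of "emb p"] by (simp add: sum_2)

lemma has_derivative_emb: "(emb has_derivative emb) (at p)"
  unfolding emb_def[abs_def] by (auto intro!: derivative_eq_intros)

lemma torus_fun_floor: "torus_fun g \<Longrightarrow> g (x - (\<chi> i. of_int \<lfloor>x $ i\<rfloor>)) = g x"
proof -
  assume g: "torus_fun g"
  have "(\<chi> i. - of_int \<lfloor>x $ i\<rfloor>) \<in> int_lattice" by (simp add: int_lattice_def)
  then have "g (x + (\<chi> i. - of_int \<lfloor>x $ i\<rfloor>)) = g x" using g unfolding torus_fun_def by blast
  moreover have "x + (\<chi> i. - of_int \<lfloor>x $ i\<rfloor>) = x - (\<chi> i. of_int \<lfloor>x $ i\<rfloor>)"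
    by (simp add: vec_eq_iff)
  ultimately show ?thesis by simp
qed

lemma torus_fun_bounded:
  fixes g :: "real^2 \<Rightarrow> 'b::real_normed_vector"
  assumes "torus_fun g" "continuous_on UNIV g"
  obtains B where "\<And>x. norm (g x) \<le> B"
proof -
  have "compact (g ` cbox 0 1)"
    using assms(2) by (intro compact_continuous_image) (auto intro: continuous_on_subset)
  then obtain B where B: "\<And>x. x \<in> cbox 0 1 \<Longrightarrow> norm (g x) \<le> B"
    by (meson bounded_iff compact_imp_bounded imageI)
  have "norm (g x) \<le> B" for x
  proof -
    have "x - (\<chi> i. of_int \<lfloor>x $ i\<rfloor>) \<in> cbox 0 1"
      by (simp add: mem_box_cart) (metis frac_def frac_ge_0 frac_lt_1 less_imp_le)
    from B[OF this] show ?thesis by (simp only: torus_fun_floor[OF assms(1)])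
  qed
  then show ?thesis using that by blast
qed

lemma has_derivative_periodic:
  assumes "torus_fun u" "k \<in> int_lattice"
  shows "(u has_derivative D) (at (x + k)) \<longleftrightarrow> (u has_derivative D) (at x)"
proof -
  have *: "(u has_derivative D) (at y)" if "(u has_derivative D) (at (y + l))" "l \<in> int_lattice" for y l
  proof -
    have "((\<lambda>y. y + l) has_derivative (\<lambda>v. v)) (at y)" by (auto intro!: derivative_eq_intros)
    from has_derivative_compose[OF this that(1)]
    have "((\<lambda>y. u (y + l)) has_derivative D) (at y)" .
    then show ?thesis using assms(1) that(2) by (simp add: torus_fun_def)
  qed
  have "- k \<in> int_lattice" using assms(2) by (simp add: int_lattice_def)
  then show ?thesis using *[of x k] *[of "x + k" "- k"] assms(2) by auto
qed

text \<open>The derivatives at both points satisfy the same predicate, so the choice operator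
  returns the same function.\<close>

lemma frechet_derivative_periodic:
  assumes "torus_fun u" "k \<in> int_lattice"
  shows "frechet_derivative u (at (x + k)) = frechet_derivative u (at x)"
  unfolding frechet_derivative_def has_derivative_periodic[OF assms] ..

lemma torus_fun_gradient: "torus_fun u \<Longrightarrow> torus_fun (gradient u)"
  by (simp add: torus_fun_def[of "gradient u"] gradient_def frechet_derivative_periodic)

lemma torus_fun_hessian: "torus_fun u \<Longrightarrow> torus_fun (hessian u)"
  using torus_fun_gradient[of u]
  by (simp add: torus_fun_def[of "hessian u"] hessian_def jacobian_def frechet_derivative_periodic)

text \<open>A nonempty open subset of the fundamental domain has positive measure and cannot lie in
  the exceptional set.\<close>

lemma torus_measure_AE_imp_ex:
  assumes "AE x in torus_measure. P x" "open V" "V \<noteq> {}" "V \<subseteq> {x. \<forall>i. 0 \<le> x $ i \<and> x $ i < 1}"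
  shows "\<exists>x\<in>V. P x"
proof (rule ccontr)
  assume "\<not> (\<exists>x\<in>V. P x)"
  then have no: "\<not> P x" if "x \<in> V" for x using that by blast
  have m: "{x::real^2. \<forall>i. 0 \<le> x $ i \<and> x $ i < 1} \<in> sets lborel" 
  proof -
    have "{x::real^2. \<forall>i. 0 \<le> x $ i \<and> x $ i < 1} = (\<Inter>i. {x. 0 \<le> x $ i} \<inter> {x. x $ i < 1})" by auto
    moreover have "{x::real^2. 0 \<le> x $ i} \<inter> {x. x $ i < 1} \<in> sets borel" for i
      by (intro sets.Int borel_closed borel_open closed_Collect_le open_Collect_less continuous_intros)
    ultimately show ?thesis by (simp add: sets.finite_INT)
  qed
  have "AE x in lborel. (\<forall>i. 0 \<le> x $ i \<and> x $ i < 1) \<longrightarrow> P x"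
    using assms(1) m unfolding torus_measure_def by (subst (asm) AE_restrict_space_iff) auto
  then have "AE x in lborel. x \<notin> V"
    by (rule AE_mp) (use no assms(4) in \<open>auto intro!: AE_I2\<close>)
  then have "V \<in> null_sets lborel"
    using assms(2) by (subst (asm) AE_iff_null_sets[symmetric]) auto
  then have "negligible V"
    using negligible_iff_null_sets null_sets_completionI by blast
  with assms(2,3) show False using open_not_negligible by blast
qed

context
  fixes g :: "real^2 \<Rightarrow> 'b::real_normed_vector"
  assumes per: "torus_fun g" and cont: "continuous_on UNIV g"
begin

text \<open>A continuous periodic function is bounded, so the essential supremum is finite and its
  conversion to a real loses nothing.\<close>

lemma esssup_norm_eq: "esssup torus_measure (\<lambda>x. ereal (norm (g x))) = ereal (Linf_norm g)"
proof -
  obtain B where B: "\<And>x. norm (g x) \<le> B" using torus_fun_bounded[OF per cont] by blast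
  let ?s = "esssup torus_measure (\<lambda>x. ereal (norm (g x)))"
  have meas: "(\<lambda>x. ereal (norm (g x))) \<in> borel_measurable torus_measure"
    unfolding torus_measure_def using cont
    by (intro measurable_restrict_space1 borel_measurable_ereal)
       (simp add: borel_measurable_continuous_onI continuous_on_norm)
  have "?s \<le> ereal B"
    by (rule esssup_I[OF meas]) (use B in auto)
  moreover have "\<exists>x\<in>box 0 1. ereal (norm (g x)) \<le> ?s"
  proof (rule torus_measure_AE_imp_ex[OF esssup_AE open_box])
    have "(\<chi> i. 1 / 2) \<in> box (0::real^2) 1" by (simp add: mem_box_cart)
    then show "box (0::real^2) 1 \<noteq> {}" by blast
  qed (auto simp: mem_box_cart less_imp_le)
  then have "0 \<le> ?s" by (meson ereal_less_eq(5) norm_ge_zero order_trans)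
  ultimately have "\<bar>?s\<bar> \<noteq> \<infinity>" by auto
  then show ?thesis unfolding Linf_norm_def by (simp add: ereal_real')
qed

lemma norm_le_Linf: "norm (g x) \<le> Linf_norm g"
proof (rule ccontr)
  assume less: "\<not> norm (g x) \<le> Linf_norm g"
  define y where "y = x - (\<chi> i. of_int \<lfloor>x $ i\<rfloor>)"
  have gy: "norm (g y) > Linf_norm g" using less torus_fun_floor[OF per, of x] by (simp add: y_def)
  have y: "0 \<le> y $ i" "y $ i < 1" for i
    by (simp_all add: y_def) (linarith+)
  define V where "V = {z. norm (g z) > Linf_norm g} \<inter> box 0 1"
  have "open {z. norm (g z) > Linf_norm g}"
    using cont by (intro open_Collect_less continuous_intros)
  then have V: "open V" unfolding V_def by (intro open_Int open_box)
  \<comment> \<open>The representative \<open>y\<close> may lie on an edge of the half-open square.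
    A small diagonal push moves it into the interior and keeps the strict inequality.\<close>
  have "((\<lambda>t. norm (g (y + t *\<^sub>R (1::real^2)))) \<longlongrightarrow> norm (g (y + 0 *\<^sub>R 1))) (at_right 0)"
  proof (rule tendsto_norm, rule isCont_tendsto_compose[of _ g])
    show "isCont g (y + 0 *\<^sub>R 1)" using cont by (simp add: continuous_on_eq_continuous_at)
  qed (intro tendsto_intros)
  then have "\<forall>\<^sub>F t in at_right 0. norm (g (y + t *\<^sub>R (1::real^2))) > Linf_norm g"
    by (rule order_tendstoD(1)) (use gy in simp)
  moreover have "\<forall>\<^sub>F t in at_right 0. y + t *\<^sub>R (1::real^2) \<in> box 0 1"
  proof -
    have "\<forall>\<^sub>F t in at_right (0::real). t < 1 - y $ 1" "\<forall>\<^sub>F t in at_right (0::real). t < 1 - y $ 2"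
      using y by (auto intro!: eventually_at_right_less order_tendstoD(2)[of "\<lambda>t. t", OF tendsto_ident_at])
    moreover have "\<forall>\<^sub>F t in at_right (0::real). t > 0" by (rule eventually_at_right_less)
    ultimately show ?thesis
    proof eventually_elim
      case (elim t)
      then show ?case using y(1)[of 1] y(1)[of 2] by (simp add: mem_box_cart forall_2)
    qed
  qed
  ultimately have "\<forall>\<^sub>F t in at_right 0. y + t *\<^sub>R (1::real^2) \<in> V"
    by eventually_elim (simp add: V_def)
  then obtain t where "y + t *\<^sub>R (1::real^2) \<in> V"
    using eventually_happens'[OF trivial_limit_at_right_real] by blast
  then have "V \<noteq> {}" by blast
  moreover have "V \<subseteq> {x. \<forall>i. 0 \<le> x $ i \<and> x $ i < 1}" by (auto simp: V_def mem_box_cart less_imp_le)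
  ultimately have "\<exists>z\<in>V. ereal (norm (g z)) \<le> esssup torus_measure (\<lambda>x. ereal (norm (g x)))"
    by (intro torus_measure_AE_imp_ex[OF esssup_AE V])
  then show False by (auto simp: esssup_norm_eq V_def)
qed

lemma Linf_le:
  assumes "\<And>x. norm (g x) \<le> c" shows "Linf_norm g \<le> c"
proof -
  have meas: "(\<lambda>x. ereal (norm (g x))) \<in> borel_measurable torus_measure"
    unfolding torus_measure_def using cont
    by (intro measurable_restrict_space1 borel_measurable_ereal)
       (simp add: borel_measurable_continuous_onI continuous_on_norm)
  have "ereal (Linf_norm g) \<le> ereal c"
    unfolding esssup_norm_eq[symmetric] by (rule esssup_I[OF meas]) (use assms in auto)
  then show ?thesis by simp
qed

lemma Linf_nonneg: "0 \<le> Linf_norm g"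
  using norm_le_Linf[of 0] norm_ge_zero order_trans by blast

end

section \<open>Hoelder functions on the torus\<close>

lemma torus_dist_le: "torus_dist x y \<le> dist x y"
proof -
  have "(0::real^2) \<in> int_lattice" by (simp add: int_lattice_def)
  then have "y \<in> {y + k |k. k \<in> int_lattice}" by force
  then show ?thesis unfolding torus_dist_def by (rule infdist_le)
qed

lemma torus_dist_nonneg: "0 \<le> torus_dist x y"
  unfolding torus_dist_def by (rule infdist_nonneg)

text \<open>The constant of \<open>torus_holder\<close> makes the supremum in
  \<open>holder_seminorm\<close> a genuine one, and forces equal values at torus distance 0. The
  slack \<open>H'\<close> later allows the maximum of seminorm and sup norm.\<close>

lemma torus_holder_bound:
  assumes "torus_holder \<alpha> g" "0 < \<alpha>" "H' \<ge> holder_seminorm \<alpha> g" "H' \<ge> 0"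
  shows "\<bar>g x - g y\<bar> \<le> H' * norm (x - y) powr \<alpha>"
proof -
  obtain K where K: "\<And>x y. \<bar>g x - g y\<bar> \<le> K * torus_dist x y powr \<alpha>"
    using assms(1) unfolding torus_holder_def by blast
  let ?S = "{\<bar>g x - g y\<bar> / torus_dist x y powr \<alpha> |x y. torus_dist x y > 0}"
  have bdd: "bdd_above ?S"
    by (rule bdd_aboveI[of _ K]) (use K in \<open>auto simp: pos_divide_le_eq\<close>)
  have "\<bar>g x - g y\<bar> \<le> H' * torus_dist x y powr \<alpha>"
  proof (cases "torus_dist x y = 0")
    case True
    then show ?thesis using K[of x y] assms(2) by simp
  next
    case False
    then have pos: "torus_dist x y > 0" using torus_dist_nonneg[of x y] by simp
    then have "\<bar>g x - g y\<bar> / torus_dist x y powr \<alpha> \<in> ?S" by blast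
    from cSup_upper[OF this bdd] have "\<bar>g x - g y\<bar> / torus_dist x y powr \<alpha> \<le> holder_seminorm \<alpha> g"
      unfolding holder_seminorm_def .
    then show ?thesis using pos assms(3) by (simp add: pos_divide_le_eq)
      (smt (verit) mult_right_mono powr_ge_zero)
  qed
  also have "\<dots> \<le> H' * norm (x - y) powr \<alpha>"
    using torus_dist_le[of x y] torus_dist_nonneg[of x y] assms
    by (intro mult_left_mono powr_mono2) (auto simp: dist_norm)
  finally show ?thesis .
qed

lemma torus_holder_continuous:
  assumes "torus_holder \<alpha> g" "0 < \<alpha>"
  shows "continuous_on UNIV g"
proof -
  define H where "H = max (holder_seminorm \<alpha> g) 0"
  have b: "norm (g y - g x) \<le> H * norm (y - x) powr \<alpha>" for x y
    using torus_holder_bound[OF assms, of H y x] by (simp add: H_def)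
  have "isCont g x" for x
  proof -
    have "((\<lambda>y. norm (y - x)) \<longlongrightarrow> norm (x - x)) (at x)" by (intro tendsto_intros)
    then have "((\<lambda>y. norm (y - x) powr \<alpha>) \<longlongrightarrow> 0) (at x)"
      by (intro tendsto_zero_powrI[OF _ tendsto_const _ assms(2)]) auto
    then have "((\<lambda>y. H * norm (y - x) powr \<alpha>) \<longlongrightarrow> 0) (at x)"
      by (rule tendsto_mult_right_zero)
    then have "((\<lambda>y. g y - g x) \<longlongrightarrow> 0) (at x)"
      by (rule Lim_null_comparison[rotated]) (use b in auto)
    then show ?thesis unfolding isCont_def by (rule LIM_zero_cancel)
  qed
  then show ?thesis by (simp add: continuous_on_eq_continuous_at)
qed

section \<open>Passage to planar coordinates\<close>

lemma tempered_emb: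
  assumes "continuous_on UNIV k" "\<And>x. \<bar>k x\<bar> \<le> B"
  shows "tempered (\<lambda>p. c * k (emb p))"
proof (rule temperedI)
  show "continuous_on UNIV (\<lambda>p. c * k (emb p))"
    by (intro continuous_intros continuous_on_compose2[OF assms(1) continuous_emb]) auto
  show "\<bar>c * k (emb p)\<bar> \<le> (\<bar>c\<bar> * B) * growth p ^ 0" for p
    using assms(2)[of "emb p"] by (simp add: abs_mult mult_left_mono)
qed

lemma C1_emb:
  assumes D: "\<And>x. (u has_derivative D x) (at x)"
    and tempered: "tempered (\<lambda>p. c * u (emb p))" "tempered (\<lambda>p. c * D (emb p) (axis 1 1))" "tempered (\<lambda>p. c * D (emb p) (axis 2 1))"
  shows "C1 (\<lambda>p. c * u (emb p)) (\<lambda>p. c * D (emb p) (axis 1 1)) (\<lambda>p. c * D (emb p) (axis 2 1))"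
  unfolding C1_def
proof (intro conjI allI tempered)
  fix p
  interpret D: bounded_linear "D (emb p)" using D by (rule has_derivative_bounded_linear)
  have "((\<lambda>p. u (emb p)) has_derivative (\<lambda>v. D (emb p) (emb v))) (at p)"
    by (rule has_derivative_compose[OF has_derivative_emb D])
  then have "((\<lambda>p. c * u (emb p)) has_derivative (\<lambda>v. c * D (emb p) (emb v))) (at p)"
    by (rule has_derivative_mult_right)
  moreover have "c * D (emb p) (emb v) = fst v * (c * D (emb p) (axis 1 1)) + snd v * (c * D (emb p) (axis 2 1))" for v
    unfolding emb_def[of v] D.add D.scaleR by (simp add: algebra_simps)
  ultimately show "((\<lambda>p. c * u (emb p)) has_derivative
      (\<lambda>v. fst v * (c * D (emb p) (axis 1 1)) + snd v * (c * D (emb p) (axis 2 1)))) (at p)"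
    by (simp only:)
qed

text \<open>By Rolle's theorem the derivative of a periodic function vanishes on every unit segment.\<close>

lemma periodic_derivative_bound:
  fixes F F' F'' :: "real \<Rightarrow> real"
  assumes d1: "\<And>s. (F has_real_derivative F' s) (at s)" and d2: "\<And>s. (F' has_real_derivative F'' s) (at s)"
    and per: "F 1 = F 0" and bnd: "\<And>s. \<bar>F'' s\<bar> \<le> N"
  shows "\<bar>F' 0\<bar> \<le> N"
proof -
  have "\<exists>z>0. z < 1 \<and> F 1 - F 0 = (1 - 0) * F' z" by (rule MVT2) (auto intro: d1)
  then obtain z where z: "0 < z" "z < 1" "F' z = 0" using per by auto
  have "\<exists>y>0. y < z \<and> F' z - F' 0 = (z - 0) * F'' y" by (rule MVT2) (use z in \<open>auto intro: d2\<close>)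
  then obtain y where "F' z - F' 0 = z * F'' y" by auto
  then have "\<bar>F' 0\<bar> = z * \<bar>F'' y\<bar>" using z by (simp add: abs_mult flip: abs_minus_cancel[of "F' 0"])
  also have "\<dots> \<le> 1 * N" using z bnd[of y] by (intro mult_mono) auto
  finally show ?thesis by simp
qed

text \<open>Interpolates between the trivial oscillation bound and the Hoelder bound
  \<open>M * u\<^sup>2\<close>. The square root built into \<open>u\<close> halves the exponent
  \<alpha>, as square-root growth demands.\<close>

lemma min_le_modulus:
  fixes d M u :: real
  assumes "M \<ge> 0" "u \<ge> 0" "d \<le> 2 * M" "d \<le> M * u\<^sup>2"
  shows "d \<le> 4 * M * (u / (1 + u))"
proof (cases "u \<le> 1")
  case True
  have "d \<le> M * (u * u)" using assms(4) by (simp add: power2_eq_square)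
  also have "\<dots> \<le> M * (4 * (u / (1 + u)))"
  proof (rule mult_left_mono[OF _ assms(1)])
    have "u * u * (1 + u) \<le> u * 1 * 2" using True assms(2) by (intro mult_mono) auto
    then have "u * u * (1 + u) \<le> 4 * u" using assms(2) by simp
    then show "u * u \<le> 4 * (u / (1 + u))" using assms(2) by (simp add: pos_le_divide_eq)
  qed
  also have "\<dots> = 4 * M * (u / (1 + u))" by (simp only: mult_ac)
  finally show ?thesis .
next
  case False
  have "2 * M \<le> M * (4 * (u / (1 + u)))"
  proof -
    have "2 \<le> 4 * (u / (1 + u))" using False by (simp add: pos_le_divide_eq)
    from mult_left_mono[OF this assms(1)] show ?thesis by (simp only: mult.commute)
  qed
  also have "\<dots> = 4 * M * (u / (1 + u))" by (simp only: mult_ac)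
  finally show ?thesis using assms(3) by linarith
qed

text \<open>The maximum with \<open>M\<close> makes the ratio at least 1. Then
  \<open>sqrt h * (1 + R)\<close> dominates the argument, and its logarithm splits into
  \<open>log_plus\<close> and a universal constant.\<close>

lemma ln_modulus_le:
  assumes M: "M > 0" and \<alpha>: "0 < \<alpha>" "\<alpha> \<le> 1" and R: "R \<ge> 1"
  shows "ln (1 + sqrt (max H M / M) * R powr (\<alpha> / 2)) \<le> (ln (1 + R) + 1) * (1 + log_plus (H / M))"
proof -
  define h where "h = max H M / M"
  have h1: "h \<ge> 1" using M by (simp add: h_def)
  have lp: "ln h \<le> log_plus (H / M)"
  proof (cases "H \<le> M")
    case True
    then have "h = 1" using M by (simp add: h_def)
    then show ?thesis by (simp add: log_plus_def)
  next
    case False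
    then have "h = H / M" "H / M \<noteq> 0" using M by (auto simp: h_def)
    then show ?thesis by (simp add: log_plus_def)
  qed
  have lp0: "log_plus (H / M) \<ge> 0" by (simp add: log_plus_def)
  have sh: "1 \<le> sqrt h" using h1 by simp
  have "R powr (\<alpha> / 2) \<le> R powr 1" using R \<alpha> by (intro powr_mono) auto
  then have "sqrt h * R powr (\<alpha> / 2) \<le> sqrt h * R" using sh R by (intro mult_left_mono) auto
  then have "1 + sqrt h * R powr (\<alpha> / 2) \<le> sqrt h * (1 + R)" unfolding distrib_left using sh by linarith
  moreover have "0 < 1 + sqrt h * R powr (\<alpha> / 2)" using sh by (intro add_pos_nonneg mult_nonneg_nonneg) auto
  ultimately have "ln (1 + sqrt h * R powr (\<alpha> / 2)) \<le> ln (sqrt h * (1 + R))" by (intro ln_mono) auto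
  also have "\<dots> = ln h / 2 + ln (1 + R)" using h1 R by (simp add: ln_mult ln_sqrt)
  also have "\<dots> \<le> 1 * log_plus (H / M) + ln (1 + R)" using lp lp0 by simp
  also have "\<dots> \<le> (ln (1 + R) + 1) * (1 + log_plus (H / M))"
  proof -
    have "0 \<le> ln (1 + R) * log_plus (H / M)" using R lp0 by (intro mult_nonneg_nonneg ln_ge_zero) auto
    then show ?thesis by (simp add: algebra_simps)
  qed
  finally show ?thesis by (simp only: h_def)
qed

lemma norm_matrix_le: "norm (A :: real^2^2) \<le> \<bar>A$1$1\<bar> + \<bar>A$1$2\<bar> + (\<bar>A$2$1\<bar> + \<bar>A$2$2\<bar>)"
proof -
  have "norm A \<le> norm (A$1) + norm (A$2)"
    unfolding norm_vec_def[of A] using L2_set_le_sum[of UNIV "\<lambda>i. norm (A $ i)"] by (simp add: sum_2)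
  moreover have "norm (A$i) \<le> \<bar>A$i$1\<bar> + \<bar>A$i$2\<bar>" for i
    using norm_le_l1_cart[of "A$i"] by (simp add: sum_2)
  ultimately show ?thesis by (meson add_mono order_trans)
qed

text \<open>Both halves of the theorem at once: the scale analysis is run for
  \<open>\<epsilon> * \<psi>\<close>, while \<open>h\<close> depends only on the ratio of seminorm
  and sup norm of \<rho>, so \<epsilon> enters linearly on both sides and cancels.\<close>

lemma hessian_estimate:
  fixes \<psi> \<rho> :: "real^2 \<Rightarrow> real"
  assumes \<alpha>: "0 < \<alpha>" "\<alpha> \<le> 1" and \<epsilon>: "\<epsilon> > 0" and \<psi>: "torus_C2 \<psi>" and \<rho>: "torus_holder \<alpha> \<rho>"
    and eqn: "\<And>x. det (mat 1 + \<epsilon> *\<^sub>R hessian \<psi> x) = 1 + \<epsilon> * \<rho> x"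
    and small: "\<epsilon> * Linf_norm (hessian \<psi>) \<le> 1 / (128 * bound_const)"
  shows "Linf_norm (hessian \<psi>) \<le> (40 * bound_const / \<alpha> * (ln (1 + outer_scale) + 1)) * log_bound (Linf_norm \<rho>) (holder_seminorm \<alpha> \<rho>)"
proof -
  define M H where "M = Linf_norm \<rho>" and "H = holder_seminorm \<alpha> \<rho>"
  define N where "N = \<epsilon> * Linf_norm (hessian \<psi>)"
  \<comment> \<open>Makes \<open>M * (h * r powr (\<alpha> / 2))\<^sup>2\<close> equal to
    \<open>max H M * r powr \<alpha>\<close> when \<open>M > 0\<close>; for \<open>M = 0\<close>
    division by zero gives \<open>h = 0\<close>.\<close>
  define h where "h = sqrt (max H M / M)"
  have per: "torus_fun \<psi>" and diff: "\<And>x. \<psi> differentiable (at x)" "\<And>x. gradient \<psi> differentiable (at x)"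
    and cont_hess: "continuous_on UNIV (hessian \<psi>)"
    using \<psi> by (auto simp: torus_C2_def differentiable_on_def)
  have D: "(\<psi> has_derivative frechet_derivative \<psi> (at x)) (at x)" for x
    using diff(1) frechet_derivative_works by blast
  have Dg: "(gradient \<psi> has_derivative frechet_derivative (gradient \<psi>) (at x)) (at x)" for x
    using diff(2) frechet_derivative_works by blast
  have cont: "continuous_on UNIV \<psi>" "continuous_on UNIV (gradient \<psi>)"
    using diff by (auto intro!: differentiable_imp_continuous_on simp: differentiable_on_def)
  note perg = torus_fun_gradient[OF per] and perh = torus_fun_hessian[OF per]
  have grad: "frechet_derivative \<psi> (at x) (axis i 1) = gradient \<psi> x $ i" for x i
    by (simp add: gradient_def)
  have hess: "frechet_derivative (gradient \<psi>) (at x) (axis j 1) $ i = hessian \<psi> x $ i $ j" for x i j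
    by (simp add: hessian_def jacobian_def matrix_def)
  have hess_N: "\<bar>\<epsilon> * hessian \<psi> x $ i $ j\<bar> \<le> N" for x i j
  proof -
    have "\<bar>hessian \<psi> x $ i $ j\<bar> \<le> norm (hessian \<psi> x $ i)" by (rule component_le_norm_cart)
    also have "\<dots> \<le> norm (hessian \<psi> x)" by (rule Finite_Cartesian_Product.norm_nth_le)
    also have "\<dots> \<le> Linf_norm (hessian \<psi>)" by (rule norm_le_Linf[OF perh cont_hess])
    finally show ?thesis using \<epsilon> by (simp add: N_def abs_mult)
  qed
  define w w1 w2 where "w p = \<epsilon> * \<psi> (emb p)" and "w1 p = \<epsilon> * gradient \<psi> (emb p) $ 1"
    and "w2 p = \<epsilon> * gradient \<psi> (emb p) $ 2" for p
  define w11 w12 w21 w22 where "w11 p = \<epsilon> * hessian \<psi> (emb p) $ 1 $ 1" and "w12 p = \<epsilon> * hessian \<psi> (emb p) $ 1 $ 2"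
    and "w21 p = \<epsilon> * hessian \<psi> (emb p) $ 2 $ 1" and "w22 p = \<epsilon> * hessian \<psi> (emb p) $ 2 $ 2" for p
  have tempered_w: "tempered (\<lambda>p. \<epsilon> * \<psi> (emb p))"
    using torus_fun_bounded[OF per cont(1)] by (metis tempered_emb[OF cont(1)] real_norm_def)
  have tempered_g: "tempered (\<lambda>p. \<epsilon> * gradient \<psi> (emb p) $ i)" for i
  proof -
    obtain B where "\<And>x. norm (gradient \<psi> x) \<le> B" using torus_fun_bounded[OF perg cont(2)] by blast
    then have "\<bar>gradient \<psi> x $ i\<bar> \<le> B" for x by (rule order.trans[OF component_le_norm_cart])
    then show ?thesis by (intro tempered_emb[where B = B] continuous_intros cont)
  qed
  have tempered_h: "tempered (\<lambda>p. \<epsilon> * hessian \<psi> (emb p) $ i $ j)" for i j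
  proof -
    have "\<bar>hessian \<psi> x $ i $ j\<bar> \<le> N / \<epsilon>" for x
      using hess_N[of x i j] \<epsilon> by (simp add: abs_mult pos_le_divide_eq mult.commute)
    then show ?thesis by (intro tempered_emb[where B = "N / \<epsilon>"] continuous_intros cont_hess)
  qed
  have C1_w: "C1 w w1 w2"
    using C1_emb[OF D, of \<epsilon>] tempered_w tempered_g by (simp add: grad w_def[abs_def] w1_def[abs_def] w2_def[abs_def])
  have C1_g: "C1 (\<lambda>p. \<epsilon> * gradient \<psi> (emb p) $ i) (\<lambda>p. \<epsilon> * hessian \<psi> (emb p) $ i $ 1) (\<lambda>p. \<epsilon> * hessian \<psi> (emb p) $ i $ 2)" for i
  proof -
    have "((\<lambda>x. gradient \<psi> x $ i) has_derivative (\<lambda>v. frechet_derivative (gradient \<psi>) (at x) v $ i)) (at x)" for x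
      using bounded_linear.has_derivative[OF bounded_linear_vec_nth Dg] .
    from C1_emb[OF this, of \<epsilon>] show ?thesis using tempered_g tempered_h by (simp add: hess)
  qed
  have C1_w1: "C1 w1 w11 w12" and C1_w2': "C1 w2 w21 w22"
    using C1_g[of 1] C1_g[of 2]
    by (simp_all add: w1_def[abs_def] w2_def[abs_def] w11_def[abs_def] w12_def[abs_def] w21_def[abs_def] w22_def[abs_def])
  have "w12 = w21" by (rule ext) (rule mixed_partials_eq[OF C1_w C1_w1 C1_w2'])
  with C1_w2' have C1_w2: "C1 w2 w12 w22" by simp
  have sym: "hessian \<psi> x $ 2 $ 1 = hessian \<psi> x $ 1 $ 2" for x
    using fun_cong[OF \<open>w12 = w21\<close>, of "(x $ 1, x $ 2)"] \<epsilon> by (simp add: w12_def w21_def emb_surj)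
  have bnd2: "\<bar>w11 p\<bar> \<le> N" "\<bar>w12 p\<bar> \<le> N" "\<bar>w22 p\<bar> \<le> N" for p
    by (simp_all only: w11_def w12_def w22_def hess_N)
  have per_w: "w (p + emb0) = w p" if "emb emb0 \<in> int_lattice" for p emb0
    using per that by (simp add: w_def emb_add torus_fun_def)
  \<comment> \<open>The periods have length 1, so the gradient inherits the Hessian bound
    \<open>N\<close> without a further constant.\<close>
  have bnd1: "\<bar>w1 p\<bar> \<le> N" "\<bar>w2 p\<bar> \<le> N" for p
  proof -
    have "emb (1, 0) \<in> int_lattice" "emb (0, 1) \<in> int_lattice"
      by (simp_all add: int_lattice_def forall_2)
    then have e: "w (p + 1 *\<^sub>R (1, 0)) = w (p + 0 *\<^sub>R (1, 0))" "w (p + 1 *\<^sub>R (0, 1)) = w (p + 0 *\<^sub>R (0, 1))"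
      using per_w by (simp_all add: zero_prod_def[symmetric])
    have "\<bar>w1 (p + 0 *\<^sub>R (1, 0))\<bar> \<le> N"
      by (rule periodic_derivative_bound[where F = "\<lambda>s. w (p + s *\<^sub>R (1, 0))" and F' = "\<lambda>s. w1 (p + s *\<^sub>R (1, 0))"
            and F'' = "\<lambda>s. w11 (p + s *\<^sub>R (1, 0))"])
         (use C1_line[OF C1_w, of p "(1, 0)"] C1_line[OF C1_w1, of p "(1, 0)"] e bnd2 in auto)
    then show "\<bar>w1 p\<bar> \<le> N" by (simp add: zero_prod_def[symmetric])
    have "\<bar>w2 (p + 0 *\<^sub>R (0, 1))\<bar> \<le> N"
      by (rule periodic_derivative_bound[where F = "\<lambda>s. w (p + s *\<^sub>R (0, 1))" and F' = "\<lambda>s. w2 (p + s *\<^sub>R (0, 1))"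
            and F'' = "\<lambda>s. w22 (p + s *\<^sub>R (0, 1))"])
         (use C1_line[OF C1_w, of p "(0, 1)"] C1_line[OF C1_w2, of p "(0, 1)"] e bnd2 in auto)
    then show "\<bar>w2 p\<bar> \<le> N" by (simp add: zero_prod_def[symmetric])
  qed
  have per_\<rho>: "torus_fun \<rho>" using \<rho> by (simp add: torus_holder_def)
  note cont_\<rho> = torus_holder_continuous[OF \<rho> \<alpha>(1)]
  have \<rho>_M: "\<bar>\<rho> x\<bar> \<le> M" for x using norm_le_Linf[OF per_\<rho> cont_\<rho>, of x] by (simp add: M_def)
  have M0: "M \<ge> 0" unfolding M_def by (rule Linf_nonneg[OF per_\<rho> cont_\<rho>])
  have h0: "h \<ge> 0" using M0 by (simp add: h_def)
  define f where "f p = \<epsilon> * \<rho> (emb p)" for p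
  have tempered_f: "tempered f" unfolding f_def[abs_def] by (rule tempered_emb[OF cont_\<rho> \<rho>_M])
  have MA: "w11 p + w22 p + w11 p * w22 p - w12 p * w12 p = f p" for p
    using eqn[of "emb p"] by (simp add: det_2 mat_def sym w11_def w22_def w12_def f_def algebra_simps)
  have osc: "\<bar>f (x + y) - f x\<bar> \<le> (4 * (\<epsilon> * M)) *
      (h * (\<bar>fst y\<bar> + \<bar>snd y\<bar>) powr (\<alpha> / 2) / (1 + h * (\<bar>fst y\<bar> + \<bar>snd y\<bar>) powr (\<alpha> / 2)))" for x y
  proof -
    define r where "r = \<bar>fst y\<bar> + \<bar>snd y\<bar>"
    define u where "u = h * r powr (\<alpha> / 2)"
    have u0: "u \<ge> 0" using h0 by (simp add: u_def)
    let ?d = "\<bar>\<rho> (emb (x + y)) - \<rho> (emb x)\<bar>"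
    have d1: "?d \<le> 2 * M" using \<rho>_M[of "emb (x + y)"] \<rho>_M[of "emb x"] by linarith
    have d2: "?d \<le> M * u\<^sup>2"
    proof (cases "M = 0")
      case True
      then show ?thesis using d1 by simp
    next
      case False
      then have Mp: "M > 0" using M0 by simp
      have "?d \<le> max H M * norm (emb (x + y) - emb x) powr \<alpha>"
        by (rule torus_holder_bound[OF \<rho> \<alpha>(1)]) (use M0 in \<open>auto simp: H_def\<close>)
      also have "\<dots> \<le> max H M * r powr \<alpha>"
        using norm_emb_le[of y] \<alpha> M0 by (intro mult_left_mono powr_mono2) (auto simp: emb_add r_def)
      also have "\<dots> = M * u\<^sup>2"
      proof -
        have "r powr \<alpha> = (r powr (\<alpha> / 2))\<^sup>2" by (simp add: power2_eq_square flip: powr_add)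
        then show ?thesis using Mp by (simp add: u_def h_def power_mult_distrib)
      qed
      finally show ?thesis .
    qed
    have "\<bar>f (x + y) - f x\<bar> = \<epsilon> * ?d"
      using \<epsilon> by (simp add: f_def abs_mult flip: right_diff_distrib)
    also have "\<dots> \<le> \<epsilon> * (4 * M * (u / (1 + u)))"
      using \<epsilon> by (intro mult_left_mono min_le_modulus M0 u0 d1 d2) auto
    finally show ?thesis by (simp add: u_def r_def mult_ac)
  qed
  have N0: "N \<ge> 0" using Linf_nonneg[OF perh cont_hess] \<epsilon> by (simp add: N_def)
  define L where "L = ln (1 + h * outer_scale powr (\<alpha> / 2))"
  have L0: "L \<ge> 0" unfolding L_def using h0 by (intro ln_ge_zero) simp
  have N_le: "N \<le> \<epsilon> * (40 * bound_const / \<alpha> * M * L)"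
  proof (cases "N = 0")
    case True
    then show ?thesis using \<epsilon> bound_const_pos \<alpha> M0 L0 by simp
  next
    case False
    then have Np: "N > 0" using N0 by simp
    define T where "T = bound_const * (4 * (\<epsilon> * M) / (\<alpha> / 2) * L)"
    have hb: "\<bar>w11 p\<bar> \<le> N / 32 + T" "\<bar>w12 p\<bar> \<le> N / 32 + T" "\<bar>w22 p\<bar> \<le> N / 32 + T" for p
      unfolding T_def L_def using small \<alpha> M0 h0 \<epsilon>
      by (intro hessian_log_bound[OF C1_w C1_w1 C1_w2 tempered_f Np _ bnd1 bnd2 MA _ _ _ _ osc]; simp add: N_def)+
    have "\<epsilon> * norm (hessian \<psi> x) \<le> 4 * (N / 32 + T)" for x
    proof -
      have "\<epsilon> * norm (hessian \<psi> x) \<le> \<epsilon> * (\<bar>hessian \<psi> x $ 1 $ 1\<bar> + \<bar>hessian \<psi> x $ 1 $ 2\<bar> + (\<bar>hessian \<psi> x $ 2 $ 1\<bar> + \<bar>hessian \<psi> x $ 2 $ 2\<bar>))"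
        using \<epsilon> by (intro mult_left_mono norm_matrix_le) auto
      also have "\<dots> = \<bar>w11 (x $ 1, x $ 2)\<bar> + \<bar>w12 (x $ 1, x $ 2)\<bar> + (\<bar>w12 (x $ 1, x $ 2)\<bar> + \<bar>w22 (x $ 1, x $ 2)\<bar>)"
        using \<epsilon> by (simp add: w11_def w12_def w22_def emb_surj sym abs_mult algebra_simps)
      also have "\<dots> \<le> 4 * (N / 32 + T)" 
        by (rule order.trans[OF add_mono[OF add_mono[OF hb(1,2)] add_mono[OF hb(2,3)]]]) simp
      finally show ?thesis .
    qed
    then have "norm (hessian \<psi> x) \<le> 4 * (N / 32 + T) / \<epsilon>" for x
      using \<epsilon> by (simp add: pos_le_divide_eq mult.commute)
    from Linf_le[OF perh cont_hess this] have "N \<le> 4 * (N / 32 + T)"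
      using \<epsilon> by (simp add: N_def pos_le_divide_eq mult.commute)
    moreover have "T \<ge> 0" unfolding T_def using bound_const_pos \<epsilon> M0 \<alpha> L0 by simp
    \<comment> \<open>Four entries give \<open>N \<le> N / 8 + 4 * T\<close>, hence
      \<open>N \<le> 32 / 7 * T\<close>, rounded up. The final 40 is this 5 times the
      \<open>4 / (1 / 2)\<close> inside \<open>T\<close>.\<close>
    ultimately have "N \<le> 5 * T" by simp
    also have "\<dots> = \<epsilon> * (40 * bound_const / \<alpha> * M * L)" by (simp add: T_def)
    finally show ?thesis .
  qed
  have "Linf_norm (hessian \<psi>) \<le> 40 * bound_const / \<alpha> * M * L"
    by (rule mult_left_le_imp_le[OF N_le[unfolded N_def] \<epsilon>])
  also have "\<dots> \<le> (40 * bound_const / \<alpha> * (ln (1 + outer_scale) + 1)) * log_bound M H"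
  proof (cases "M = 0")
    case False
    then have "L \<le> (ln (1 + outer_scale) + 1) * (1 + log_plus (H / M))"
      unfolding L_def h_def using M0 \<alpha> outer_scale_ge_1 by (intro ln_modulus_le) auto
    then have "40 * bound_const / \<alpha> * M * L \<le> 40 * bound_const / \<alpha> * M * ((ln (1 + outer_scale) + 1) * (1 + log_plus (H / M)))"
      using bound_const_pos \<alpha> M0 by (intro mult_left_mono) auto
    then show ?thesis using False by (simp add: log_bound_def mult_ac)
  qed (simp add: log_bound_def)
  finally show ?thesis by (simp only: M_def H_def)
qed

theorem proposition5p5:
  shows "\<exists>\<eta>\<^sub>0 c\<^sub>0 :: real. \<eta>\<^sub>0 > 0 \<and> c\<^sub>0 > 0 \<and>
    (\<forall>\<alpha>::real. 0 < \<alpha> \<and> \<alpha> \<le> 1 \<longrightarrow> (\<exists>C::real.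
      (\<forall>w f :: real^2 \<Rightarrow> real.
         torus_C2 w \<and> (LINT x|torus_measure. w x) = 0 \<and>
         (\<forall>x. det (mat 1 + hessian w x) = 1 + f x) \<and>
         (LINT x|torus_measure. f x) = 0 \<and>
         Linf_norm (hessian w) \<le> \<eta>\<^sub>0 \<and> Linf_norm f \<le> c\<^sub>0 \<and> torus_holder \<alpha> f
         \<longrightarrow> Linf_norm (hessian w) \<le> C * log_bound (Linf_norm f) (holder_seminorm \<alpha> f)) \<and>
      (\<forall>(\<epsilon>::real) (\<psi> :: real^2 \<Rightarrow> real) (\<rho> :: real^2 \<Rightarrow> real).
         \<epsilon> > 0 \<and> torus_C2 \<psi> \<and> (LINT x|torus_measure. \<psi> x) = 0 \<and>
         torus_holder \<alpha> \<rho> \<and> (LINT x|torus_measure. \<rho> x) = 0 \<and>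
         (\<forall>x. det (mat 1 + \<epsilon> *\<^sub>R hessian \<psi> x) = 1 + \<epsilon> * \<rho> x) \<and>
         \<epsilon> * Linf_norm (hessian \<psi>) \<le> \<eta>\<^sub>0 \<and> \<epsilon> * Linf_norm \<rho> \<le> c\<^sub>0
         \<longrightarrow> Linf_norm (hessian \<psi>) \<le> C * log_bound (Linf_norm \<rho>) (holder_seminorm \<alpha> \<rho>))))"
proof (rule exI[of _ "1 / (128 * bound_const)"], rule exI[of _ 1], intro conjI allI impI)
  \<comment> \<open>\<open>bound_const\<close> is built from a Gaussian moment, so the threshold is
    fixed before \<alpha>.\<close>
  show "1 / (128 * bound_const) > 0" using bound_const_pos by simp
  fix \<alpha> :: real
  assume \<alpha>: "0 < \<alpha> \<and> \<alpha> \<le> 1"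
  note est = hessian_estimate[of \<alpha>]
  show "\<exists>C::real.
      (\<forall>w f :: real^2 \<Rightarrow> real.
         torus_C2 w \<and> (LINT x|torus_measure. w x) = 0 \<and>
         (\<forall>x. det (mat 1 + hessian w x) = 1 + f x) \<and>
         (LINT x|torus_measure. f x) = 0 \<and>
         Linf_norm (hessian w) \<le> 1 / (128 * bound_const) \<and> Linf_norm f \<le> 1 \<and> torus_holder \<alpha> f
         \<longrightarrow> Linf_norm (hessian w) \<le> C * log_bound (Linf_norm f) (holder_seminorm \<alpha> f)) \<and>
      (\<forall>(\<epsilon>::real) (\<psi> :: real^2 \<Rightarrow> real) (\<rho> :: real^2 \<Rightarrow> real).
         \<epsilon> > 0 \<and> torus_C2 \<psi> \<and> (LINT x|torus_measure. \<psi> x) = 0 \<and>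
         torus_holder \<alpha> \<rho> \<and> (LINT x|torus_measure. \<rho> x) = 0 \<and>
         (\<forall>x. det (mat 1 + \<epsilon> *\<^sub>R hessian \<psi> x) = 1 + \<epsilon> * \<rho> x) \<and>
         \<epsilon> * Linf_norm (hessian \<psi>) \<le> 1 / (128 * bound_const) \<and> \<epsilon> * Linf_norm \<rho> \<le> 1
         \<longrightarrow> Linf_norm (hessian \<psi>) \<le> C * log_bound (Linf_norm \<rho>) (holder_seminorm \<alpha> \<rho>))"
  \<comment> \<open>The factor \<open>1 / \<alpha>\<close> is left by integrating the modulus of
    exponent \<open>\<alpha> / 2\<close> against dt / t.\<close>
  proof (rule exI[of _ "40 * bound_const / \<alpha> * (ln (1 + outer_scale) + 1)"], intro conjI allI impI; elim conjE)
    fix w f :: "real^2 \<Rightarrow> real"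
    assume "torus_C2 w" "torus_holder \<alpha> f" "Linf_norm (hessian w) \<le> 1 / (128 * bound_const)"
      "\<forall>x. det (mat 1 + hessian w x) = 1 + f x"
    then show "Linf_norm (hessian w) \<le> 40 * bound_const / \<alpha> * (ln (1 + outer_scale) + 1) * log_bound (Linf_norm f) (holder_seminorm \<alpha> f)"
      using \<alpha> by (intro est[where \<epsilon> = 1]) simp_all
  next
    fix \<epsilon> :: real and \<psi> \<rho> :: "real^2 \<Rightarrow> real"
    assume "\<epsilon> > 0" "torus_C2 \<psi>" "torus_holder \<alpha> \<rho>" "\<epsilon> * Linf_norm (hessian \<psi>) \<le> 1 / (128 * bound_const)"
      "\<forall>x. det (mat 1 + \<epsilon> *\<^sub>R hessian \<psi> x) = 1 + \<epsilon> * \<rho> x"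
    then show "Linf_norm (hessian \<psi>) \<le> 40 * bound_const / \<alpha> * (ln (1 + outer_scale) + 1) * log_bound (Linf_norm \<rho>) (holder_seminorm \<alpha> \<rho>)"
      using \<alpha> by (intro est[where \<epsilon> = \<epsilon>]) simp_all
  qed
qed simp

end
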